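(* Let $n\ge 2$, let $\Omega\subset\mathbb{R}^n$ be a bounded Lipschitz domain and let $1<p<\infty$. There exists a constant $c=c(n,p,\Omega)>0$ such that for all $P\in W^{1,p}_0(\underline{\mathrm{Curl}};\Omega,\mathbb{R}^{n\times n})$ we have $$\|P\|_{L^p(\Omega,\mathbb{R}^{n\times n})}\le c\,\Big(\|\operatorname{sym}P\|_{L^p(\Omega,\mathbb{R}^{n\times n})}+\|\underline{\mathrm{Curl}}\,P\|_{L^p(\Omega,(\mathfrak{so}(n))^n)}\Big).$$
   Context: A bounded Lipschitz domain is a bounded, open, connected set with Lipschitz boundary. $\mathfrak{so}(n)=\{A\in\mathbb{R}^{n\times n}: A^T=-A\}$; $\operatorname{sym}P=\frac12(P+P^T)$ and $\operatorname{skew}P=\frac12(P-P^T)$. Vectors, matrices and tensors carry the Euclidean (Frobenius) inner product and norm, denoted $\langle\cdot,\cdot\rangle$ and $\|\cdot\|$. For a vector field $v:\Omega\to\mathbb{R}^n$ the generalized curl is the distributional $\mathfrak{so}(n)$-valued field $(\underline{\mathrm{curl}}\,v)_{ij}=\partial_i v_j-\partial_j v_i$. For a matrix field $P:\Omega\to\mathbb{R}^{n\times n}$ it is applied row-wise: $(\underline{\mathrm{Curl}}\,P)_{ijk}=\partial_iP_{kj}-\partial_jP_{ki}$, $i,j,k=1,\dots,n$, regarded as an element of $(\mathfrak{so}(n))^n$ (one skew-symmetric matrix in the indices $i,j$ for each row index $k$). $\operatorname{Div}$ is the row-wise divergence, $(\operatorname{Div}Q)_i=\sum_j\partial_jQ_{ij}$.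 $W^{1,p}(\underline{\mathrm{Curl}};\Omega,\mathbb{R}^{n\times n})=\{P\in L^p(\Omega,\mathbb{R}^{n\times n}): \underline{\mathrm{Curl}}\,P\in L^p(\Omega,(\mathfrak{so}(n))^n)\}$. $W^{1,p}_0(\underline{\mathrm{Curl}};\Omega,\mathbb{R}^{n\times n})$ is the subspace of those $P\in W^{1,p}(\underline{\mathrm{Curl}};\Omega,\mathbb{R}^{n\times n})$ with vanishing generalized tangential trace $P\,\underline{\times}\,\nu=0$ on $\partial\Omega$, where $\nu$ is the outward unit normal and, for each row $P^Te_k$ of $P$, $(P^Te_k)\,\underline{\times}\,\nu=(P^Te_k)\otimes\nu-\nu\otimes(P^Te_k)$. (For fields regular up to the boundary this says $P\tau=0$ for every tangent vector $\tau$ of $\partial\Omega$.) The trace is understood in $W^{-1/p,p}(\partial\Omega)$, the dual of $W^{1-1/p',p'}(\partial\Omega)$ with $\frac1p+\frac1{p'}=1$, through $$\langle (P^Te_k)\,\underline{\times}\,\nu,Q\rangle_{\partial\Omega}=\int_\Omega -\langle\underline{\mathrm{curl}}(P^Te_k),\widetilde Q\rangle+2\langle P^Te_k,\operatorname{Div}(\operatorname{skew}\widetilde Q)\rangle\,dx,\qquad k=1,\dots,n,$$ for $Q\in W^{1-1/p',p'}(\partial\Omega,\mathbb{R}^{n\times n})$, where $\widetilde Q\in W^{1,p'}(\Omega,\mathbb{R}^{n\times n})$ is any extension of $Q$. Thus $P\,\underline{\times}\,\nu=0$ means that the right-hand side vanishes for all $k$ and all $\widetilde Q\in W^{1,p'}(\Omega,\mathbb{R}^{n\times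 n})$. *)

theory Defs
  imports "HOL-Analysis.Analysis"
begin

section \<open>Matrices\<close>

definition sym_part :: "real^'n^'n \<Rightarrow> real^'n^'n" where
  "sym_part A = (1/2) *\<^sub>R (A + transpose A)"

definition skew_part :: "real^'n^'n \<Rightarrow> real^'n^'n" where
  "skew_part A = (1/2) *\<^sub>R (A - transpose A)"


section \<open>Bounded Lipschitz domains\<close>

text \<open>
  Near each boundary point, after a rigid motion sending the unit vector \<open>e\<close> to the last
  coordinate direction, the set is the strict epigraph of a Lipschitz function \<open>\<gamma>\<close>; the hyperplane
  of the remaining coordinates is the orthogonal complement of \<open>e\<close>, so that the vertical and
  horizontal parts of \<open>x\<close> are \<open>x \<bullet> e\<close> and \<open>x - (x \<bullet> e) *\<^sub>R e\<close>.
\<close>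
definition lipschitz_boundary :: "'a::euclidean_space set \<Rightarrow> bool" where
  "lipschitz_boundary \<Omega> \<longleftrightarrow>
    (\<forall>x0 \<in> frontier \<Omega>. \<exists>e r L \<gamma>. norm e = 1 \<and> r > 0 \<and> L-lipschitz_on {y. y \<bullet> e = 0} \<gamma> \<and>
       \<Omega> \<inter> ball x0 r = {x \<in> ball x0 r. (\<gamma> (x - (x \<bullet> e) *\<^sub>R e) :: real) < x \<bullet> e})"

definition bounded_lipschitz_domain :: "'a::euclidean_space set \<Rightarrow> bool" where
  "bounded_lipschitz_domain \<Omega> \<longleftrightarrow>
    bounded \<Omega> \<and> open \<Omega> \<and> connected \<Omega> \<and> lipschitz_boundary \<Omega>"


section \<open>Lebesgue spaces\<close>

text \<open>
  Elements of \<open>Lp\<close> are functions rather than classes modulo null sets; values outside \<open>\<Omega>\<close> are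
  irrelevant. The norm of \<open>'b\<close> is the Euclidean one, hence the Frobenius norm for matrices and
  third-order tensors.
\<close>
definition Lp :: "real \<Rightarrow> 'a::euclidean_space set \<Rightarrow> ('a \<Rightarrow> 'b::euclidean_space) set" where
  "Lp p \<Omega> = {f \<in> borel_measurable (lebesgue_on \<Omega>).
               integrable (lebesgue_on \<Omega>) (\<lambda>x. norm (f x) powr p)}"

definition Lp_norm :: "real \<Rightarrow> 'a::euclidean_space set \<Rightarrow> ('a \<Rightarrow> 'b::euclidean_space) \<Rightarrow> real" where
  "Lp_norm p \<Omega> f = (LINT x|lebesgue_on \<Omega>. norm (f x) powr p) powr (1 / p)"

definition locally_integrable :: "'a::euclidean_space set \<Rightarrow> ('a \<Rightarrow> 'b::euclidean_space) \<Rightarrow> bool" where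
  "locally_integrable \<Omega> f \<longleftrightarrow> (\<forall>K. compact K \<and> K \<subseteq> \<Omega> \<longrightarrow> integrable (lebesgue_on K) f)"

definition conjugate_exponent :: "real \<Rightarrow> real" where
  "conjugate_exponent p = p / (p - 1)"


section \<open>Test functions and weak derivatives\<close>

definition partial :: "'n::finite \<Rightarrow> (real^'n \<Rightarrow> real) \<Rightarrow> real^'n \<Rightarrow> real" where
  "partial i f x = frechet_derivative f (at x) (axis i 1)"

primrec Ck :: "nat \<Rightarrow> (real^'n::finite \<Rightarrow> real) \<Rightarrow> bool" where
  "Ck 0 f \<longleftrightarrow> continuous_on UNIV f"
| "Ck (Suc k) f \<longleftrightarrow> (\<forall>x. f differentiable (at x)) \<and> (\<forall>i. Ck k (partial i f))"

definition test_function :: "(real^'n::finite) set \<Rightarrow> (real^'n \<Rightarrow> real) \<Rightarrow> bool" where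
  "test_function \<Omega> \<phi> \<longleftrightarrow> (\<forall>k. Ck k \<phi>) \<and>
     compact (closure {x. \<phi> x \<noteq> 0}) \<and> closure {x. \<phi> x \<noteq> 0} \<subseteq> \<Omega>"

text \<open>\<open>D i\<close> is the weak \<open>i\<close>-th partial derivative of \<open>f\<close>.\<close>
definition has_weak_gradient ::
    "(real^'n::finite) set \<Rightarrow> (real^'n \<Rightarrow> 'b::euclidean_space) \<Rightarrow> ('n \<Rightarrow> real^'n \<Rightarrow> 'b) \<Rightarrow> bool" where
  "has_weak_gradient \<Omega> f D \<longleftrightarrow>
     locally_integrable \<Omega> f \<and> (\<forall>i. locally_integrable \<Omega> (D i)) \<and>
     (\<forall>i \<phi>. test_function \<Omega> \<phi> \<longrightarrow>
        (LINT x|lebesgue_on \<Omega>. \<phi> x *\<^sub>R D i x) = - (LINT x|lebesgue_on \<Omega>. partial i \<phi> x *\<^sub>R f x))"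

definition W1p :: "real \<Rightarrow> (real^'n::finite) set \<Rightarrow> (real^'n \<Rightarrow> 'b::euclidean_space) set" where
  "W1p p \<Omega> = {f \<in> Lp p \<Omega>. \<exists>D. (\<forall>i. D i \<in> Lp p \<Omega>) \<and> has_weak_gradient \<Omega> f D}"

text \<open>Row-wise divergence of a matrix field, computed from its weak partial derivatives \<open>D\<close>.\<close>
definition Div :: "('n::finite \<Rightarrow> real^'n \<Rightarrow> real^'n^'n) \<Rightarrow> real^'n \<Rightarrow> real^'n" where
  "Div D x = (\<chi> i. \<Sum>j\<in>UNIV. D j x $ i $ j)"


section \<open>The generalized curl\<close>

text \<open>
  \<open>w\<close> represents the distribution \<open>(\<partial>\<^sub>i v\<^sub>j - \<partial>\<^sub>j v\<^sub>i)\<^sub>i\<^sub>j\<close>. It is determined almost everywhere on an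
  open \<open>\<Omega>\<close>, and is then automatically skew-symmetric almost everywhere.
\<close>
definition has_weak_curl ::
    "(real^'n::finite) set \<Rightarrow> (real^'n \<Rightarrow> real^'n) \<Rightarrow> (real^'n \<Rightarrow> real^'n^'n) \<Rightarrow> bool" where
  "has_weak_curl \<Omega> v w \<longleftrightarrow>
     locally_integrable \<Omega> v \<and> locally_integrable \<Omega> w \<and>
     (\<forall>i j \<phi>. test_function \<Omega> \<phi> \<longrightarrow>
        (LINT x|lebesgue_on \<Omega>. w x $ i $ j * \<phi> x)
        = - (LINT x|lebesgue_on \<Omega>. v x $ j * partial i \<phi> x - v x $ i * partial j \<phi> x))"

text \<open>
  The row index comes first: \<open>C x $ k\<close> is the curl of the \<open>k\<close>-th row of \<open>P\<close>, that is,
  \<open>C x $ k $ i $ j\<close> is \<open>\<partial>\<^sub>i P\<^sub>k\<^sub>j - \<partial>\<^sub>j P\<^sub>k\<^sub>i\<close>.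
\<close>
definition has_weak_Curl ::
    "(real^'n::finite) set \<Rightarrow> (real^'n \<Rightarrow> real^'n^'n) \<Rightarrow> (real^'n \<Rightarrow> real^'n^'n^'n) \<Rightarrow> bool" where
  "has_weak_Curl \<Omega> P C \<longleftrightarrow> (\<forall>k. has_weak_curl \<Omega> (\<lambda>x. row k (P x)) (\<lambda>x. C x $ k))"

definition W1p_Curl :: "real \<Rightarrow> (real^'n::finite) set \<Rightarrow> (real^'n \<Rightarrow> real^'n^'n) set" where
  "W1p_Curl p \<Omega> = {P \<in> Lp p \<Omega>. \<exists>C \<in> Lp p \<Omega>. has_weak_Curl \<Omega> P C}"

text \<open>
  Vanishing generalized tangential trace of a field \<open>v\<close> with weak curl \<open>w\<close>: the boundary pairing
  vanishes against all \<open>Q\<close>, where \<open>E\<close> is the weak gradient of the skew part of \<open>Q\<close>.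
\<close>
definition zero_tangential_trace ::
    "real \<Rightarrow> (real^'n::finite) set \<Rightarrow> (real^'n \<Rightarrow> real^'n) \<Rightarrow> (real^'n \<Rightarrow> real^'n^'n) \<Rightarrow> bool" where
  "zero_tangential_trace p \<Omega> v w \<longleftrightarrow>
     (\<forall>Q \<in> W1p (conjugate_exponent p) \<Omega>. \<forall>E.
        (\<forall>i. E i \<in> Lp (conjugate_exponent p) \<Omega>) \<and>
        has_weak_gradient \<Omega> (\<lambda>x. skew_part (Q x)) E \<longrightarrow>
        (LINT x|lebesgue_on \<Omega>. - (w x \<bullet> Q x) + 2 * (v x \<bullet> Div E x)) = 0)"

definition W1p_Curl_0 :: "real \<Rightarrow> (real^'n::finite) set \<Rightarrow> (real^'n \<Rightarrow> real^'n^'n) set" where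
  "W1p_Curl_0 p \<Omega> = {P \<in> W1p_Curl p \<Omega>.
     \<forall>C \<in> Lp p \<Omega>. has_weak_Curl \<Omega> P C \<longrightarrow>
       (\<forall>k. zero_tangential_trace p \<Omega> (\<lambda>x. row k (P x)) (\<lambda>x. C x $ k))}"

end

theory Submission
  imports Defs
begin

text \<open>
  The vanishing trace is tested with \<open>Q = \<phi> E\<^sub>i\<^sub>j\<close> for smooth \<open>\<phi>\<close> on the whole space, so the extension
  of \<open>P\<close> by zero has the extension of \<open>Curl P\<close> by zero as its weak curl. Write \<open>P = S + A\<close> with
  symmetric and skew parts. Then \<open>\<partial>\<^sub>i A\<^sub>a\<^sub>b = E\<^sub>i + \<partial>\<^sub>b S\<^sub>a\<^sub>i - \<partial>\<^sub>a S\<^sub>b\<^sub>i\<close>, where \<open>E\<^sub>i\<close> is a combination of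
  entries of \<open>Curl P\<close>, and \<open>A\<close> has to be bounded in \<open>L\<^sup>p\<close>, i.e. tested against smooth \<open>G\<close>.

  In place of singular integrals we use a random walk \<open>M\<close> on a lattice of mesh \<open>h\<close>, whose powers are
  a discrete heat flow. Telescoping \<open>\<integral> A M\<^sup>4\<^sup>k G\<close> in \<open>k\<close> produces, up to \<open>O(h\<^sup>3)\<close> per step, terms
  \<open>h\<^sup>2 \<integral> A \<Delta>M\<^sup>4\<^sup>k G\<close>, hence \<open>h\<^sup>2 \<integral> S \<partial>\<^sub>i\<partial>\<^sub>j M\<^sup>4\<^sup>k G\<close> and \<open>h\<^sup>2 \<integral> E \<partial>\<^sub>i M\<^sup>4\<^sup>k G\<close>. Sums of terms of the first kind are
  bounded by \<open>\<parallel>S\<parallel>\<^sub>p\<^sup>p + \<parallel>G\<parallel>\<^sub>q\<^sup>q\<close> uniformly in \<open>h\<close> and the number of steps, by a Bellman function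
  argument. Those of the second kind are reduced to the first by replacing \<open>G\<close> with
  \<open>G - G(\<cdot> + 2R e)\<close>, an integral of \<open>\<partial>\<^sub>e G\<close> along a segment; this does not change \<open>\<integral> A G\<close> because
  of the supports, and it also makes the flow decay. Finally \<open>h \<rightarrow> 0\<close> while the elapsed time
  \<open>K h\<^sup>2\<close> tends to infinity so slowly that \<open>K h\<^sup>3 \<rightarrow> 0\<close>.
\<close>

text \<open>The formula for the gradient of \<open>A\<close> contains derivatives of
  \<open>S\<close>, while only \<open>S\<close> itself is controlled in L^p. Solving for
  \<open>A\<close> costs operators of the type of second-order Riesz transforms, D_i D_j over the
  Laplacian, whose kernels are not absolutely integrable. Convexity of a Bellman function replaces
  kernel estimates: it bounds the sum over all steps of |increment of f| |increment of g|, with a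
  constant that sees only the size of the averaging set. The exponent 4k is 2 times 2. The walk is
  self-adjoint, so half of its steps may act on \<open>S\<close> and half on \<open>G\<close>. They
  are taken in pairs, because a mixed second difference in directions i and j is a signed
  combination of the moves h (s e_i + t e_j), which a single step does not make. The resulting bound
  is a sum of powers of norms, not a product of norms. This suffices for duality: for G close to eps
  sgn(A) |A|^(p-1) the pairing is linear in eps, while the G-term is of order eps^q with q > 1, so a
  small eps absorbs it.\<close>

section \<open>The Bellman function\<close>

lemma taylor_lower_bound:
  fixes f f' f'' :: "real \<Rightarrow> real"
  assumes 1: "\<And>s. 0 \<le> s \<Longrightarrow> s \<le> 1 \<Longrightarrow> (f has_real_derivative f' s) (at s)"
    and 2: "\<And>s. 0 \<le> s \<Longrightarrow> s \<le> 1 \<Longrightarrow> (f' has_real_derivative f'' s) (at s)"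
    and 3: "\<And>s. 0 \<le> s \<Longrightarrow> s \<le> 1 \<Longrightarrow> 2 * c \<le> f'' s"
  shows "f 0 + f' 0 + c \<le> f 1"
proof -
  have f': "f' 0 + 2 * c * s \<le> f' s" if "0 \<le> s" "s \<le> 1" for s
  proof -
    have "(\<lambda>s. f' s - 2 * c * s) 0 \<le> (\<lambda>s. f' s - 2 * c * s) s"
    proof (rule DERIV_nonneg_imp_nondecreasing[OF \<open>0 \<le> s\<close>])
      fix t assume t: "0 \<le> t" "t \<le> s"
      have "((\<lambda>s. f' s - 2 * c * s) has_real_derivative (f'' t - 2 * c)) (at t)"
        using that t by (auto intro!: derivative_eq_intros 2)
      then show "\<exists>y. ((\<lambda>s. f' s - 2 * c * s) has_real_derivative y) (at t) \<and> 0 \<le> y"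
        using 3[of t] that t by auto
    qed
    then show ?thesis by simp
  qed
  have "(\<lambda>s. f s - f' 0 * s - c * s\<^sup>2) 0 \<le> (\<lambda>s. f s - f' 0 * s - c * s\<^sup>2) 1"
  proof (rule DERIV_nonneg_imp_nondecreasing[of "0::real" 1 "\<lambda>s. f s - f' 0 * s - c * s\<^sup>2"])
    fix t :: real assume t: "0 \<le> t" "t \<le> 1"
    have "((\<lambda>s. f s - f' 0 * s - c * s\<^sup>2) has_real_derivative (f' t - f' 0 - 2 * c * t)) (at t)"
      using t by (auto intro!: derivative_eq_intros 1)
    then show "\<exists>y. ((\<lambda>s. f s - f' 0 * s - c * s\<^sup>2) has_real_derivative y) (at t) \<and> 0 \<le> y"
      using f'[of t] t by force
  qed simp
  then show ?thesis by simp
qed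

lemma conjugate_exponent_facts:
  assumes "2 \<le> p" "q = conjugate_exponent p"
  shows "1 < q" "q \<le> 2" "q * (1 - 2 / p) = 2 - q" "q / p = q - 1" "p * (q - 1) = q"
proof -
  have q: "q = p / (p - 1)" using assms by (simp add: conjugate_exponent_def)
  show "1 < q" "q \<le> 2" using assms(1) unfolding q by (auto simp: field_simps)
  show "q * (1 - 2 / p) = 2 - q" "q / p = q - 1" "p * (q - 1) = q"
    using assms(1) unfolding q by (auto simp: field_simps)
qed

text \<open>For \<open>p \<ge> 2\<close> the second derivative dominates \<open>4 \<bar>\<xi> \<eta>\<bar>\<close> for positive arguments, while the function itself is
  at most a multiple of \<open>u\<^sup>p + v\<^sup>q\<close>. The coefficient of \<open>v\<^sup>q\<close> only has to absorb the negative
  part of the Hessian of the first summand.\<close>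
definition bellman :: "real \<Rightarrow> real \<Rightarrow> real \<Rightarrow> real" where
  "bellman p u v = (let q = conjugate_exponent p in
     u\<^sup>2 * (u powr p + v powr q) powr (1 - 2 / p) + 10 * q / (q - 1) * v powr q)"

text \<open>The right side is the second derivative of \<open>bellman\<close> along a line with
  velocity (\<xi>, \<eta>). In terms of \<open>X\<close>, \<open>Y\<close>, \<open>Z\<close> below,
  its first summand is 2 X, the cross term gives 4 \<alpha> p Z up to a multiple of |\<xi> \<eta>|,
  and concavity of the power \<alpha> of \<open>W\<close> costs at most 4 \<alpha> p Z + 2 q^2 Y;
  the multiples of Z cancel. The coefficient 10 is 2 + 8: the part 2 q^2 Y repays the last loss and
  8 q^2 Y is spent in \<open>t5\<close>.\<close>

lemma bellman_second_derivative_bound: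
  fixes p q U V \<xi> \<eta> :: real
  assumes p: "2 \<le> p" and q: "q = conjugate_exponent p" and UV: "0 < U" "0 < V"
  defines "\<alpha> \<equiv> 1 - 2 / p" and "W \<equiv> U powr p + V powr q"
    and "W1 \<equiv> p * U powr (p - 1) * \<xi> + q * V powr (q - 1) * \<eta>"
    and "W2 \<equiv> p * (p - 1) * U powr (p - 2) * \<xi>\<^sup>2 + q * (q - 1) * V powr (q - 2) * \<eta>\<^sup>2"
  shows "2 * (2 * \<bar>\<xi> * \<eta>\<bar>) \<le> 2 * \<xi>\<^sup>2 * W powr \<alpha> + 4 * U * \<xi> * \<alpha> * W powr (\<alpha> - 1) * W1
      + U\<^sup>2 * (\<alpha> * (\<alpha> - 1) * W powr (\<alpha> - 2) * W1\<^sup>2 + \<alpha> * W powr (\<alpha> - 1) * W2)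
      + 10 * q / (q - 1) * (q * (q - 1) * V powr (q - 2) * \<eta>\<^sup>2)"
proof -
  note qf = conjugate_exponent_facts[OF p q]
  have \<alpha>: "0 \<le> \<alpha>" "\<alpha> \<le> 1" "(1 - \<alpha>) * p = 2" "q * \<alpha> = 2 - q"
    using p qf by (auto simp: \<alpha>_def field_simps)
  have Wpos: "0 < W" unfolding W_def using UV by (simp add: add_pos_pos)
  have UW: "U powr p \<le> W" and VW: "V powr q \<le> W" unfolding W_def by auto
  have U1: "U \<le> W powr (1 / p)"
    using powr_mono2[OF _ _ UW, of "1/p"] UV p by (simp add: powr_powr)
  have V1: "V powr (q - 1) \<le> W powr (1 / p)"
    using powr_mono2[OF _ _ VW, of "1/p"] UV p qf by (simp add: powr_powr)
  have WV: "V powr (2 - q) \<le> W powr \<alpha>"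
    using powr_mono2[OF _ _ VW, of \<alpha>] UV \<alpha> by (simp add: powr_powr)
  \<comment> \<open>\<open>U\<close> and \<open>V powr (q - 1)\<close> are both at most
    \<open>W powr (1 / p)\<close>, and \<alpha> - 1 is -2/p, so the powers of \<open>W\<close>
    cancel exactly.\<close>
  have UV1: "U * V powr (q - 1) * W powr (\<alpha> - 1) \<le> 1"
  proof -
    have "U * V powr (q - 1) * W powr (\<alpha> - 1) \<le> W powr (1/p) * W powr (1/p) * W powr (\<alpha> - 1)"
      using U1 V1 UV by (intro mult_mono) auto
    also have "\<dots> = 1"
      using Wpos by (simp add: powr_add[symmetric] \<alpha>_def field_simps)
    finally show ?thesis .
  qed
  define X where "X = \<xi>\<^sup>2 * W powr \<alpha>"
  define Y where "Y = V powr (q - 2) * \<eta>\<^sup>2"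
  have X0: "0 \<le> X" and Y0: "0 \<le> Y" unfolding X_def Y_def by auto
  \<comment> \<open>The weights of \<open>X\<close> and \<open>Y\<close> have product at least 1
    because of \<open>WV\<close>; this is what lets the AM-GM inequality recover |\<xi> \<eta>|
    without any weight.\<close>
  have XY: "\<bar>\<xi> * \<eta>\<bar>\<^sup>2 \<le> X * Y"
  proof -
    have "1 \<le> W powr \<alpha> * V powr (q - 2)"
    proof -
      have "1 = V powr (2 - q) * V powr (q - 2)"
        using UV by (simp add: powr_add[symmetric])
      also have "\<dots> \<le> W powr \<alpha> * V powr (q - 2)"
        using WV by (intro mult_right_mono) auto
      finally show ?thesis .
    qed
    then have "(\<xi>\<^sup>2 * \<eta>\<^sup>2) * 1 \<le> (\<xi>\<^sup>2 * \<eta>\<^sup>2) * (W powr \<alpha> * V powr (q - 2))"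
      by (intro mult_left_mono) auto
    then show ?thesis by (simp add: X_def Y_def power_mult_distrib mult_ac)
  qed
  define Z where "Z = U powr p / W * X"
  have Z0: "0 \<le> Z" unfolding Z_def using X0 Wpos by auto
  have t1: "4 * U * \<xi> * \<alpha> * W powr (\<alpha> - 1) * W1 \<ge> 4 * \<alpha> * p * Z - 4 * \<alpha> * q * \<bar>\<xi> * \<eta>\<bar>"
  proof -
    have "4 * U * \<xi> * \<alpha> * W powr (\<alpha> - 1) * W1 =
      4 * \<alpha> * p * (U * U powr (p - 1) * W powr (\<alpha> - 1) * \<xi>\<^sup>2)
      + 4 * \<alpha> * q * ((U * V powr (q - 1) * W powr (\<alpha> - 1)) * (\<xi> * \<eta>))"
      unfolding W1_def by (simp add: algebra_simps power2_eq_square)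
    moreover have "U * U powr (p - 1) * W powr (\<alpha> - 1) * \<xi>\<^sup>2 = Z"
      using UV Wpos unfolding Z_def X_def
      by (simp add: powr_diff powr_mult_base[symmetric])
    moreover have "(U * V powr (q - 1) * W powr (\<alpha> - 1)) * (\<xi> * \<eta>) \<ge> - \<bar>\<xi> * \<eta>\<bar>"
    proof -
      have "\<bar>(U * V powr (q - 1) * W powr (\<alpha> - 1)) * (\<xi> * \<eta>)\<bar> \<le> 1 * \<bar>\<xi> * \<eta>\<bar>"
        unfolding abs_mult[of "U * V powr (q - 1) * W powr (\<alpha> - 1)"]
        using UV1 UV by (intro mult_right_mono) auto
      then show ?thesis by linarith
    qed
    then have "4 * \<alpha> * q * ((U * V powr (q - 1) * W powr (\<alpha> - 1)) * (\<xi> * \<eta>)) \<ge> 4 * \<alpha> * q * (- \<bar>\<xi> * \<eta>\<bar>)"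
      using \<alpha> qf by (intro mult_left_mono) auto
    ultimately show ?thesis by simp
  qed
  have t2: "U\<^sup>2 * (\<alpha> * W powr (\<alpha> - 1) * W2) \<ge> 0"
    unfolding W2_def using \<alpha> p qf by (intro mult_nonneg_nonneg add_nonneg_nonneg) auto
  have t3: "U\<^sup>2 * (\<alpha> * (\<alpha> - 1) * W powr (\<alpha> - 2) * W1\<^sup>2) \<ge> - (4 * \<alpha> * p * Z) - 2 * q\<^sup>2 * Y"
  proof -
    have sq: "W1\<^sup>2 \<le> 2 * (p * U powr (p - 1) * \<xi>)\<^sup>2 + 2 * (q * V powr (q - 1) * \<eta>)\<^sup>2"
      unfolding W1_def
      using zero_le_power2[of "p * U powr (p - 1) * \<xi> - q * V powr (q - 1) * \<eta>"]
      by (simp add: power2_sum power2_diff)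
    have "U\<^sup>2 * (\<alpha> * (1 - \<alpha>) * W powr (\<alpha> - 2) * W1\<^sup>2) \<le>
      U\<^sup>2 * (\<alpha> * (1 - \<alpha>) * W powr (\<alpha> - 2) * (2 * (p * U powr (p - 1) * \<xi>)\<^sup>2 + 2 * (q * V powr (q - 1) * \<eta>)\<^sup>2))"
      using sq \<alpha> by (intro mult_left_mono) auto
    also have "\<dots> = 2 * \<alpha> * (1 - \<alpha>) * p\<^sup>2 * ((U * U powr (p - 1))\<^sup>2 * W powr (\<alpha> - 2) * \<xi>\<^sup>2)
       + 2 * \<alpha> * (1 - \<alpha>) * q\<^sup>2 * ((U * V powr (q - 1))\<^sup>2 * W powr (\<alpha> - 2) * \<eta>\<^sup>2)"
      by (simp add: algebra_simps power2_eq_square)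
    also have "\<dots> \<le> 2 * \<alpha> * (1 - \<alpha>) * p\<^sup>2 * Z + 2 * \<alpha> * (1 - \<alpha>) * q\<^sup>2 * Y"
    proof (intro add_mono mult_left_mono)
      have "(U * U powr (p - 1))\<^sup>2 * W powr (\<alpha> - 2) * \<xi>\<^sup>2 = (U powr p / W) * Z"
        using UV Wpos unfolding Z_def X_def
        by (simp add: powr_diff powr_mult_base[symmetric] power2_eq_square)
      also have "\<dots> \<le> 1 * Z"
        using UW Wpos Z0 by (intro mult_right_mono) auto
      finally show "(U * U powr (p - 1))\<^sup>2 * W powr (\<alpha> - 2) * \<xi>\<^sup>2 \<le> Z" by simp
      have "(U * V powr (q - 1))\<^sup>2 * W powr (\<alpha> - 2) = U\<^sup>2 * V powr q * W powr (\<alpha> - 2) * V powr (q - 2)"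
      proof -
        have "(V powr (q - 1))\<^sup>2 = V powr q * V powr (q - 2)"
          using UV by (simp add: power2_eq_square powr_add[symmetric])
        then show ?thesis by (simp add: power_mult_distrib)
      qed
      also have "\<dots> \<le> ((W powr (1/p))\<^sup>2 * W * W powr (\<alpha> - 2)) * V powr (q - 2)"
        using U1 VW UV Wpos by (intro mult_right_mono mult_mono power_mono) auto
      also have "(W powr (1/p))\<^sup>2 * W * W powr (\<alpha> - 2) = 1"
        using Wpos powr_one[of W] p
        by (simp add: power2_eq_square powr_add[symmetric] powr_mult_base \<alpha>_def mult.assoc)
      finally show "(U * V powr (q - 1))\<^sup>2 * W powr (\<alpha> - 2) * \<eta>\<^sup>2 \<le> Y"
        unfolding Y_def by (intro mult_right_mono) auto
    qed (use \<alpha> in auto)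
    \<comment> \<open>The relation \<open>(1 - \<alpha>) * p = 2\<close> makes this loss equal to
      the gain in \<open>t1\<close>.\<close>
    also have "2 * \<alpha> * (1 - \<alpha>) * p\<^sup>2 * Z = 4 * \<alpha> * p * Z"
    proof -
      have "2 * \<alpha> * (1 - \<alpha>) * p\<^sup>2 * Z = 2 * \<alpha> * p * ((1 - \<alpha>) * p) * Z"
        by (simp only: power2_eq_square mult_ac)
      then show ?thesis unfolding \<alpha>(3) by simp
    qed
    also have "2 * \<alpha> * (1 - \<alpha>) * q\<^sup>2 * Y \<le> 2 * q\<^sup>2 * Y"
    proof -
      have "\<alpha> * (1 - \<alpha>) \<le> 1 * 1" using \<alpha> by (intro mult_mono) auto
      then have "\<alpha> * (1 - \<alpha>) * (2 * q\<^sup>2 * Y) \<le> 1 * (2 * q\<^sup>2 * Y)"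
        using Y0 by (intro mult_right_mono) auto
      then show ?thesis by (simp only: mult_ac mult_1_left)
    qed
    finally have "U\<^sup>2 * (\<alpha> * (1 - \<alpha>) * W powr (\<alpha> - 2) * W1\<^sup>2) \<le> 4 * \<alpha> * p * Z + 2 * q\<^sup>2 * Y"
      by simp
    moreover have "U\<^sup>2 * (\<alpha> * (\<alpha> - 1) * W powr (\<alpha> - 2) * W1\<^sup>2) = - (U\<^sup>2 * (\<alpha> * (1 - \<alpha>) * W powr (\<alpha> - 2) * W1\<^sup>2))"
      by (simp add: algebra_simps)
    ultimately show ?thesis by linarith
  qed
  have t4: "10 * q / (q - 1) * (q * (q - 1) * V powr (q - 2) * \<eta>\<^sup>2) = 10 * q\<^sup>2 * Y"
    using qf unfolding Y_def by (simp add: power2_eq_square)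
  \<comment> \<open>AM-GM: 64 q^2 X Y is four times the product of the two terms on the right. Of
    the 8 q thus gained, at most 4 q pays for the negative part of \<open>t1\<close>; the remaining
    4 q is at least 4.\<close>
  have t5: "8 * q * \<bar>\<xi> * \<eta>\<bar> \<le> 2 * X + 8 * q\<^sup>2 * Y"
  proof (rule power2_le_imp_le)
    have "(8 * q * \<bar>\<xi> * \<eta>\<bar>)\<^sup>2 = 64 * q\<^sup>2 * \<bar>\<xi> * \<eta>\<bar>\<^sup>2"
      by (simp add: power2_eq_square)
    also have "\<dots> \<le> 64 * q\<^sup>2 * (X * Y)" using XY by (intro mult_left_mono) auto
    also have "\<dots> \<le> (2 * X + 8 * q\<^sup>2 * Y)\<^sup>2"
      using zero_le_power2[of "2 * X - 8 * q\<^sup>2 * Y"]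
      by (simp add: power2_sum power2_diff algebra_simps)
    finally show "(8 * q * \<bar>\<xi> * \<eta>\<bar>)\<^sup>2 \<le> (2 * X + 8 * q\<^sup>2 * Y)\<^sup>2" .
  qed (use X0 Y0 in auto)
  have t6: "4 * \<alpha> * q * \<bar>\<xi> * \<eta>\<bar> \<le> 4 * q * \<bar>\<xi> * \<eta>\<bar>"
    using \<alpha> qf mult_right_mono[of \<alpha> 1 "4 * q * \<bar>\<xi> * \<eta>\<bar>"] by (simp add: mult_ac)
  have t7: "4 * \<bar>\<xi> * \<eta>\<bar> \<le> 4 * q * \<bar>\<xi> * \<eta>\<bar>"
    using qf mult_right_mono[of 1 q "4 * \<bar>\<xi> * \<eta>\<bar>"] by (simp add: mult_ac)
  have "2 * \<xi>\<^sup>2 * W powr \<alpha> = 2 * X" unfolding X_def by simp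
  then show ?thesis
    using t1 t2 t3 t4 t5 t6 t7 by (simp add: distrib_left) 
qed

text \<open>The plane is the tangent plane, and the second-derivative bound is integrated along the
  segment from (a, b) to (x, y), which stays in the open quadrant. Positivity matters because
  \<open>V powr (q - 2)\<close> is singular at 0 when q < 2.\<close>

lemma bellman_supporting_plane:
  fixes p a b :: real
  assumes p: "2 \<le> p" and ab: "0 < a" "0 < b"
  obtains L1 L2 where "\<And>x y. 0 < x \<Longrightarrow> 0 < y \<Longrightarrow>
    bellman p a b + L1 * (x - a) + L2 * (y - b) + 2 * \<bar>(x - a) * (y - b)\<bar> \<le> bellman p x y"
proof -
  define q where "q = conjugate_exponent p"
  define \<alpha> where "\<alpha> = 1 - 2 / p"
  define M where "M = 10 * q / (q - 1)"
  note qf = conjugate_exponent_facts[OF p q_def]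
  define L1 where "L1 = 2 * a * (a powr p + b powr q) powr \<alpha>
     + a\<^sup>2 * (\<alpha> * (a powr p + b powr q) powr (\<alpha> - 1) * (p * a powr (p - 1)))"
  define L2 where "L2 = a\<^sup>2 * (\<alpha> * (a powr p + b powr q) powr (\<alpha> - 1) * (q * b powr (q - 1)))
     + M * (q * b powr (q - 1))"
  have "bellman p a b + L1 * (x - a) + L2 * (y - b) + 2 * \<bar>(x - a) * (y - b)\<bar> \<le> bellman p x y"
    if xy: "0 < x" "0 < y" for x y
  proof -
    define \<xi> where "\<xi> = x - a"
    define \<eta> where "\<eta> = y - b"
    define U where "U = (\<lambda>s. a + s * \<xi>)"
    define V where "V = (\<lambda>s. b + s * \<eta>)"
    define W where "W = (\<lambda>s. U s powr p + V s powr q)"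
    define W1 where "W1 = (\<lambda>s. p * U s powr (p - 1) * \<xi> + q * V s powr (q - 1) * \<eta>)"
    define W2 where "W2 = (\<lambda>s. p * (p - 1) * U s powr (p - 2) * \<xi>\<^sup>2 + q * (q - 1) * V s powr (q - 2) * \<eta>\<^sup>2)"
    define f where "f = (\<lambda>s. (U s)\<^sup>2 * W s powr \<alpha> + M * V s powr q)"
    define f1 where "f1 = (\<lambda>s. 2 * U s * \<xi> * W s powr \<alpha> + (U s)\<^sup>2 * (\<alpha> * W s powr (\<alpha> - 1) * W1 s)
       + M * (q * V s powr (q - 1) * \<eta>))"
    define f2 where "f2 = (\<lambda>s. 2 * \<xi>\<^sup>2 * W s powr \<alpha> + 4 * U s * \<xi> * \<alpha> * W s powr (\<alpha> - 1) * W1 s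
      + (U s)\<^sup>2 * (\<alpha> * (\<alpha> - 1) * W s powr (\<alpha> - 2) * (W1 s)\<^sup>2 + \<alpha> * W s powr (\<alpha> - 1) * W2 s)
      + M * (q * (q - 1) * V s powr (q - 2) * \<eta>\<^sup>2))"
    have pos: "0 < U s" "0 < V s" "0 < W s" if "0 \<le> s" "s \<le> 1" for s
    proof -
      have "U s = (1 - s) * a + s * x" "V s = (1 - s) * b + s * y"
        by (auto simp: U_def V_def \<xi>_def \<eta>_def algebra_simps)
      moreover have "0 < (1 - s) * a + s * x" "0 < (1 - s) * b + s * y"
        using that ab xy by (cases "s = 0"; simp add: add_nonneg_pos)+
      ultimately show "0 < U s" "0 < V s" by auto
      then show "0 < W s" unfolding W_def by (simp add: add_pos_pos)
    qed
    have dU: "(U has_real_derivative \<xi>) (at s)" for s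
      unfolding U_def by (auto intro!: derivative_eq_intros)
    have dV: "(V has_real_derivative \<eta>) (at s)" for s
      unfolding V_def by (auto intro!: derivative_eq_intros)
    have dUr: "((\<lambda>s. U s powr r) has_real_derivative (r * U s powr (r - 1) * \<xi>)) (at s)"
      if "0 \<le> s" "s \<le> 1" for s r
      using DERIV_fun_powr[OF dU pos(1)[OF that], of r] by simp
    have dVr: "((\<lambda>s. V s powr r) has_real_derivative (r * V s powr (r - 1) * \<eta>)) (at s)"
      if "0 \<le> s" "s \<le> 1" for s r
      using DERIV_fun_powr[OF dV pos(2)[OF that], of r] by simp
    have dW: "(W has_real_derivative W1 s) (at s)" if "0 \<le> s" "s \<le> 1" for s
      unfolding W_def W1_def using dUr[OF that, of p] dVr[OF that, of q] by (rule DERIV_add)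
    have dWr: "((\<lambda>s. W s powr r) has_real_derivative (r * W s powr (r - 1) * W1 s)) (at s)"
      if "0 \<le> s" "s \<le> 1" for s r
      using DERIV_fun_powr[OF dW[OF that] pos(3)[OF that], of r] by simp
    have dW1: "(W1 has_real_derivative W2 s) (at s)" if "0 \<le> s" "s \<le> 1" for s
      unfolding W1_def W2_def
      by (rule derivative_eq_intros dUr[OF that] dVr[OF that] refl)+
        (simp add: power2_eq_square algebra_simps)
    have df: "(f has_real_derivative f1 s) (at s)" if "0 \<le> s" "s \<le> 1" for s
      unfolding f_def f1_def
      by (rule derivative_eq_intros dU dWr[OF that] dVr[OF that] refl)+
        (simp add: algebra_simps)
    have df1: "(f1 has_real_derivative f2 s) (at s)" if "0 \<le> s" "s \<le> 1" for s
      unfolding f1_def f2_def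
      by (rule derivative_eq_intros dU dW1[OF that] dWr[OF that] dVr[OF that] refl)+
        (simp add: algebra_simps power2_eq_square)
    have f2: "2 * (2 * \<bar>\<xi> * \<eta>\<bar>) \<le> f2 s" if "0 \<le> s" "s \<le> 1" for s
      using bellman_second_derivative_bound[OF p q_def pos(1,2)[OF that], of \<xi> \<eta>]
      unfolding f2_def W_def W1_def W2_def \<alpha>_def M_def by simp
    have "f 0 + f1 0 + 2 * \<bar>\<xi> * \<eta>\<bar> \<le> f 1"
      by (rule taylor_lower_bound[OF df df1 f2])
    moreover have "f 0 = bellman p a b" "f 1 = bellman p x y"
      unfolding f_def bellman_def Let_def q_def[symmetric] M_def \<alpha>_def W_def U_def V_def \<xi>_def \<eta>_def
      by simp_all
    moreover have "f1 0 = L1 * \<xi> + L2 * \<eta>"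
      unfolding f1_def L1_def L2_def W_def W1_def U_def V_def by (simp add: algebra_simps)
    ultimately show ?thesis by (simp add: \<xi>_def \<eta>_def)
  qed
  then show thesis by (rule that)
qed

lemma bellman_tendsto:
  assumes p: "2 \<le> p" and uv: "0 \<le> u" "0 \<le> v"
  shows "((\<lambda>\<epsilon>. bellman p (u + \<epsilon>) (v + \<epsilon>)) \<longlongrightarrow> bellman p u v) (at_right 0)"
proof -
  define q where "q = conjugate_exponent p"
  define \<alpha> where "\<alpha> = 1 - 2 / p"
  note qf = conjugate_exponent_facts[OF p q_def]
  have \<alpha>: "0 \<le> \<alpha>" using p by (simp add: \<alpha>_def)
  have lim: "((\<lambda>\<epsilon>. w + \<epsilon>) \<longlongrightarrow> w) (at_right (0::real))" for w :: real
    by (auto intro!: tendsto_eq_intros)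
  have pos: "eventually (\<lambda>\<epsilon>. 0 < w + \<epsilon>) (at_right (0::real))" if "0 \<le> w" for w
    using that eventually_at_right_less[of 0] by (auto elim!: eventually_mono)
  have pw: "((\<lambda>\<epsilon>. (w + \<epsilon>) powr r) \<longlongrightarrow> w powr r) (at_right 0)" if "0 \<le> w" "0 < r" for w r :: real
    using that pos[OF that(1)]
    by (intro tendsto_powr2 lim tendsto_const) (auto elim!: eventually_mono)
  define W where "W = (\<lambda>\<epsilon>. (u + \<epsilon>) powr p + (v + \<epsilon>) powr q)"
  have W: "(W \<longlongrightarrow> u powr p + v powr q) (at_right 0)"
    unfolding W_def using p qf uv by (intro tendsto_add pw) auto
  have "((\<lambda>\<epsilon>. (u + \<epsilon>)\<^sup>2 * W \<epsilon> powr \<alpha>) \<longlongrightarrow> u\<^sup>2 * (u powr p + v powr q) powr \<alpha>) (at_right 0)"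
  \<comment> \<open>For p = 2 the exponent \<alpha> is 0 and \<open>0 powr 0\<close> is 0, so
    \<open>powr\<close> may jump as its base tends to 0. If u = 0 the factor
    \<open>(u + \<epsilon>)\<^sup>2\<close> forces the limit 0; if u > 0 the limit of
    \<open>W\<close> is positive.\<close>
  proof (cases "\<alpha> = 0 \<and> u = 0")
    case False
    show ?thesis
    proof (cases "\<alpha> = 0")
      case True
      then have "0 < u" using False uv by auto
      then have "u powr p + v powr q \<noteq> 0"
        using add_pos_nonneg[of "u powr p" "v powr q"] by simp
      then show ?thesis using W by (intro tendsto_mult tendsto_power lim tendsto_powr tendsto_const)
    next
      case False
      then show ?thesis using W \<alpha>
        by (intro tendsto_mult tendsto_power lim tendsto_powr2 tendsto_const)
          (auto simp: W_def)
    qed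
  next
    case True
    have "((\<lambda>\<epsilon>. (u + \<epsilon>)\<^sup>2) \<longlongrightarrow> 0) (at_right 0)"
      using True by (auto intro!: tendsto_eq_intros)
    moreover have "eventually (\<lambda>\<epsilon>. (u + \<epsilon>)\<^sup>2 = (u + \<epsilon>)\<^sup>2 * W \<epsilon> powr \<alpha>) (at_right 0)"
      using pos[OF uv(1)]
    proof (rule eventually_mono)
      fix \<epsilon> assume "0 < u + \<epsilon>"
      then have "W \<epsilon> \<noteq> 0" unfolding W_def
        using add_pos_nonneg[of "(u + \<epsilon>) powr p" "(v + \<epsilon>) powr q"] by simp
      then show "(u + \<epsilon>)\<^sup>2 = (u + \<epsilon>)\<^sup>2 * W \<epsilon> powr \<alpha>" using True by simp
    qed
    ultimately have "((\<lambda>\<epsilon>. (u + \<epsilon>)\<^sup>2 * W \<epsilon> powr \<alpha>) \<longlongrightarrow> 0) (at_right 0)"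
      by (rule Lim_transform_eventually)
    then show ?thesis using True by simp
  qed
  moreover have "((\<lambda>\<epsilon>. 10 * q / (q - 1) * (v + \<epsilon>) powr q) \<longlongrightarrow> 10 * q / (q - 1) * v powr q) (at_right 0)"
    using qf uv by (intro tendsto_mult tendsto_const pw) auto
  ultimately show ?thesis
    unfolding bellman_def Let_def q_def[symmetric] \<alpha>_def[symmetric] W_def
    by (rule tendsto_add)
qed

text \<open>Jensen's inequality with a gain: in the sum of the supporting-plane inequalities at the
  mean, the linear terms cancel and the products of deviations remain. Supporting planes are
  available only at positive points, so both families are shifted by \<epsilon>, which leaves the
  deviations unchanged, and \<epsilon> tends to 0.\<close>

lemma bellman_jensen:
  fixes u v :: "'i \<Rightarrow> real"
  assumes p: "2 \<le> p" and J: "finite J" "J \<noteq> {}"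
    and uv: "\<And>j. j \<in> J \<Longrightarrow> 0 \<le> u j" "\<And>j. j \<in> J \<Longrightarrow> 0 \<le> v j"
  defines "mu \<equiv> (\<Sum>j\<in>J. u j) / card J" and "mv \<equiv> (\<Sum>j\<in>J. v j) / card J"
  shows "card J * bellman p mu mv + 2 * (\<Sum>j\<in>J. \<bar>(u j - mu) * (v j - mv)\<bar>)
      \<le> (\<Sum>j\<in>J. bellman p (u j) (v j))"
proof -
  have card: "0 < real (card J)" using J by (simp add: card_gt_0_iff)
  have m0: "0 \<le> mu" "0 \<le> mv" unfolding mu_def mv_def using uv by (auto intro!: divide_nonneg_nonneg sum_nonneg)
  have su: "(\<Sum>j\<in>J. u j - mu) = 0" "(\<Sum>j\<in>J. v j - mv) = 0"
    using card by (auto simp: sum_subtractf mu_def mv_def)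
  have "card J * bellman p (mu + \<epsilon>) (mv + \<epsilon>) + 2 * (\<Sum>j\<in>J. \<bar>(u j - mu) * (v j - mv)\<bar>)
      \<le> (\<Sum>j\<in>J. bellman p (u j + \<epsilon>) (v j + \<epsilon>))" if \<epsilon>: "0 < \<epsilon>" for \<epsilon>
  proof -
    obtain L1 L2 where L: "\<And>x y. 0 < x \<Longrightarrow> 0 < y \<Longrightarrow>
      bellman p (mu + \<epsilon>) (mv + \<epsilon>) + L1 * (x - (mu + \<epsilon>)) + L2 * (y - (mv + \<epsilon>))
        + 2 * \<bar>(x - (mu + \<epsilon>)) * (y - (mv + \<epsilon>))\<bar> \<le> bellman p x y"
      by (rule bellman_supporting_plane[OF p, of "mu + \<epsilon>" "mv + \<epsilon>"]) (use m0 \<epsilon> in auto)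
    have "(\<Sum>j\<in>J. bellman p (mu + \<epsilon>) (mv + \<epsilon>) + L1 * (u j - mu) + L2 * (v j - mv)
        + 2 * \<bar>(u j - mu) * (v j - mv)\<bar>) \<le> (\<Sum>j\<in>J. bellman p (u j + \<epsilon>) (v j + \<epsilon>))"
    proof (rule sum_mono)
      fix j assume "j \<in> J"
      then show "bellman p (mu + \<epsilon>) (mv + \<epsilon>) + L1 * (u j - mu) + L2 * (v j - mv)
        + 2 * \<bar>(u j - mu) * (v j - mv)\<bar> \<le> bellman p (u j + \<epsilon>) (v j + \<epsilon>)"
        using L[of "u j + \<epsilon>" "v j + \<epsilon>"] uv[of j] \<epsilon> by simp
    qed
    then show ?thesis
      using su by (simp add: sum.distrib sum_distrib_left[symmetric])
  qed
  then have ev: "eventually (\<lambda>\<epsilon>. card J * bellman p (mu + \<epsilon>) (mv + \<epsilon>) + 2 * (\<Sum>j\<in>J. \<bar>(u j - mu) * (v j - mv)\<bar>)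
      \<le> (\<Sum>j\<in>J. bellman p (u j + \<epsilon>) (v j + \<epsilon>))) (at_right 0)"
    using eventually_at_right_less[of "0::real"] by (auto elim!: eventually_mono)
  show ?thesis
    by (rule tendsto_le[OF _ _ _ ev])
      (use m0 uv p in \<open>auto intro!: tendsto_intros bellman_tendsto\<close>)
qed

lemma bellman_nonneg: "2 \<le> p \<Longrightarrow> 0 \<le> bellman p u v"
  using conjugate_exponent_facts(1)[of p "conjugate_exponent p"]
  by (auto simp: bellman_def Let_def)

lemma bellman_upper_bound:
  assumes p: "2 \<le> p" and u: "0 \<le> u"
  defines "q \<equiv> conjugate_exponent p"
  shows "bellman p u v \<le> u powr p + (1 + 10 * q / (q - 1)) * v powr q"
proof -
  define W where "W = u powr p + v powr q"
  have W: "0 \<le> W" "u powr p \<le> W" by (auto simp: W_def)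
  have "u\<^sup>2 * W powr (1 - 2 / p) \<le> W"
  proof (cases "u = 0")
    case False
    then have "0 < u" using u by simp
    then have Wp: "0 < W" using W(2) less_le_trans[of 0 "u powr p" W] by simp
    have "u\<^sup>2 = (u powr p) powr (2 / p)" using \<open>0 < u\<close> p by (simp add: powr_powr powr_numeral)
    also have "\<dots> \<le> W powr (2 / p)" using W p by (intro powr_mono2) auto
    finally have "u\<^sup>2 * W powr (1 - 2 / p) \<le> W powr (2 / p) * W powr (1 - 2 / p)"
      by (intro mult_right_mono) auto
    also have "\<dots> = W" using Wp by (simp add: powr_add[symmetric])
    finally show ?thesis .
  qed (use W in auto)
  then show ?thesis
    unfolding bellman_def Let_def q_def[symmetric] W_def by (simp add: algebra_simps)
qed

section \<open>Energy of the increments of an averaging flow\<close>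

lemma nn_integral_lborel_translate:
  fixes f :: "'a::euclidean_space \<Rightarrow> ennreal"
  assumes [measurable]: "f \<in> borel_measurable borel"
  shows "(\<integral>\<^sup>+x. f (x + a) \<partial>lborel) = (\<integral>\<^sup>+x. f x \<partial>lborel)"
proof -
  have "(\<integral>\<^sup>+x. f x \<partial>lborel) = (\<integral>\<^sup>+x. f x \<partial>distr lborel borel (\<lambda>x. a + x))"
    by (simp add: lborel_distr_plus)
  also have "\<dots> = (\<integral>\<^sup>+x. f (a + x) \<partial>lborel)"
    by (subst nn_integral_distr) auto
  finally show ?thesis by (simp add: add.commute)
qed

lemma integral_lborel_translate:
  fixes f :: "'a::euclidean_space \<Rightarrow> real"
  assumes [measurable]: "f \<in> borel_measurable borel"
  shows "(LBINT x. f (x + a)) = (LBINT x. f x)"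
proof -
  have "(LBINT x. f x) = (\<integral>x. f x \<partial>distr lborel borel (\<lambda>x. a + x))"
    by (simp add: lborel_distr_plus)
  also have "\<dots> = (LBINT x. f (a + x))"
    by (subst integral_distr) auto
  finally show ?thesis by (simp add: add.commute)
qed

lemma integrable_lborel_translate:
  fixes f :: "'a::euclidean_space \<Rightarrow> real"
  assumes "integrable lborel f"
  shows "integrable lborel (\<lambda>x. f (x + a))"
proof -
  have [measurable]: "f \<in> borel_measurable borel" using assms by auto
  have "integrable (distr lborel borel (\<lambda>x. a + x)) f" using assms by (simp add: lborel_distr_plus)
  then show ?thesis by (subst (asm) integrable_distr_eq) (auto simp: add.commute)
qed

definition average :: "'i set \<Rightarrow> ('i \<Rightarrow> 'a::euclidean_space) \<Rightarrow> ('a \<Rightarrow> real) \<Rightarrow> 'a \<Rightarrow> real" where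
  "average J w f x = (\<Sum>j\<in>J. f (x + w j)) / card J"

definition increment :: "'i set \<Rightarrow> ('i \<Rightarrow> 'a::euclidean_space) \<Rightarrow> ('a \<Rightarrow> real) \<Rightarrow> 'i \<Rightarrow> 'a \<Rightarrow> real" where
  "increment J w f j x = f (x + w j) - average J w f x"

lemma average_measurable [measurable]:
  assumes [measurable]: "f \<in> borel_measurable borel"
  shows "average J w f \<in> borel_measurable borel"
  unfolding average_def[abs_def] by measurable

lemma average_pow_measurable [measurable]:
  assumes [measurable]: "f \<in> borel_measurable borel"
  shows "(average J w ^^ k) f \<in> borel_measurable borel"
  by (induction k) auto

lemma increment_measurable [measurable]:
  assumes [measurable]: "f \<in> borel_measurable borel"
  shows "increment J w f j \<in> borel_measurable borel"
  unfolding increment_def[abs_def] by measurable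

lemma average_pow_nonneg: "(\<And>x. 0 \<le> f x) \<Longrightarrow> 0 \<le> (average J w ^^ k) f x"
  by (induction k arbitrary: x) (auto simp: average_def intro!: divide_nonneg_nonneg sum_nonneg)

lemma average_diff: "average J w (\<lambda>x. f x - g x) = (\<lambda>x. average J w f x - average J w g x)"
  by (auto simp: average_def sum_subtractf diff_divide_distrib)

lemma average_pow_diff:
  "(average J w ^^ k) (\<lambda>x. f x - g x) = (\<lambda>x. (average J w ^^ k) f x - (average J w ^^ k) g x)"
  by (induction k) (auto simp: average_diff)

lemma increment_diff:
  "increment J w (\<lambda>x. f x - g x) j x = increment J w f j x - increment J w g j x"
  by (simp add: increment_def average_diff)

lemma bellman_measurable [measurable]:
  assumes [measurable]: "u \<in> borel_measurable M" "v \<in> borel_measurable M"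
  shows "(\<lambda>x. bellman p (u x) (v x)) \<in> borel_measurable M"
  unfolding bellman_def Let_def by measurable

text \<open>Integrating \<open>bellman_jensen\<close> turns the translated values on its right side
  back into the untranslated ones. Hence the Bellman energy of a pair drops under averaging by at
  least the energy of the increments. Integrals valued in \<open>ennreal\<close> make integrability
  of the terms irrelevant here.\<close>

lemma bellman_energy_step:
  assumes p: "2 \<le> p" and J: "finite J" "J \<noteq> {}"
    and [measurable]: "u \<in> borel_measurable borel" "v \<in> borel_measurable borel"
    and nn: "\<And>x. 0 \<le> u x" "\<And>x. 0 \<le> v x"
  shows "(\<integral>\<^sup>+x. card J * bellman p (average J w u x) (average J w v x) \<partial>lborel)
     + (\<Sum>j\<in>J. \<integral>\<^sup>+x. 2 * \<bar>increment J w u j x * increment J w v j x\<bar> \<partial>lborel)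
     \<le> (\<integral>\<^sup>+x. card J * bellman p (u x) (v x) \<partial>lborel)"
proof -
  note B0 = bellman_nonneg[OF p]
  have "(\<integral>\<^sup>+x. card J * bellman p (average J w u x) (average J w v x) \<partial>lborel)
     + (\<Sum>j\<in>J. \<integral>\<^sup>+x. 2 * \<bar>increment J w u j x * increment J w v j x\<bar> \<partial>lborel)
    = (\<integral>\<^sup>+x. ennreal (card J * bellman p (average J w u x) (average J w v x))
       + (\<Sum>j\<in>J. ennreal (2 * \<bar>increment J w u j x * increment J w v j x\<bar>)) \<partial>lborel)"
    by (simp add: nn_integral_add nn_integral_sum del: sum_ennreal)
  also have "\<dots> \<le> (\<integral>\<^sup>+x. (\<Sum>j\<in>J. ennreal (bellman p (u (x + w j)) (v (x + w j)))) \<partial>lborel)"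
  proof (rule nn_integral_mono)
    fix x
    have "card J * bellman p (average J w u x) (average J w v x)
        + 2 * (\<Sum>j\<in>J. \<bar>increment J w u j x * increment J w v j x\<bar>)
      \<le> (\<Sum>j\<in>J. bellman p (u (x + w j)) (v (x + w j)))"
      using bellman_jensen[OF p J, of "\<lambda>j. u (x + w j)" "\<lambda>j. v (x + w j)"] nn
      by (simp add: average_def increment_def)
    then show "ennreal (card J * bellman p (average J w u x) (average J w v x))
       + (\<Sum>j\<in>J. ennreal (2 * \<bar>increment J w u j x * increment J w v j x\<bar>))
       \<le> (\<Sum>j\<in>J. ennreal (bellman p (u (x + w j)) (v (x + w j))))"
      using B0 by (simp add: sum_nonneg sum_distrib_left flip: ennreal_plus)
  qed
  also have "\<dots> = (\<Sum>j\<in>J. \<integral>\<^sup>+x. ennreal (bellman p (u (x + w j)) (v (x + w j))) \<partial>lborel)"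
    by (simp add: nn_integral_sum del: sum_ennreal)
  also have "\<dots> = (\<Sum>j\<in>J. \<integral>\<^sup>+x. ennreal (bellman p (u x) (v x)) \<partial>lborel)"
    by (intro sum.cong refl, rule nn_integral_lborel_translate) measurable
  also have "\<dots> = (\<integral>\<^sup>+x. card J * bellman p (u x) (v x) \<partial>lborel)"
    using B0 by (simp add: ennreal_mult nn_integral_cmult ennreal_of_nat_eq_real_of_nat)
  finally show ?thesis .
qed

text \<open>Discrete counterpart of the space-time integral of |grad u| |grad v| for the heat flows
  u and v started at f and g.\<close>

definition increment_energy ::
  "'i set \<Rightarrow> ('i \<Rightarrow> 'a::euclidean_space) \<Rightarrow> nat \<Rightarrow> ('a \<Rightarrow> real) \<Rightarrow> ('a \<Rightarrow> real) \<Rightarrow> ennreal" where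
  "increment_energy J w K f g = (\<Sum>k<K. \<Sum>j\<in>J. \<integral>\<^sup>+x.
     \<bar>increment J w ((average J w ^^ k) f) j x * increment J w ((average J w ^^ k) g) j x\<bar> \<partial>lborel)"

lemma increment_energy_commute: "increment_energy J w K f g = increment_energy J w K g f"
  by (simp add: increment_energy_def mult.commute)

lemma increment_energy_bound_nonneg:
  assumes p: "2 \<le> p" and J: "finite J" "J \<noteq> {}"
    and [measurable]: "u \<in> borel_measurable borel" "v \<in> borel_measurable borel"
    and nn: "\<And>x. 0 \<le> u x" "\<And>x. 0 \<le> v x"
  shows "increment_energy J w K u v \<le> (\<integral>\<^sup>+x. card J * bellman p (u x) (v x) \<partial>lborel)"
proof -
  have "(\<integral>\<^sup>+x. card J * bellman p ((average J w ^^ K) u x) ((average J w ^^ K) v x) \<partial>lborel)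
    + (\<Sum>k<K. \<Sum>j\<in>J. \<integral>\<^sup>+x. 2 * \<bar>increment J w ((average J w ^^ k) u) j x
        * increment J w ((average J w ^^ k) v) j x\<bar> \<partial>lborel)
    \<le> (\<integral>\<^sup>+x. card J * bellman p (u x) (v x) \<partial>lborel)"
  proof (induction K)
    case (Suc K)
    have swap: "A' + (S + d) \<le> T" if "A' + d \<le> A" "A + S \<le> T" for A' S d A T :: ennreal
    proof -
      have "A' + (S + d) = (A' + d) + S" by (simp add: ac_simps)
      also have "\<dots> \<le> A + S" by (rule add_right_mono) (rule that)
      also have "\<dots> \<le> T" by (rule that)
      finally show ?thesis .
    qed
    show ?case
      unfolding sum.lessThan_Suc funpow.simps(2) o_apply
      by (rule swap[OF bellman_energy_step[OF p J] Suc]) (auto intro: average_pow_nonneg nn)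
  qed simp
  then have "(\<Sum>k<K. \<Sum>j\<in>J. \<integral>\<^sup>+x. 2 * \<bar>increment J w ((average J w ^^ k) u) j x
        * increment J w ((average J w ^^ k) v) j x\<bar> \<partial>lborel)
    \<le> (\<integral>\<^sup>+x. card J * bellman p (u x) (v x) \<partial>lborel)"
    by (rule order_trans[rotated]) simp
  moreover have "increment_energy J w K u v \<le> (\<Sum>k<K. \<Sum>j\<in>J. \<integral>\<^sup>+x. 2 * \<bar>increment J w ((average J w ^^ k) u) j x
        * increment J w ((average J w ^^ k) v) j x\<bar> \<partial>lborel)"
    unfolding increment_energy_def
    by (intro sum_mono nn_integral_mono ennreal_leI) simp
  ultimately show ?thesis by (rule order_trans[rotated])
qed

lemma increment_energy_add_le:
  assumes [measurable]: "f1 \<in> borel_measurable borel" "f2 \<in> borel_measurable borel"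
     "g \<in> borel_measurable borel"
  shows "increment_energy J w K (\<lambda>x. f1 x - f2 x) g
    \<le> increment_energy J w K f1 g + increment_energy J w K f2 g"
  unfolding increment_energy_def sum.distrib[symmetric]
proof (intro sum_mono)
  fix k j
  let ?u1 = "increment J w ((average J w ^^ k) f1) j"
  let ?u2 = "increment J w ((average J w ^^ k) f2) j"
  let ?v = "increment J w ((average J w ^^ k) g) j"
  have "(\<integral>\<^sup>+x. \<bar>(?u1 x - ?u2 x) * ?v x\<bar> \<partial>lborel)
     \<le> (\<integral>\<^sup>+x. ennreal \<bar>?u1 x * ?v x\<bar> + ennreal \<bar>?u2 x * ?v x\<bar> \<partial>lborel)"
    by (intro nn_integral_mono) (simp add: left_diff_distrib flip: ennreal_plus)
  then show "(\<integral>\<^sup>+x. \<bar>increment J w ((average J w ^^ k) (\<lambda>x. f1 x - f2 x)) j x * ?v x\<bar> \<partial>lborel)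
    \<le> (\<integral>\<^sup>+x. \<bar>?u1 x * ?v x\<bar> \<partial>lborel) + (\<integral>\<^sup>+x. \<bar>?u2 x * ?v x\<bar> \<partial>lborel)"
    by (simp add: average_pow_diff increment_diff nn_integral_add)
qed

text \<open>The Bellman argument needs nonnegative functions. Splitting f and g into positive and
  negative parts leaves four pairs, each dominated by |f| and |g|; this is the factor 4.\<close>

lemma increment_energy_bound_ge2:
  fixes w :: "'i \<Rightarrow> 'a::euclidean_space"
  assumes p: "2 \<le> p" and J: "finite J" "J \<noteq> {}"
    and [measurable]: "f \<in> borel_measurable borel" "g \<in> borel_measurable borel"
  defines "q \<equiv> conjugate_exponent p"
  shows "increment_energy J w K f g \<le> ennreal (card J * (4 * (1 + 10 * q / (q - 1))))
     * ((\<integral>\<^sup>+x. \<bar>f x\<bar> powr p \<partial>lborel) + (\<integral>\<^sup>+x. \<bar>g x\<bar> powr q \<partial>lborel))"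
proof -
  define c where "c = 1 + 10 * q / (q - 1)"
  have qf: "1 < q" unfolding q_def by (rule conjugate_exponent_facts[OF p refl])
  have c: "1 \<le> c" using qf by (simp add: c_def)
  define F where "F = (\<integral>\<^sup>+x. \<bar>f x\<bar> powr p \<partial>lborel) + (\<integral>\<^sup>+x. \<bar>g x\<bar> powr q \<partial>lborel)"
  have *: "increment_energy J w K u v \<le> ennreal (card J * c) * F"
    if [measurable]: "u \<in> borel_measurable borel" "v \<in> borel_measurable borel"
      and nn: "\<And>x. 0 \<le> u x" "\<And>x. 0 \<le> v x" and le: "\<And>x. u x \<le> \<bar>f x\<bar>" "\<And>x. v x \<le> \<bar>g x\<bar>"
    for u v :: "'a \<Rightarrow> real"
  proof -
    have "increment_energy J w K u v \<le> (\<integral>\<^sup>+x. card J * bellman p (u x) (v x) \<partial>lborel)"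
      by (rule increment_energy_bound_nonneg[OF p J]) (use that in auto)
    also have "\<dots> \<le> (\<integral>\<^sup>+x. ennreal (card J * c) * (ennreal (\<bar>f x\<bar> powr p) + ennreal (\<bar>g x\<bar> powr q)) \<partial>lborel)"
    proof (rule nn_integral_mono)
      fix x
      have "bellman p (u x) (v x) \<le> u x powr p + c * v x powr q"
        using bellman_upper_bound[OF p nn(1)] by (simp add: c_def q_def)
      also have "\<dots> \<le> c * \<bar>f x\<bar> powr p + c * \<bar>g x\<bar> powr q"
      proof (intro add_mono mult_left_mono)
        have "u x powr p \<le> \<bar>f x\<bar> powr p" using p nn le by (intro powr_mono2) auto
        also have "\<dots> \<le> c * \<bar>f x\<bar> powr p" using c mult_right_mono[of 1 c "\<bar>f x\<bar> powr p"] by simp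
        finally show "u x powr p \<le> c * \<bar>f x\<bar> powr p" .
      qed (use qf nn le c in \<open>auto intro!: powr_mono2\<close>)
      finally have "card J * bellman p (u x) (v x) \<le> card J * (c * (\<bar>f x\<bar> powr p + \<bar>g x\<bar> powr q))"
        by (intro mult_left_mono) (auto simp: distrib_left)
      then show "ennreal (card J * bellman p (u x) (v x))
        \<le> ennreal (card J * c) * (ennreal (\<bar>f x\<bar> powr p) + ennreal (\<bar>g x\<bar> powr q))"
        using c by (simp add: ennreal_leI mult.assoc flip: ennreal_mult' ennreal_plus)
    qed
    also have "\<dots> = ennreal (card J * c) * F"
      unfolding F_def by (simp add: nn_integral_cmult nn_integral_add)
    finally show ?thesis .
  qed
  define fp fm gp gm where "fp = (\<lambda>x. max 0 (f x))" and "fm = (\<lambda>x. max 0 (- f x))"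
    and "gp = (\<lambda>x. max 0 (g x))" and "gm = (\<lambda>x. max 0 (- g x))"
  have [measurable]: "fp \<in> borel_measurable borel" "fm \<in> borel_measurable borel"
     "gp \<in> borel_measurable borel" "gm \<in> borel_measurable borel"
    unfolding fp_def fm_def gp_def gm_def by measurable
  have f: "f = (\<lambda>x. fp x - fm x)" and g: "g = (\<lambda>x. gp x - gm x)"
    by (auto simp: fp_def fm_def gp_def gm_def)
  have "increment_energy J w K f g \<le> increment_energy J w K fp g + increment_energy J w K fm g"
    by (subst f) (intro increment_energy_add_le, auto)
  also have "\<dots> \<le> (increment_energy J w K fp gp + increment_energy J w K fp gm)
      + (increment_energy J w K fm gp + increment_energy J w K fm gm)"
  proof -
    have "increment_energy J w K h g \<le> increment_energy J w K h gp + increment_energy J w K h gm"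
      if [measurable]: "h \<in> borel_measurable borel" for h
      unfolding increment_energy_commute[of J w K h]
      by (subst g) (intro increment_energy_add_le, auto)
    then show ?thesis by (intro add_mono) auto
  qed
  also have "\<dots> \<le> (ennreal (card J * c) * F + ennreal (card J * c) * F)
      + (ennreal (card J * c) * F + ennreal (card J * c) * F)"
    by (intro add_mono *) (auto simp: fp_def fm_def gp_def gm_def)
  also have "\<dots> = ennreal (card J * (4 * c)) * F"
    using c by (simp add: distrib_right[symmetric] flip: ennreal_plus) (simp only: mult_ac)
  finally show ?thesis by (simp add: F_def c_def)
qed

text \<open>For p < 2 the conjugate exponent is above 2, and since the energy is symmetric, f and g
  exchange roles. The constant is chosen before \<open>J\<close>, \<open>w\<close> and
  \<open>K\<close>, which makes it uniform in the mesh and in the number of steps.\<close>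

lemma increment_energy_bound:
  assumes p: "1 < p"
  obtains C :: real where "0 \<le> C" "\<And>(J :: 'i set) (w :: 'i \<Rightarrow> 'a::euclidean_space) K f g. finite J \<Longrightarrow> J \<noteq> {} \<Longrightarrow>
     f \<in> borel_measurable borel \<Longrightarrow> g \<in> borel_measurable borel \<Longrightarrow>
     increment_energy J w K f g \<le> ennreal (card J * C)
     * ((\<integral>\<^sup>+x. \<bar>f x\<bar> powr p \<partial>lborel) + (\<integral>\<^sup>+x. \<bar>g x\<bar> powr conjugate_exponent p \<partial>lborel))"
proof (cases "2 \<le> p")
  case True
  define q where "q = conjugate_exponent p"
  have q: "1 < q" unfolding q_def by (rule conjugate_exponent_facts[OF True refl])
  show ?thesis
  proof (rule that[of "4 * (1 + 10 * q / (q - 1))"])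
    fix J :: "'i set" and w :: "'i \<Rightarrow> 'a" and K and f g :: "'a \<Rightarrow> real"
    assume *: "finite J" "J \<noteq> {}" "f \<in> borel_measurable borel" "g \<in> borel_measurable borel"
    show "increment_energy J w K f g \<le> ennreal (card J * (4 * (1 + 10 * q / (q - 1))))
     * ((\<integral>\<^sup>+x. \<bar>f x\<bar> powr p \<partial>lborel) + (\<integral>\<^sup>+x. \<bar>g x\<bar> powr conjugate_exponent p \<partial>lborel))"
      using increment_energy_bound_ge2[OF True *, of w K]
      by (simp only: q_def[symmetric])
  qed (use q in auto)
next
  case False
  define q where "q = conjugate_exponent p"
  have q: "2 \<le> q" "conjugate_exponent q = p"
    using p False by (auto simp: q_def conjugate_exponent_def field_simps)
  show ?thesis
  proof (rule that[of "4 * (1 + 10 * p / (p - 1))"])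
    fix J :: "'i set" and w :: "'i \<Rightarrow> 'a" and K and f g :: "'a \<Rightarrow> real"
    assume *: "finite J" "J \<noteq> {}" "f \<in> borel_measurable borel" "g \<in> borel_measurable borel"
    show "increment_energy J w K f g \<le> ennreal (card J * (4 * (1 + 10 * p / (p - 1))))
     * ((\<integral>\<^sup>+x. \<bar>f x\<bar> powr p \<partial>lborel) + (\<integral>\<^sup>+x. \<bar>g x\<bar> powr conjugate_exponent p \<partial>lborel))"
      using increment_energy_bound_ge2[OF q(1) *(1,2,4,3), of w K]
      by (simp only: q_def[symmetric] q(2) add.commute increment_energy_commute[of J w K f])
  qed (use p in auto)
qed

section \<open>The random walk\<close>

lemma translate_measurable [measurable]:
  fixes f :: "'a::euclidean_space \<Rightarrow> real"
  assumes [measurable]: "f \<in> borel_measurable borel"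
  shows "(\<lambda>x. f (x + a)) \<in> borel_measurable borel" "(\<lambda>x. f (x - a)) \<in> borel_measurable borel"
  by measurable

definition rw :: "real \<Rightarrow> (real^'n \<Rightarrow> real) \<Rightarrow> real^'n \<Rightarrow> real" where
  "rw h f x = (\<Sum>i\<in>UNIV. f (x + h *\<^sub>R axis i 1) + f (x - h *\<^sub>R axis i 1)) / (2 * CARD('n))"

text \<open>Deliberately not divided by 2 h: two such differences are about 4 h^2 times a second
  derivative, so plain sums over the steps of the walk are already Riemann sums in time.\<close>

definition cdiff :: "real \<Rightarrow> 'n::finite \<Rightarrow> (real^'n \<Rightarrow> real) \<Rightarrow> real^'n \<Rightarrow> real" where
  "cdiff h i f x = f (x + h *\<^sub>R axis i 1) - f (x - h *\<^sub>R axis i 1)"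

text \<open>The steps of two consecutive moves of the walk, \<open>h (s e\<^sub>i + t e\<^sub>j)\<close> with signs \<open>s\<close>, \<open>t\<close>.\<close>
definition double_steps :: "('n::finite \<times> 'n \<times> real \<times> real) set" where
  "double_steps = UNIV \<times> UNIV \<times> {1, -1} \<times> {1, -1}"

definition double_step :: "real \<Rightarrow> ('n::finite \<times> 'n \<times> real \<times> real) \<Rightarrow> real^'n" where
  "double_step h = (\<lambda>(i, j, s, t). (h * s) *\<^sub>R axis i 1 + (h * t) *\<^sub>R axis j 1)"

lemma double_steps_card: "finite (double_steps :: ('n::finite \<times> 'n \<times> real \<times> real) set)"
  "(double_steps :: ('n::finite \<times> 'n \<times> real \<times> real) set) \<noteq> {}"
  "card (double_steps :: ('n::finite \<times> 'n \<times> real \<times> real) set) = 4 * CARD('n) ^ 2"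
  by (auto simp: double_steps_def card_cartesian_product power2_eq_square)

lemma sum_double_steps:
  fixes F :: "('n::finite \<times> 'n \<times> real \<times> real) \<Rightarrow> 'b::ab_group_add"
  shows "(\<Sum>z\<in>double_steps. F z) = (\<Sum>i\<in>UNIV. \<Sum>j\<in>UNIV.
     F (i, j, 1, 1) + F (i, j, 1, -1) + F (i, j, -1, 1) + F (i, j, -1, -1))"
  unfolding double_steps_def sum.cartesian_product' by (simp add: add.assoc)

text \<open>Indexing the moves by directions and signs, not by the displacements themselves, keeps
  multiplicities. Two steps of the walk thus become an unweighted average, the form required by
  \<open>bellman_jensen\<close>.\<close>

lemma rw_rw:
  fixes f :: "real^'n \<Rightarrow> real"
  shows "rw h (rw h f) = average double_steps (double_step h) f"
proof
  fix x
  let ?e = "\<lambda>i. axis i 1 :: real^'n"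
  have "rw h (rw h f) x = (\<Sum>i\<in>UNIV. \<Sum>j\<in>UNIV.
      f (x + h *\<^sub>R ?e i + h *\<^sub>R ?e j) + f (x + h *\<^sub>R ?e i - h *\<^sub>R ?e j)
    + (f (x - h *\<^sub>R ?e i + h *\<^sub>R ?e j) + f (x - h *\<^sub>R ?e i - h *\<^sub>R ?e j))) / (4 * CARD('n) ^ 2)"
    unfolding rw_def by (simp add: sum.distrib sum_divide_distrib[symmetric]
      add_divide_distrib[symmetric] power2_eq_square)
  also have "\<dots> = average double_steps (double_step h) f x"
    unfolding average_def double_steps_card sum_double_steps double_step_def
    by (simp add: algebra_simps)
  finally show "rw h (rw h f) x = average double_steps (double_step h) f x" .
qed

lemma rw_pow_even: "(rw h ^^ (2 * k)) f = (average double_steps (double_step h) ^^ k) f"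
  by (induction k) (simp_all add: rw_rw)

lemma rw_measurable [measurable]:
  fixes f :: "real^'n \<Rightarrow> real"
  assumes [measurable]: "f \<in> borel_measurable borel"
  shows "rw h f \<in> borel_measurable borel"
  unfolding rw_def[abs_def] by measurable

lemma cdiff_measurable [measurable]:
  fixes f :: "real^'n \<Rightarrow> real"
  assumes [measurable]: "f \<in> borel_measurable borel"
  shows "cdiff h i f \<in> borel_measurable borel"
  unfolding cdiff_def[abs_def] by measurable

lemma rw_pow_measurable [measurable]:
  fixes f :: "real^'n \<Rightarrow> real"
  assumes [measurable]: "f \<in> borel_measurable borel"
  shows "(rw h ^^ k) f \<in> borel_measurable borel"
  by (induction k) auto

lemma rw_integrable:
  fixes f :: "real^'n \<Rightarrow> real"
  shows "integrable lborel f \<Longrightarrow> integrable lborel (rw h f)"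
  unfolding rw_def[abs_def]
  using integrable_lborel_translate[of f "h *\<^sub>R axis _ 1"] integrable_lborel_translate[of f "- h *\<^sub>R axis _ 1"]
  by (intro integrable_divide Bochner_Integration.integrable_sum Bochner_Integration.integrable_add) auto

lemma rw_pow_integrable:
  fixes f :: "real^'n \<Rightarrow> real"
  shows "integrable lborel f \<Longrightarrow> integrable lborel ((rw h ^^ k) f)"
  by (induction k) (auto intro: rw_integrable)

lemma rw_mono:
  fixes f :: "real^'n \<Rightarrow> real"
  assumes "\<And>x. f x \<le> g x"
  shows "rw h f x \<le> rw h g x"
  unfolding rw_def by (intro divide_right_mono sum_mono add_mono assms) auto

lemma rw_const: "rw h (\<lambda>_. c) = (\<lambda>_::real^'n. c)"
  by (rule ext) (simp add: rw_def)

lemma rw_bounded: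
  fixes f :: "real^'n \<Rightarrow> real"
  assumes "\<And>x. \<bar>f x\<bar> \<le> b"
  shows "\<bar>rw h f x\<bar> \<le> b"
proof -
  have "rw h f x \<le> rw h (\<lambda>_. b) x" "rw h (\<lambda>_. - b) x \<le> rw h f x"
    using assms by (auto intro!: rw_mono simp: abs_le_iff) (metis minus_le_iff)
  then show ?thesis by (simp add: rw_const)
qed

lemma rw_pow_bounded:
  fixes f :: "real^'n \<Rightarrow> real"
  assumes "\<And>x. \<bar>f x\<bar> \<le> b"
  shows "\<bar>(rw h ^^ k) f x\<bar> \<le> b"
  using assms by (induction k arbitrary: x) (auto intro: rw_bounded)

lemma rw_diff: "rw h (\<lambda>x. f x - g x) = (\<lambda>x. rw h f x - rw h g x)"
  by (auto simp: rw_def sum_subtractf sum.distrib diff_divide_distrib add_divide_distrib)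

lemma rw_pow_diff: "(rw h ^^ k) (\<lambda>x. f x - g x) = (\<lambda>x. (rw h ^^ k) f x - (rw h ^^ k) g x)"
  by (induction k) (auto simp: rw_diff)

lemma rw_translate: "rw h (\<lambda>x. f (x + a)) = (\<lambda>x. rw h f (x + a))"
  by (auto simp: rw_def algebra_simps)

lemma rw_pow_translate: "(rw h ^^ k) (\<lambda>x. f (x + a)) = (\<lambda>x. (rw h ^^ k) f (x + a))"
  by (induction k) (auto simp: rw_translate)

lemma cdiff_translate: "cdiff h i (\<lambda>x. f (x + a)) = (\<lambda>x. cdiff h i f (x + a))"
  by (auto simp: cdiff_def algebra_simps)

lemma rw_cdiff: "rw h (cdiff h' i f) = cdiff h' i (rw h f)"
proof -
  have "rw h (cdiff h' i f) = rw h (\<lambda>x. f (x + h' *\<^sub>R axis i 1) - f (x + (- h' *\<^sub>R axis i 1)))"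
    by (simp add: cdiff_def[abs_def])
  also have "\<dots> = cdiff h' i (rw h f)"
    unfolding rw_diff rw_translate by (simp add: cdiff_def[abs_def])
  finally show ?thesis .
qed

lemma rw_pow_cdiff: "(rw h ^^ k) (cdiff h' i f) = cdiff h' i ((rw h ^^ k) f)"
  by (induction k) (auto simp: rw_cdiff)

section \<open>Pairings with the walk\<close>

lemma integrable_mult_bounded:
  fixes f g :: "'a::euclidean_space \<Rightarrow> real"
  assumes f: "integrable lborel f" and [measurable]: "g \<in> borel_measurable borel"
    and b: "\<And>x. \<bar>g x\<bar> \<le> b"
  shows "integrable lborel (\<lambda>x. f x * g x)"
proof (rule Bochner_Integration.integrable_bound)
  show "integrable lborel (\<lambda>x. b * \<bar>f x\<bar>)" using f by auto
  have [measurable]: "f \<in> borel_measurable borel" using f by auto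
  show "(\<lambda>x. f x * g x) \<in> borel_measurable lborel" by measurable
  have "0 \<le> b" using b[of 0] by linarith
  then show "AE x in lborel. norm (f x * g x) \<le> norm (b * \<bar>f x\<bar>)"
    using b by (intro AE_I2) (simp add: abs_mult mult.commute[of "\<bar>f _\<bar>"] mult_right_mono)
qed

lemma integral_mult_bounded_le:
  fixes f g :: "'a::euclidean_space \<Rightarrow> real"
  assumes f: "integrable lborel f" and [measurable]: "g \<in> borel_measurable borel"
    and b: "\<And>x. \<bar>g x\<bar> \<le> b"
  shows "\<bar>LBINT x. f x * g x\<bar> \<le> b * (LBINT x. \<bar>f x\<bar>)"
proof -
  have "\<bar>LBINT x. f x * g x\<bar> \<le> (LBINT x. \<bar>f x * g x\<bar>)"
    by (rule integral_abs_bound)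
  also have "\<dots> \<le> (LBINT x. b * \<bar>f x\<bar>)"
    using f b integrable_mult_bounded[OF assms]
    by (intro integral_mono integrable_abs) (simp_all add: abs_mult mult.commute[of "\<bar>f _\<bar>"] mult_right_mono)
  finally show ?thesis by simp
qed

lemma integral_translate_mult:
  fixes f g :: "'a::euclidean_space \<Rightarrow> real"
  assumes [measurable]: "f \<in> borel_measurable borel" "g \<in> borel_measurable borel"
  shows "(LBINT x. f (x + a) * g x) = (LBINT x. f x * g (x - a))"
  using integral_lborel_translate[of "\<lambda>x. f x * g (x - a)" a] by simp

lemma rw_self_adjoint:
  fixes f g :: "real^'n \<Rightarrow> real"
  assumes f: "integrable lborel f" and g[measurable]: "g \<in> borel_measurable borel"
    and b: "\<And>x. \<bar>g x\<bar> \<le> b"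
  shows "(LBINT x. rw h f x * g x) = (LBINT x. f x * rw h g x)"
proof -
  have [measurable]: "f \<in> borel_measurable borel" using f by auto
  let ?a = "\<lambda>i. h *\<^sub>R axis i 1 :: real^'n"
  have i1: "integrable lborel (\<lambda>x. f (x + a) * g x)" for a
    by (rule integrable_mult_bounded[OF integrable_lborel_translate[OF f] g b])
  have i1': "integrable lborel (\<lambda>x. f (x - a) * g x)" for a using i1[of "- a"] by simp
  have i2: "integrable lborel (\<lambda>x. f x * g (x + a))" for a
    by (rule integrable_mult_bounded[OF f _ b]) measurable
  have i2': "integrable lborel (\<lambda>x. f x * g (x - a))" for a using i2[of "- a"] by simp
  have "(LBINT x. rw h f x * g x)
    = (LBINT x. (\<Sum>i\<in>UNIV. f (x + ?a i) * g x + f (x - ?a i) * g x) / (2 * CARD('n)))"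
    by (simp add: rw_def sum_distrib_right distrib_right)
  also have "\<dots> = (\<Sum>i\<in>UNIV. (LBINT x. f (x + ?a i) * g x) + (LBINT x. f (x - ?a i) * g x)) / (2 * CARD('n))"
    using i1 i1' by simp
  also have "\<dots> = (\<Sum>i\<in>UNIV. (LBINT x. f x * g (x - ?a i)) + (LBINT x. f x * g (x + ?a i))) / (2 * CARD('n))"
    using integral_translate_mult[of f g] integral_translate_mult[of f g "- _"] by simp
  also have "\<dots> = (LBINT x. (\<Sum>i\<in>UNIV. f x * g (x - ?a i) + f x * g (x + ?a i)) / (2 * CARD('n)))"
    using i2 i2' by simp
  also have "\<dots> = (LBINT x. f x * rw h g x)"
    by (simp add: rw_def sum_distrib_left distrib_left add.commute)
  finally show ?thesis .
qed

lemma rw_pow_self_adjoint: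
  fixes f g :: "real^'n \<Rightarrow> real"
  assumes f: "integrable lborel f" and g: "g \<in> borel_measurable borel"
    and b: "\<And>x. \<bar>g x\<bar> \<le> b"
  shows "(LBINT x. (rw h ^^ k) f x * g x) = (LBINT x. f x * (rw h ^^ k) g x)"
  using g b
proof (induction k arbitrary: g)
  case (Suc k)
  note [measurable] = Suc.prems(1)
  have "(LBINT x. (rw h ^^ Suc k) f x * g x) = (LBINT x. (rw h ^^ k) f x * rw h g x)"
    using rw_self_adjoint[OF rw_pow_integrable[OF f] Suc.prems] by simp
  also have "\<dots> = (LBINT x. f x * (rw h ^^ k) (rw h g) x)"
    by (rule Suc.IH) (use Suc.prems in \<open>auto intro: rw_bounded\<close>)
  finally show ?case by (simp add: funpow_swap1)
qed simp

text \<open>A polarisation identity. Each \<open>I s t\<close> has two terms independent of the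
  signs, minus the pairings of f with the translates of \<open>rw h (rw h g)\<close> by plus and
  minus the move. In the signed sum the former cancel and the translates assemble to the mixed
  central difference. Reversing both signs reverses the move, so every translate occurs twice,
  whence the factor 2.\<close>

lemma increment_pairing:
  fixes f g :: "real^'n \<Rightarrow> real" and h :: real and i j :: 'n
  assumes f: "integrable lborel f" and g[measurable]: "g \<in> borel_measurable borel"
    and b: "\<And>x. \<bar>g x\<bar> \<le> b"
  defines "I \<equiv> \<lambda>s t. \<integral>x. increment double_steps (double_step h) f (i, j, s, t) x
       * increment double_steps (double_step h) g (i, j, s, t) x \<partial>lborel"
  shows "- 2 * (LBINT x. f x * rw h (rw h (cdiff h i (cdiff h j g))) x)
      = I 1 1 - I 1 (-1) - I (-1) 1 + I (-1) (-1)"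
proof -
  have fm[measurable]: "f \<in> borel_measurable borel" using f by auto
  define z where "z = (\<lambda>s t. double_step h (i, j, s, t))"
  define T where "T = (\<lambda>u :: real^'n \<Rightarrow> real. rw h (rw h u))"
  have Tm[measurable]: "T g \<in> borel_measurable borel" "T f \<in> borel_measurable borel"
    unfolding T_def by auto
  have Tb: "\<bar>T u x\<bar> \<le> b" if "\<And>x. \<bar>u x\<bar> \<le> b" for u x
    unfolding T_def using that by (intro rw_bounded)
  have Ti: "integrable lborel (T f)" unfolding T_def using f by (intro rw_integrable)
  have adj: "(LBINT x. T f x * u x) = (LBINT x. f x * T u x)"
    if [measurable]: "u \<in> borel_measurable borel" and ub: "\<And>x. \<bar>u x\<bar> \<le> b" for u
    using rw_pow_self_adjoint[OF f that, where h = h and k = 2] by (simp add: T_def numeral_2_eq_2)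
  have Ttr: "T (\<lambda>x. g (x + a)) = (\<lambda>x. T g (x + a))" for a
    by (simp add: T_def rw_translate)
  have int: "integrable lborel (\<lambda>x. u x * v (x + a))"
    if "integrable lborel u" "v \<in> borel_measurable borel" "\<And>x. \<bar>v x\<bar> \<le> b" for u v a
    by (rule integrable_mult_bounded) (use that in auto)
  have I: "I s t = (LBINT x. f x * g x) + (LBINT x. T f x * T g x)
      - (LBINT x. f x * T g (x - z s t)) - (LBINT x. f x * T g (x + z s t))" for s t
  proof -
    have i: "integrable lborel (\<lambda>x. f (x + z s t) * g (x + z s t))"
      "integrable lborel (\<lambda>x. f (x + z s t) * T g x)"
      "integrable lborel (\<lambda>x. T f x * g (x + z s t))"
      "integrable lborel (\<lambda>x. T f x * T g x)"
      using int[OF integrable_lborel_translate[OF f] g b] 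
        int[OF integrable_lborel_translate[OF f] Tm(1) Tb[OF b], of _ 0]
        int[OF Ti g b] int[OF Ti Tm(1) Tb[OF b], of 0] by auto
    have "I s t = (\<integral>x. f (x + z s t) * g (x + z s t) - f (x + z s t) * T g x
        - T f x * g (x + z s t) + T f x * T g x \<partial>lborel)"
      unfolding I_def increment_def z_def[symmetric] T_def rw_rw
      by (simp add: algebra_simps z_def)
    also have "\<dots> = (LBINT x. f (x + z s t) * g (x + z s t)) - (LBINT x. f (x + z s t) * T g x)
        - (LBINT x. T f x * g (x + z s t)) + (LBINT x. T f x * T g x)"
      using i by simp
    also have "(LBINT x. f (x + z s t) * g (x + z s t)) = (LBINT x. f x * g x)"
      using integral_lborel_translate[of "\<lambda>x. f x * g x" "z s t"] by simp
    also have "(LBINT x. f (x + z s t) * T g x) = (LBINT x. f x * T g (x - z s t))"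
      by (rule integral_translate_mult) auto
    also have "(LBINT x. T f x * g (x + z s t)) = (LBINT x. f x * T g (x + z s t))"
      using adj[of "\<lambda>x. g (x + z s t)"] b by (simp add: Ttr)
    finally show ?thesis by simp
  qed
  have iT: "integrable lborel (\<lambda>x. f x * T g (x + a))" for a
    by (rule int[OF f Tm(1) Tb[OF b]])
  have z: "z (-1) (-1) = - z 1 1" "z (-1) 1 = - z 1 (-1)" by (auto simp: z_def double_step_def)
  have "I 1 1 - I 1 (-1) - I (-1) 1 + I (-1) (-1) = - 2 * ((LBINT x. f x * T g (x + z 1 1))
     - (LBINT x. f x * T g (x + z 1 (-1))) - (LBINT x. f x * T g (x + - z 1 (-1)))
     + (LBINT x. f x * T g (x + - z 1 1)))"
    unfolding I z by simp
  also have "\<dots> = - 2 * (\<integral>x. f x * T g (x + z 1 1) - f x * T g (x + z 1 (-1))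
     - f x * T g (x + - z 1 (-1)) + f x * T g (x + - z 1 1) \<partial>lborel)"
    using iT[of "z 1 1"] iT[of "z 1 (-1)"] iT[of "- z 1 1"] iT[of "- z 1 (-1)"] by simp
  also have "(\<lambda>x. f x * T g (x + z 1 1) - f x * T g (x + z 1 (-1))
     - f x * T g (x + - z 1 (-1)) + f x * T g (x + - z 1 1)) = (\<lambda>x. f x * cdiff h i (cdiff h j (T g)) x)"
    by (auto simp: fun_eq_iff cdiff_def z_def double_step_def algebra_simps)
  also have "cdiff h i (cdiff h j (T g)) = rw h (rw h (cdiff h i (cdiff h j g)))"
    by (simp add: T_def rw_cdiff)
  finally show ?thesis by simp
qed

text \<open>The sum over k is a Riemann sum, with time step proportional to h^2, of second
  derivatives of the heat flow: a truncated second-order Riesz transform of g, paired with f. The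
  constant depends on n and p only.\<close>

lemma discrete_riesz_bound:
  assumes p: "1 < p"
  obtains C :: real where "0 \<le> C"
    "\<And>h K i j (f :: real^'n \<Rightarrow> real) g b. integrable lborel f \<Longrightarrow> integrable lborel (\<lambda>x. \<bar>f x\<bar> powr p) \<Longrightarrow>
      g \<in> borel_measurable borel \<Longrightarrow> (\<And>x. \<bar>g x\<bar> \<le> b) \<Longrightarrow>
      integrable lborel (\<lambda>x. \<bar>g x\<bar> powr conjugate_exponent p) \<Longrightarrow>
      \<bar>\<Sum>k<K. LBINT x. f x * (rw h ^^ (4 * k + 2)) (cdiff h i (cdiff h j g)) x\<bar>
      \<le> C * ((LBINT x. \<bar>f x\<bar> powr p) + (LBINT x. \<bar>g x\<bar> powr conjugate_exponent p))"
proof -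
  define q where "q = conjugate_exponent p"
  show thesis
  proof (rule increment_energy_bound[OF p, where 'i = "'n \<times> 'n \<times> real \<times> real" and 'a = "real^'n"], goal_cases)
    case (1 C)
    note C = 1
    let ?J = "double_steps :: ('n \<times> 'n \<times> real \<times> real) set"
    define c where "c = card ?J * C"
    have c0: "0 \<le> c" using C by (simp add: c_def)
    show thesis
    proof (rule that[of c])
      fix h K i j and f g :: "real^'n \<Rightarrow> real" and b
      assume f: "integrable lborel f" "integrable lborel (\<lambda>x. \<bar>f x\<bar> powr p)"
        and g[measurable]: "g \<in> borel_measurable borel" and b: "\<And>x. \<bar>g x\<bar> \<le> b"
        and gq: "integrable lborel (\<lambda>x. \<bar>g x\<bar> powr conjugate_exponent p)"
      have [measurable]: "f \<in> borel_measurable borel" using f by auto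
      define T where "T = average ?J (double_step h)"
      define N where "N = (LBINT x. \<bar>f x\<bar> powr p) + (LBINT x. \<bar>g x\<bar> powr conjugate_exponent p)"
      have N0: "0 \<le> N" unfolding N_def by (intro add_nonneg_nonneg integral_nonneg) auto
      define X where "X = (\<lambda>k z x. increment ?J (double_step h) ((T ^^ k) f) z x
          * increment ?J (double_step h) ((T ^^ k) g) z x)"
      have [measurable]: "X k z \<in> borel_measurable borel" for k z
        unfolding X_def T_def by measurable
      have "increment_energy ?J (double_step h) K f g \<le> ennreal c * ennreal N"
        using C(2)[OF double_steps_card(1,2), of f g "double_step h" K] f gq
        by (simp add: c_def N_def nn_integral_eq_integral integral_nonneg flip: ennreal_plus)
      also have "increment_energy ?J (double_step h) K f g = (\<Sum>k<K. \<Sum>z\<in>?J. \<integral>\<^sup>+x. \<bar>X k z x\<bar> \<partial>lborel)"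
        by (simp add: increment_energy_def X_def T_def)
      finally have E: "(\<Sum>k<K. \<Sum>z\<in>?J. \<integral>\<^sup>+x. \<bar>X k z x\<bar> \<partial>lborel) \<le> ennreal (c * N)"
        using c0 by (simp add: ennreal_mult')
      have "(\<Sum>k<K. \<Sum>z\<in>?J. ennreal \<bar>LBINT x. X k z x\<bar>) \<le> (\<Sum>k<K. \<Sum>z\<in>?J. \<integral>\<^sup>+x. \<bar>X k z x\<bar> \<partial>lborel)"
      proof (intro sum_mono)
        fix k z
        show "ennreal \<bar>LBINT x. X k z x\<bar> \<le> (\<integral>\<^sup>+x. \<bar>X k z x\<bar> \<partial>lborel)"
        \<comment> \<open>Without integrability the Bochner integral on the left is 0 by
          convention.\<close>
        proof (cases "integrable lborel (X k z)")
          case True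
          then show ?thesis
            by (simp add: nn_integral_eq_integral integral_abs_bound ennreal_leI)
        qed (simp add: not_integrable_integral_eq)
      qed
      from order_trans[OF this E]
      have E': "(\<Sum>k<K. \<Sum>z\<in>?J. \<bar>LBINT x. X k z x\<bar>) \<le> c * N"
        using c0 N0 by (simp add: sum_nonneg)
      \<comment> \<open>Of the 4 k + 2 steps, 2 k are moved to f by self-adjointness and 2 k stay on
        g; the last two are those produced by \<open>increment_pairing\<close>.\<close>
      have k: "\<bar>LBINT x. f x * (rw h ^^ (4 * k + 2)) (cdiff h i (cdiff h j g)) x\<bar>
          \<le> (\<Sum>z\<in>?J. \<bar>LBINT x. X k z x\<bar>)" for k
      proof -
        let ?I = "\<lambda>s t. LBINT x. X k (i, j, s, t) x"
        have gk: "\<bar>(rw h ^^ (2 * k)) g x\<bar> \<le> b" for x by (rule rw_pow_bounded) (rule b)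
        have "(LBINT x. (rw h ^^ (2 * k)) f x * rw h (rw h (cdiff h i (cdiff h j ((rw h ^^ (2 * k)) g)))) x)
           = (LBINT x. (rw h ^^ (2 * k)) f x * (rw h ^^ (2 * k + 2)) (cdiff h i (cdiff h j g)) x)"
          by (simp add: rw_pow_cdiff)
        also have "\<dots> = (LBINT x. f x * (rw h ^^ (2 * k)) ((rw h ^^ (2 * k + 2)) (cdiff h i (cdiff h j g))) x)"
        proof (rule rw_pow_self_adjoint[OF f(1), of _ "4 * b"])
          fix x
          have "\<bar>cdiff h i (cdiff h j g) y\<bar> \<le> 4 * b" for y
            unfolding cdiff_def
            using b[of "y + h *\<^sub>R axis i 1 + h *\<^sub>R axis j 1"] b[of "y + h *\<^sub>R axis i 1 - h *\<^sub>R axis j 1"]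
              b[of "y - h *\<^sub>R axis i 1 + h *\<^sub>R axis j 1"] b[of "y - h *\<^sub>R axis i 1 - h *\<^sub>R axis j 1"] by linarith
          then show "\<bar>(rw h ^^ (2 * k + 2)) (cdiff h i (cdiff h j g)) x\<bar> \<le> 4 * b" by (rule rw_pow_bounded)
        qed measurable
        also have "(rw h ^^ (2 * k)) ((rw h ^^ (2 * k + 2)) (cdiff h i (cdiff h j g)))
            = (rw h ^^ (4 * k + 2)) (cdiff h i (cdiff h j g))"
          unfolding funpow_add[symmetric, THEN fun_cong, unfolded o_apply] by (simp add: algebra_simps)
        finally have "- 2 * (LBINT x. f x * (rw h ^^ (4 * k + 2)) (cdiff h i (cdiff h j g)) x)
           = ?I 1 1 - ?I 1 (-1) - ?I (-1) 1 + ?I (-1) (-1)"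
          using increment_pairing[where f = "(rw h ^^ (2 * k)) f" and g = "(rw h ^^ (2 * k)) g"
            and h = h and i = i and j = j, OF rw_pow_integrable[OF f(1)] _ gk]
          by (simp add: X_def T_def rw_pow_even)
        then have "2 * \<bar>LBINT x. f x * (rw h ^^ (4 * k + 2)) (cdiff h i (cdiff h j g)) x\<bar>
           \<le> \<bar>?I 1 1\<bar> + \<bar>?I 1 (-1)\<bar> + \<bar>?I (-1) 1\<bar> + \<bar>?I (-1) (-1)\<bar>" by linarith
        also have "\<dots> = (\<Sum>z\<in>{(i, j, 1, 1), (i, j, 1, -1), (i, j, -1, 1), (i, j, -1, -1)}. \<bar>LBINT x. X k z x\<bar>)"
          by simp
        also have "\<dots> \<le> (\<Sum>z\<in>?J. \<bar>LBINT x. X k z x\<bar>)"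
          by (rule sum_mono2) (auto simp: double_steps_def)
        finally show ?thesis by linarith
      qed
      have "\<bar>\<Sum>k<K. LBINT x. f x * (rw h ^^ (4 * k + 2)) (cdiff h i (cdiff h j g)) x\<bar>
        \<le> (\<Sum>k<K. \<Sum>z\<in>?J. \<bar>LBINT x. X k z x\<bar>)"
        by (rule order_trans[OF sum_abs sum_mono[OF k]])
      with E' show "\<bar>\<Sum>k<K. LBINT x. f x * (rw h ^^ (4 * k + 2)) (cdiff h i (cdiff h j g)) x\<bar>
        \<le> c * ((LBINT x. \<bar>f x\<bar> powr p) + (LBINT x. \<bar>g x\<bar> powr conjugate_exponent p))"
        unfolding N_def by linarith
    qed (rule c0)
  qed
qed

text \<open>The average of the square exceeds the square of the average by a variance over the 2 n
  neighbours. The two opposite neighbours in direction i alone contribute at least half of their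
  squared difference, weighted by 1 / (2 n).\<close>

lemma rw_variance:
  fixes u :: "real^'n \<Rightarrow> real"
  shows "(rw h u x)\<^sup>2 + (cdiff h i u x)\<^sup>2 / (4 * CARD('n)) \<le> rw h (\<lambda>x. (u x)\<^sup>2) x"
proof -
  define n where "n = real CARD('n)"
  have n: "1 \<le> n" by (simp add: n_def Suc_leI)
  define a where "a = (\<lambda>i. u (x + h *\<^sub>R axis i 1))"
  define b where "b = (\<lambda>i. u (x - h *\<^sub>R axis i 1))"
  define m where "m = rw h u x"
  have m: "(\<Sum>i\<in>UNIV. a i + b i) = 2 * n * m"
    using n by (simp add: m_def rw_def a_def b_def n_def)
  have "(cdiff h i u x)\<^sup>2 / 2 \<le> (a i - m)\<^sup>2 + (b i - m)\<^sup>2"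
  proof -
    have "(X - Y)\<^sup>2 / 2 \<le> X\<^sup>2 + Y\<^sup>2" for X Y :: real
      using zero_le_power2[of "X + Y"] by (simp add: power2_sum power2_diff field_simps)
    from this[of "a i - m" "b i - m"] show ?thesis by (simp add: cdiff_def a_def b_def)
  qed
  also have "\<dots> \<le> (\<Sum>i\<in>UNIV. (a i - m)\<^sup>2 + (b i - m)\<^sup>2)"
    by (rule member_le_sum) auto
  also have "\<dots> = (\<Sum>i\<in>UNIV. (a i)\<^sup>2 + (b i)\<^sup>2) - 2 * m * (\<Sum>i\<in>UNIV. a i + b i) + 2 * n * m\<^sup>2"
    by (simp add: power2_diff sum.distrib sum_subtractf sum_distrib_left sum_distrib_right n_def algebra_simps)
  also have "\<dots> = 2 * n * (rw h (\<lambda>x. (u x)\<^sup>2) x - m\<^sup>2)"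
    unfolding m using n by (simp add: rw_def a_def b_def n_def[symmetric] field_simps power2_eq_square)
  finally show ?thesis
    using n unfolding m_def[symmetric] by (simp add: field_simps n_def)
qed

text \<open>A discrete version of Bernstein's gradient estimate for the heat equation: with \<open>u\<^sub>k\<close> the
  \<open>k\<close>-th iterate, \<open>u\<^sub>k\<^sup>2 + (k - 1) (D u\<^sub>k\<^sub>-\<^sub>1)\<^sup>2 / 4n\<close> is a subsolution.\<close>
lemma rw_gradient_bound:
  fixes g :: "real^'n \<Rightarrow> real" and b :: real
  assumes b: "\<And>x. \<bar>g x\<bar> \<le> b"
  shows "k * (cdiff h i ((rw h ^^ k) g) x)\<^sup>2 \<le> 4 * CARD('n) * b\<^sup>2"
proof -
  define c where "c = 1 / (4 * real CARD('n))"
  have c: "0 < c" by (simp add: c_def)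
  define u where "u = (\<lambda>k. (rw h ^^ k) g)"
  have u_Suc: "u (Suc k) = rw h (u k)" for k by (simp add: u_def)
  have *: "(u (Suc k) x)\<^sup>2 + k * (c * (cdiff h i (u k) x)\<^sup>2) \<le> b\<^sup>2" for k x
  proof (induction k arbitrary: x)
    case 0
    have "\<bar>u (Suc 0) x\<bar> \<le> b" unfolding u_def by (rule rw_pow_bounded) (rule b)
    then show ?case using power_mono[of "\<bar>u (Suc 0) x\<bar>" b 2] by simp
  next
    case (Suc k)
    have d: "(cdiff h i (u (Suc k)) x)\<^sup>2 \<le> rw h (\<lambda>x. (cdiff h i (u k) x)\<^sup>2) x"
      using rw_variance[of h "cdiff h i (u k)" x i]
      by (simp add: u_Suc rw_cdiff) (smt (verit) divide_nonneg_nonneg of_nat_0_le_iff zero_le_power2 mult_nonneg_nonneg)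
    \<comment> \<open>Of the \<open>Suc k\<close> copies of the squared difference, one is paid for
      by the variance of \<open>u (Suc k)\<close> and the other k by \<open>d\<close>.\<close>
    have "(u (Suc (Suc k)) x)\<^sup>2 + Suc k * (c * (cdiff h i (u (Suc k)) x)\<^sup>2)
       = ((rw h (u (Suc k)) x)\<^sup>2 + (cdiff h i (u (Suc k)) x)\<^sup>2 / (4 * CARD('n))) + k * (c * (cdiff h i (u (Suc k)) x)\<^sup>2)"
      by (simp add: u_Suc c_def algebra_simps add_divide_distrib)
    also have "\<dots> \<le> rw h (\<lambda>x. (u (Suc k) x)\<^sup>2) x + k * (c * rw h (\<lambda>x. (cdiff h i (u k) x)\<^sup>2) x)"
      using d c by (intro add_mono rw_variance mult_left_mono) auto
    also have "\<dots> = rw h (\<lambda>x. (u (Suc k) x)\<^sup>2 + k * (c * (cdiff h i (u k) x)\<^sup>2)) x"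
      by (simp add: rw_def sum.distrib sum_distrib_left[symmetric] add_divide_distrib algebra_simps)
    also have "\<dots> \<le> rw h (\<lambda>_. b\<^sup>2) x" by (rule rw_mono) (rule Suc.IH)
    finally show ?case by (simp add: rw_const)
  qed
  have "k * (c * (cdiff h i (u k) x)\<^sup>2) \<le> b\<^sup>2"
    using *[of k x] zero_le_power2[of "u (Suc k) x"] by linarith
  then show ?thesis by (simp add: c_def u_def field_simps)
qed

section \<open>Test functions and finite differences\<close>

lemma partial_eq:
  "(f has_derivative f') (at x) \<Longrightarrow> partial i f x = f' (axis i 1)"
  unfolding partial_def using frechet_derivative_at by metis

lemma has_derivative_frechet:
  "f differentiable (at x) \<Longrightarrow> (f has_derivative frechet_derivative f (at x)) (at x)"
  by (simp add: frechet_derivative_works)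

lemma partial_add:
  assumes "f differentiable (at x)" "g differentiable (at x)"
  shows "partial i (\<lambda>x. f x + g x) x = partial i f x + partial i g x"
  using partial_eq[OF has_derivative_add[OF assms[THEN has_derivative_frechet]]] by (simp add: partial_def)

lemma partial_diff:
  assumes "f differentiable (at x)" "g differentiable (at x)"
  shows "partial i (\<lambda>x. f x - g x) x = partial i f x - partial i g x"
  using partial_eq[OF has_derivative_diff[OF assms[THEN has_derivative_frechet]]] by (simp add: partial_def)

lemma partial_mult:
  assumes "f differentiable (at x)" "g differentiable (at x)"
  shows "partial i (\<lambda>x. f x * g x) x = f x * partial i g x + partial i f x * g x"
  using partial_eq[OF has_derivative_mult[OF assms[THEN has_derivative_frechet]]] by (simp add: partial_def)

lemma partial_const: "partial i (\<lambda>x. c) = (\<lambda>x. 0)"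
  using partial_eq[OF has_derivative_const] by fastforce

lemma differentiable_translate:
  fixes f :: "real^'n \<Rightarrow> real"
  assumes "f differentiable (at (x + a))"
  shows "(\<lambda>x. f (x + a)) differentiable (at x)"
    "partial i (\<lambda>x. f (x + a)) x = partial i f (x + a)"
proof -
  have "((\<lambda>x. f (x + a)) has_derivative frechet_derivative f (at (x + a))) (at x)"
  proof -
    have "((\<lambda>x. x + a) has_derivative (\<lambda>x. x)) (at x)" by (auto intro!: derivative_eq_intros)
    from has_derivative_compose[OF this has_derivative_frechet[OF assms]] show ?thesis .
  qed
  then show "(\<lambda>x. f (x + a)) differentiable (at x)" "partial i (\<lambda>x. f (x + a)) x = partial i f (x + a)"
    using partial_eq by (auto simp: differentiable_def partial_def)
qed

lemma Ck_Suc_imp_Ck: "Ck (Suc k) f \<Longrightarrow> Ck k f"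
proof (induction k arbitrary: f)
  case 0
  then show ?case
    by (auto simp: continuous_on_eq_continuous_at intro: differentiable_imp_continuous_within)
qed auto

lemma Ck_add: "Ck k f \<Longrightarrow> Ck k g \<Longrightarrow> Ck k (\<lambda>x. f x + g x)"
proof (induction k arbitrary: f g)
  case (Suc k)
  then have "partial i (\<lambda>x. f x + g x) = (\<lambda>x. partial i f x + partial i g x)" for i
    by (auto simp: partial_add)
  then show ?case using Suc by auto
qed (auto intro: continuous_on_add)

lemma Ck_mult: "Ck k f \<Longrightarrow> Ck k g \<Longrightarrow> Ck k (\<lambda>x. f x * g x)"
proof (induction k arbitrary: f g)
  case (Suc k)
  then have "partial i (\<lambda>x. f x * g x) = (\<lambda>x. f x * partial i g x + partial i f x * g x)" for i
    by (auto simp: partial_mult)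
  moreover have "Ck k (\<lambda>x. f x * partial i g x + partial i f x * g x)" for i
    using Suc Ck_Suc_imp_Ck[OF Suc.prems(1)] Ck_Suc_imp_Ck[OF Suc.prems(2)] by (intro Ck_add) auto
  ultimately show ?case using Suc by auto
qed (auto intro: continuous_on_mult)

lemma Ck_const: "Ck k (\<lambda>x. c)"
  by (induction k arbitrary: c) (auto simp: partial_const)

lemma Ck_diff: "Ck k f \<Longrightarrow> Ck k g \<Longrightarrow> Ck k (\<lambda>x. f x - g x)"
  using Ck_add[of k f "\<lambda>x. - 1 * g x"] Ck_mult[OF Ck_const, of k g "- 1"] by simp

lemma Ck_translate:
  fixes f :: "real^'n \<Rightarrow> real"
  shows "Ck k f \<Longrightarrow> Ck k (\<lambda>x. f (x + a))"
proof (induction k arbitrary: f)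
  case 0
  then show ?case by (auto intro!: continuous_on_compose2[of UNIV f] continuous_intros)
next
  case (Suc k)
  then have "partial i (\<lambda>x. f (x + a)) = (\<lambda>x. partial i f (x + a))" for i
    by (auto simp: differentiable_translate)
  then show ?case using Suc by (auto intro: differentiable_translate)
qed

text \<open>Smooth functions of compact support with no condition at the boundary of the domain. The
  vanishing trace provides the weak identities for this larger class.\<close>

abbreviation test :: "(real^'n \<Rightarrow> real) \<Rightarrow> bool" where
  "test \<equiv> test_function UNIV"

lemma test_Ck: "test f \<Longrightarrow> Ck k f"
  by (simp add: test_function_def)

lemma test_differentiable: "test f \<Longrightarrow> f differentiable (at x)"
  using test_Ck[of f "Suc 0"] by auto

lemma test_continuous: "test f \<Longrightarrow> continuous_on UNIV f"
  using test_Ck[of f 0] by auto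

lemma testI:
  fixes f :: "real^'n \<Rightarrow> real"
  assumes "\<And>k. Ck k f" "bounded S" "\<And>x. x \<notin> S \<Longrightarrow> f x = 0"
  shows "test f"
  using assms bounded_subset[of S "{x. f x \<noteq> 0}"] by (force simp: test_function_def compact_closure)

lemma test_support:
  fixes f :: "real^'n \<Rightarrow> real"
  assumes "test f"
  obtains r where "0 < r" "\<And>x. r < norm x \<Longrightarrow> f x = 0"
proof -
  have "bounded (closure {x. f x \<noteq> 0})"
    using assms by (auto simp: test_function_def intro: compact_imp_bounded)
  then have "bounded {x. f x \<noteq> 0}" using bounded_subset closure_subset by metis
  then obtain r where "0 < r" "\<And>x. f x \<noteq> 0 \<Longrightarrow> norm x \<le> r" by (auto simp: bounded_pos)
  then show thesis by (intro that[of r]) force+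
qed

lemma test_partial:
  fixes f :: "real^'n \<Rightarrow> real"
  assumes f: "test f"
  shows "test (partial i f)"
proof -
  obtain r where r: "\<And>x. r < norm x \<Longrightarrow> f x = 0" using test_support[OF f] by metis
  show ?thesis
  proof (rule testI)
    show "Ck k (partial i f)" for k using test_Ck[OF f, of "Suc k"] by auto
    show "bounded (cball (0 :: real^'n) r)" by simp
    fix x :: "real^'n" assume "x \<notin> cball 0 r"
    then have "x \<in> - cball 0 r" "open (- cball (0 :: real^'n) r)" by auto
    moreover have "0 = f y" if "y \<in> - cball 0 r" for y using r that by auto
    ultimately have "(f has_derivative (\<lambda>_. 0)) (at x)"
      using has_derivative_transform_within_open[OF has_derivative_const] by blast
    then show "partial i f x = 0" by (rule partial_eq)
  qed
qed

lemma test_add: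
  fixes f g :: "real^'n \<Rightarrow> real"
  shows "test f \<Longrightarrow> test g \<Longrightarrow> test (\<lambda>x. f x + g x)"
proof -
  assume f: "test f" and g: "test g"
  obtain r where r: "\<And>x. r < norm x \<Longrightarrow> f x = 0" using test_support[OF f] by metis
  obtain s where s: "\<And>x. s < norm x \<Longrightarrow> g x = 0" using test_support[OF g] by metis
  show ?thesis
  proof (rule testI)
    show "Ck k (\<lambda>x. f x + g x)" for k by (rule Ck_add[OF test_Ck[OF f] test_Ck[OF g]])
    show "bounded (cball (0 :: real^'n) (max r s))" by simp
  qed (use r s in auto)
qed

lemma test_mult:
  fixes f g :: "real^'n \<Rightarrow> real"
  assumes f: "test f" and g: "\<And>k. Ck k g"
  shows "test (\<lambda>x. f x * g x)"
proof -
  obtain r where r: "\<And>x. r < norm x \<Longrightarrow> f x = 0" using test_support[OF f] by metis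
  show ?thesis
  proof (rule testI)
    show "Ck k (\<lambda>x. f x * g x)" for k by (rule Ck_mult[OF test_Ck[OF f] g])
    show "bounded (cball (0 :: real^'n) r)" by simp
  qed (use r in auto)
qed

lemma test_cmult:
  fixes f :: "real^'n \<Rightarrow> real"
  shows "test f \<Longrightarrow> test (\<lambda>x. c * f x)"
  using test_mult[of f "\<lambda>_. c"] by (simp add: Ck_const mult.commute)

lemma test_diff:
  fixes f g :: "real^'n \<Rightarrow> real"
  shows "test f \<Longrightarrow> test g \<Longrightarrow> test (\<lambda>x. f x - g x)"
  using test_add[of f "\<lambda>x. - 1 * g x"] test_cmult[of g "- 1"] by simp

lemma test_zero: "test (\<lambda>x. 0)"
  by (rule testI[of _ "{}"]) (auto intro: Ck_const)

lemma test_sum: "(\<And>i. i \<in> I \<Longrightarrow> test (f i)) \<Longrightarrow> test (\<lambda>x. \<Sum>i\<in>I. f i x)"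
  by (induction I rule: infinite_finite_induct) (auto intro: test_zero test_add)

lemma test_translate:
  fixes f :: "real^'n \<Rightarrow> real"
  assumes f: "test f"
  shows "test (\<lambda>x. f (x + a))"
proof -
  obtain r where r: "\<And>x. r < norm x \<Longrightarrow> f x = 0" using test_support[OF f] by metis
  show ?thesis
  proof (rule testI)
    show "Ck k (\<lambda>x. f (x + a))" for k by (rule Ck_translate[OF test_Ck[OF f]])
    show "bounded (cball (- a) r)" by simp
    fix x assume "x \<notin> cball (- a) r"
    then show "f (x + a) = 0" using norm_minus_commute[of "- a" x] by (intro r) (simp add: dist_norm norm_minus_commute add.commute)
  qed
qed

lemma test_measurable: "test f \<Longrightarrow> f \<in> borel_measurable borel"
  by (intro borel_measurable_continuous_onI test_continuous)

lemma test_bounded: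
  fixes f :: "real^'n \<Rightarrow> real"
  assumes f: "test f"
  obtains b where "0 \<le> b" "\<And>x. \<bar>f x\<bar> \<le> b"
proof -
  obtain r where r: "\<And>x. r < norm x \<Longrightarrow> f x = 0" using test_support[OF f] by metis
  have "compact (f ` cball 0 r)"
    using continuous_on_subset[OF test_continuous[OF f]] by (intro compact_continuous_image) auto
  then obtain b where "0 < b" "\<And>x. x \<in> cball 0 r \<Longrightarrow> \<bar>f x\<bar> \<le> b"
    by (auto simp: bounded_pos dest!: compact_imp_bounded)
  then show thesis using r by (intro that[of b]) (force simp: not_le)+
qed

lemma test_bounded_finite:
  fixes f :: "'i::finite \<Rightarrow> real^'n \<Rightarrow> real"
  assumes "\<And>i. test (f i)"
  obtains b where "0 \<le> b" "\<And>i x. \<bar>f i x\<bar> \<le> b"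
proof -
  have "\<exists>c. \<forall>x. \<bar>f i x\<bar> \<le> c" for i using test_bounded[OF assms] by metis
  then obtain c where c: "\<And>i x. \<bar>f i x\<bar> \<le> c i" by metis
  have "\<bar>f i x\<bar> \<le> (\<Sum>i\<in>UNIV. \<bar>c i\<bar>)" for i x
    using member_le_sum[of i UNIV "\<lambda>i. \<bar>c i\<bar>"] c[of i x] by force
  then show thesis by (intro that[of "\<Sum>i\<in>UNIV. \<bar>c i\<bar>"]) (auto intro: sum_nonneg)
qed

lemma test_integrable:
  fixes f :: "real^'n \<Rightarrow> real"
  assumes f: "test f"
  shows "integrable lborel f"
proof -
  obtain r where r: "\<And>x. r < norm x \<Longrightarrow> f x = 0" using test_support[OF f] by metis
  obtain b where b: "\<And>x. \<bar>f x\<bar> \<le> b" using test_bounded[OF f] by metis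
  have "emeasure lborel (cball (0 :: real^'n) r) < \<infinity>" by (rule emeasure_bounded_finite) simp
  then have "integrable lborel (\<lambda>x. indicator (cball 0 r) x * f x)"
    using test_measurable[OF f] b
    by (intro integrable_mult_bounded[where b = b] integrable_real_indicator)
      auto
  moreover have "(\<lambda>x. indicator (cball 0 r) x * f x) = f"
    using r by (auto simp: fun_eq_iff indicator_def)
  ultimately show ?thesis by simp
qed

lemma test_powr_integrable:
  fixes f :: "real^'n \<Rightarrow> real"
  assumes f: "test f" and q: "0 \<le> q"
  shows "integrable lborel (\<lambda>x. \<bar>f x\<bar> powr q)"
proof -
  note [measurable] = test_measurable[OF f]
  obtain r where r: "\<And>x. r < norm x \<Longrightarrow> f x = 0" using test_support[OF f] by metis
  obtain b where b: "\<And>x. \<bar>f x\<bar> \<le> b" using test_bounded[OF f] by metis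
  have "emeasure lborel (cball (0 :: real^'n) r) < \<infinity>" by (rule emeasure_bounded_finite) simp
  then have "integrable lborel (\<lambda>x. indicator (cball 0 r) x * \<bar>f x\<bar> powr q)"
    using b q by (intro integrable_mult_bounded[where b = "b powr q"] integrable_real_indicator)
      (auto intro!: powr_mono2)
  moreover have "(\<lambda>x. indicator (cball 0 r) x * \<bar>f x\<bar> powr q) = (\<lambda>x. \<bar>f x\<bar> powr q)"
    using r by (auto simp: fun_eq_iff indicator_def)
  ultimately show ?thesis by simp
qed

lemma partial_translate:
  fixes f :: "real^'n \<Rightarrow> real"
  shows "test f \<Longrightarrow> partial i (\<lambda>x. f (x + a)) = (\<lambda>x. partial i f (x + a))"
  by (auto intro!: differentiable_translate test_differentiable)

lemma partial_test_diff:
  fixes f g :: "real^'n \<Rightarrow> real"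
  shows "test f \<Longrightarrow> test g \<Longrightarrow> partial i (\<lambda>x. f x - g x) = (\<lambda>x. partial i f x - partial i g x)"
  by (auto intro!: partial_diff test_differentiable)

lemma partial_test_add:
  fixes f g :: "real^'n \<Rightarrow> real"
  shows "test f \<Longrightarrow> test g \<Longrightarrow> partial i (\<lambda>x. f x + g x) = (\<lambda>x. partial i f x + partial i g x)"
  by (auto intro!: partial_add test_differentiable)

lemma partial_test_cmult:
  fixes f :: "real^'n \<Rightarrow> real"
  shows "test f \<Longrightarrow> partial i (\<lambda>x. c * f x) = (\<lambda>x. c * partial i f x)"
  using partial_mult[of "\<lambda>_. c" _ f i] by (auto simp: partial_const test_differentiable)

lemma partial_test_sum:
  "(\<And>j. j \<in> I \<Longrightarrow> test (f j)) \<Longrightarrow> partial i (\<lambda>x. \<Sum>j\<in>I. f j x) = (\<lambda>x. \<Sum>j\<in>I. partial i (f j) x)"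
proof (induction I rule: infinite_finite_induct)
  case (insert j I)
  then show ?case using partial_test_add[OF _ test_sum, of "f j" I f i] by auto
qed (auto simp: partial_const)

section \<open>Finite differences of test functions and Taylor estimates\<close>

definition fdiff :: "real \<Rightarrow> 'n::finite \<Rightarrow> (real^'n \<Rightarrow> real) \<Rightarrow> real^'n \<Rightarrow> real" where
  "fdiff t i f x = f (x + t *\<^sub>R axis i 1) - f x"

lemma test_fdiff:
  fixes f :: "real^'n \<Rightarrow> real"
  assumes "test f"
  shows "test (fdiff t i f)" "partial j (fdiff t i f) = fdiff t i (partial j f)"
  using assms test_translate[OF assms] unfolding fdiff_def[abs_def]
  by (auto intro: test_diff simp: partial_test_diff partial_translate)

lemma cdiff_fdiff: "cdiff h i f = (\<lambda>x. fdiff h i f x - fdiff (- h) i f x)"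
  by (auto simp: cdiff_def fdiff_def)

lemma test_cdiff:
  fixes f :: "real^'n \<Rightarrow> real"
  assumes "test f"
  shows "test (cdiff h i f)" "partial j (cdiff h i f) = cdiff h i (partial j f)"
  using assms test_fdiff[OF assms] unfolding cdiff_fdiff
  by (auto intro: test_diff simp: partial_test_diff)

lemma test_rw:
  fixes f :: "real^'n \<Rightarrow> real"
  assumes f: "test f"
  shows "test (rw h f)" "partial j (rw h f) = rw h (partial j f)"
proof -
  have rw: "rw h u = (\<lambda>x. (1 / (2 * real CARD('n))) * (\<Sum>i\<in>UNIV. u (x + h *\<^sub>R axis i 1) + u (x + (- h *\<^sub>R axis i 1))))"
    for u :: "real^'n \<Rightarrow> real" by (auto simp: rw_def)
  have t: "test (\<lambda>x. f (x + h *\<^sub>R axis i 1) + f (x + (- h *\<^sub>R axis i 1)))" for i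
    by (intro test_add test_translate f)
  show "test (rw h f)" unfolding rw by (intro test_cmult test_sum t)
  have "partial j (rw h f) = (\<lambda>x. (1 / (2 * real CARD('n))) * partial j (\<lambda>x. \<Sum>i\<in>UNIV. f (x + h *\<^sub>R axis i 1) + f (x + (- h *\<^sub>R axis i 1))) x)"
    unfolding rw by (intro partial_test_cmult test_sum t)
  also have "\<dots> = rw h (partial j f)"
    unfolding rw partial_test_sum[OF t] partial_test_add[OF test_translate[OF f] test_translate[OF f]]
      partial_translate[OF f] ..
  finally show "partial j (rw h f) = rw h (partial j f)" .
qed

lemma test_rw_pow:
  fixes f :: "real^'n \<Rightarrow> real"
  assumes "test f"
  shows "test ((rw h ^^ k) f)" "partial j ((rw h ^^ k) f) = (rw h ^^ k) (partial j f)"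
proof -
  have "test ((rw h ^^ k) f) \<and> partial j ((rw h ^^ k) f) = (rw h ^^ k) (partial j f)"
    using assms by (induction k) (auto simp: test_rw)
  then show "test ((rw h ^^ k) f)" "partial j ((rw h ^^ k) f) = (rw h ^^ k) (partial j f)" by auto
qed

lemma test_has_derivative_line:
  fixes f :: "real^'n \<Rightarrow> real"
  assumes "test f"
  shows "((\<lambda>s. f (x + s *\<^sub>R axis i 1)) has_real_derivative partial i f (x + s *\<^sub>R axis i 1)) (at s)"
proof -
  let ?y = "x + s *\<^sub>R axis i 1"
  have D: "(f has_derivative frechet_derivative f (at ?y)) (at ?y)"
    by (rule has_derivative_frechet[OF test_differentiable[OF assms]])
  have "((\<lambda>s. x + s *\<^sub>R axis i 1) has_derivative (\<lambda>t. t *\<^sub>R axis i 1)) (at s)"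
    by (auto intro!: derivative_eq_intros)
  from has_derivative_compose[OF this D]
  have "((\<lambda>s. f (x + s *\<^sub>R axis i 1)) has_derivative (\<lambda>t. frechet_derivative f (at ?y) (t *\<^sub>R axis i 1))) (at s)" .
  moreover have "frechet_derivative f (at ?y) (t *\<^sub>R axis i 1) = partial i f ?y * t" for t
    using linear_scale[OF has_derivative_linear[OF D]] by (simp add: partial_def)
  ultimately show ?thesis by (simp add: has_field_derivative_def)
qed

lemma fdiff_bound:
  fixes f :: "real^'n \<Rightarrow> real"
  assumes f: "test f" and b: "\<And>x. \<bar>partial i f x\<bar> \<le> b"
  shows "\<bar>fdiff t i f x\<bar> \<le> b * \<bar>t\<bar>"
  using field_differentiable_bound[of UNIV "\<lambda>s. f (x + s *\<^sub>R axis i 1)"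
      "\<lambda>s. partial i f (x + s *\<^sub>R axis i 1)" b t 0] test_has_derivative_line[OF f] b
  by (simp add: fdiff_def)

lemma fdiff_taylor:
  fixes f :: "real^'n \<Rightarrow> real"
  assumes f: "test f" and b: "\<And>x. \<bar>partial i (partial i f) x\<bar> \<le> b"
  shows "\<bar>fdiff t i f x - t * partial i f x\<bar> \<le> b * t\<^sup>2"
proof -
  have b0: "0 \<le> b" using b[of 0] by linarith
  have "norm ((\<lambda>s. f (x + s *\<^sub>R axis i 1) - s * partial i f x) t - (\<lambda>s. f (x + s *\<^sub>R axis i 1) - s * partial i f x) 0)
     \<le> (b * \<bar>t\<bar>) * norm (t - 0)"
  proof (rule field_differentiable_bound[of "{-\<bar>t\<bar>..\<bar>t\<bar>}"])
    fix s assume s: "s \<in> {-\<bar>t\<bar>..\<bar>t\<bar>}"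
    show "((\<lambda>s. f (x + s *\<^sub>R axis i 1) - s * partial i f x) has_real_derivative
      (partial i f (x + s *\<^sub>R axis i 1) - partial i f x)) (at s within {-\<bar>t\<bar>..\<bar>t\<bar>})"
      by (rule derivative_eq_intros has_field_derivative_at_within[OF test_has_derivative_line[OF f]] refl)+ simp
    have "\<bar>partial i f (x + s *\<^sub>R axis i 1) - partial i f x\<bar> \<le> b * \<bar>s\<bar>"
      using fdiff_bound[OF test_partial[OF f] b, of s x] by (simp add: fdiff_def)
    also have "\<dots> \<le> b * \<bar>t\<bar>" using s b0 by (intro mult_left_mono) auto
    finally show "norm (partial i f (x + s *\<^sub>R axis i 1) - partial i f x) \<le> b * \<bar>t\<bar>" by simp
  qed auto
  then show ?thesis by (simp add: fdiff_def power2_eq_square mult.assoc abs_mult_self_eq algebra_simps)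
qed

text \<open>A single bound is carried because it survives translations and all powers of the walk;
  the Taylor errors below are therefore uniform in the number of steps.\<close>

definition smooth_bounded :: "real \<Rightarrow> (real^'n \<Rightarrow> real) \<Rightarrow> bool" where
  "smooth_bounded b f \<longleftrightarrow> test f \<and> (\<forall>x. \<bar>f x\<bar> \<le> b) \<and>
     (\<forall>i j x. \<bar>partial j (partial i f) x\<bar> \<le> b) \<and>
     (\<forall>i j k x. \<bar>partial k (partial j (partial i f)) x\<bar> \<le> b)"

lemma test_smooth_bounded:
  fixes f :: "real^'n \<Rightarrow> real"
  assumes f: "test f"
  obtains b where "smooth_bounded b f"
proof -
  obtain b1 where b1: "\<And>x. \<bar>f x\<bar> \<le> b1" using test_bounded[OF f] by metis
  obtain b2 where b2: "\<And>z x. \<bar>(case z of (i, j) \<Rightarrow> partial j (partial i f)) x\<bar> \<le> b2"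
    using test_bounded_finite[of "\<lambda>z. case z of (i, j) \<Rightarrow> partial j (partial i f)"] f
    by (auto simp: test_partial split: prod.splits) (metis (no_types, lifting))
  obtain b3 where b3: "\<And>z x. \<bar>(case z of (i, j, k) \<Rightarrow> partial k (partial j (partial i f))) x\<bar> \<le> b3"
    using test_bounded_finite[of "\<lambda>z. case z of (i, j, k) \<Rightarrow> partial k (partial j (partial i f))"] f
    by (auto simp: test_partial split: prod.splits) (metis (no_types, lifting))
  have "smooth_bounded (max b1 (max b2 b3)) f"
    unfolding smooth_bounded_def
    using f b1 b2[of "(_, _)"] b3[of "(_, _, _)"] by (auto simp: le_max_iff_disj)
  then show thesis by (rule that)
qed

lemma smooth_bounded_translate:
  "smooth_bounded b f \<Longrightarrow> smooth_bounded b (\<lambda>x. f (x + a))"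
  unfolding smooth_bounded_def by (auto simp: test_translate partial_translate test_partial)

lemma smooth_bounded_diff:
  assumes "smooth_bounded b f" "smooth_bounded c g"
  shows "smooth_bounded (b + c) (\<lambda>x. f x - g x)"
  using assms unfolding smooth_bounded_def
  by (auto simp: test_diff partial_test_diff test_partial intro!: order_trans[OF abs_triangle_ineq4] add_mono)

lemma smooth_bounded_rw_pow:
  "smooth_bounded b f \<Longrightarrow> smooth_bounded b ((rw h ^^ k) f)"
  unfolding smooth_bounded_def by (auto simp: test_rw_pow test_partial intro: rw_pow_bounded)

text \<open>Third derivatives suffice: differentiating \<open>fdiff t j g\<close> twice in direction
  i gives a difference of a second derivative, of size b |t|. The condition on |t| covers all four
  sign patterns that occur in a mixed central difference.\<close>

lemma fdiff_fdiff_approx: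
  fixes g :: "real^'n \<Rightarrow> real"
  assumes g: "smooth_bounded b g" and t: "\<bar>t\<bar> = \<bar>h\<bar>"
  shows "\<bar>fdiff h i (fdiff t j g) x - h * t * partial j (partial i g) x\<bar> \<le> 2 * b * \<bar>h\<bar> ^ 3"
proof -
  have tg: "test g" and b: "\<And>i j k x. \<bar>partial k (partial j (partial i g)) x\<bar> \<le> b"
    using g by (auto simp: smooth_bounded_def)
  have t2: "t\<^sup>2 = h\<^sup>2" using t by (metis power2_abs)
  have "\<bar>fdiff h i (fdiff t j g) x - h * partial i (fdiff t j g) x\<bar> \<le> (b * \<bar>t\<bar>) * h\<^sup>2"
    by (rule fdiff_taylor)
      (use tg b in \<open>auto simp: test_fdiff test_partial intro!: fdiff_bound\<close>)
  moreover have "\<bar>fdiff t j (partial i g) x - t * partial j (partial i g) x\<bar> \<le> b * t\<^sup>2"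
    by (rule fdiff_taylor) (use tg b in \<open>auto simp: test_partial\<close>)
  then have "\<bar>h\<bar> * \<bar>fdiff t j (partial i g) x - t * partial j (partial i g) x\<bar> \<le> \<bar>h\<bar> * (b * t\<^sup>2)"
    by (intro mult_left_mono) auto
  then have "\<bar>h * partial i (fdiff t j g) x - h * t * partial j (partial i g) x\<bar> \<le> \<bar>h\<bar> * (b * t\<^sup>2)"
    using tg by (simp add: abs_mult[symmetric] test_fdiff right_diff_distrib mult.assoc)
  ultimately have "\<bar>fdiff h i (fdiff t j g) x - h * t * partial j (partial i g) x\<bar>
     \<le> (b * \<bar>t\<bar>) * h\<^sup>2 + \<bar>h\<bar> * (b * t\<^sup>2)" by linarith
  also have "\<dots> = 2 * b * \<bar>h\<bar> ^ 3"
    unfolding t t2 by (simp add: power3_eq_cube power2_eq_square)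
  finally show ?thesis .
qed

lemma rw_minus_id_bound:
  fixes f :: "real^'n \<Rightarrow> real"
  assumes f: "test f" and b: "\<And>i x. \<bar>partial i f x\<bar> \<le> b"
  shows "\<bar>rw h f x - f x\<bar> \<le> b * \<bar>h\<bar>"
proof -
  have "rw h f x - f x = (\<Sum>i\<in>UNIV. fdiff h i f x + fdiff (- h) i f x) / (2 * CARD('n))"
    by (simp add: rw_def fdiff_def sum.distrib sum_subtractf field_simps)
  also have "\<bar>\<dots>\<bar> \<le> (\<Sum>i\<in>(UNIV::'n set). 2 * (b * \<bar>h\<bar>)) / (2 * CARD('n))"
    unfolding abs_divide
  proof (intro divide_mono order_trans[OF sum_abs] sum_mono)
    fix i
    show "\<bar>fdiff h i f x + fdiff (- h) i f x\<bar> \<le> 2 * (b * \<bar>h\<bar>)"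
      using fdiff_bound[where i = i and t = h and x = x, OF f b]
        fdiff_bound[where i = i and t = "- h" and x = x, OF f b] by auto
  qed auto
  finally show ?thesis by simp
qed

lemma rw_pow_minus_id_bound:
  fixes f :: "real^'n \<Rightarrow> real"
  assumes f: "test f" and b: "\<And>i x. \<bar>partial i f x\<bar> \<le> b"
  shows "\<bar>(rw h ^^ k) f x - f x\<bar> \<le> k * (b * \<bar>h\<bar>)"
proof (induction k)
  case (Suc k)
  have "\<bar>rw h ((rw h ^^ k) f) x - (rw h ^^ k) f x\<bar> \<le> b * \<bar>h\<bar>"
    using f b by (intro rw_minus_id_bound) (auto simp: test_rw_pow intro: rw_pow_bounded)
  with Suc show ?case by (simp add: algebra_simps)
qed simp

text \<open>The 16 is 8 + 8: four forward differences with error 2 b |h|^3 each, and 4 h^2 times the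
  cost 2 b |h| of replacing two steps of the walk by the identity. Those two steps are present
  because \<open>discrete_riesz_bound\<close> has them.\<close>

lemma cdiff_cdiff_approx:
  fixes g :: "real^'n \<Rightarrow> real"
  assumes g: "smooth_bounded b g"
  shows "\<bar>(rw h ^^ 2) (cdiff h i (cdiff h j g)) x - 4 * h\<^sup>2 * partial j (partial i g) x\<bar> \<le> 16 * b * \<bar>h\<bar> ^ 3"
proof -
  have tg: "test g" and b: "\<And>i j k x. \<bar>partial k (partial j (partial i g)) x\<bar> \<le> b"
    using g by (auto simp: smooth_bounded_def)
  let ?d = "partial j (partial i g)"
  have *: "\<bar>cdiff h i (cdiff h j g) y - 4 * h\<^sup>2 * ?d y\<bar> \<le> 8 * b * \<bar>h\<bar> ^ 3" for y
  proof -
    have "cdiff h i (cdiff h j g) y = fdiff h i (fdiff h j g) y - fdiff h i (fdiff (-h) j g) y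
       - fdiff (-h) i (fdiff h j g) y + fdiff (-h) i (fdiff (-h) j g) y"
      by (simp add: cdiff_def fdiff_def)
    moreover note fdiff_fdiff_approx[OF g, of h h i j y] fdiff_fdiff_approx[OF g, of "-h" h i j y]
      fdiff_fdiff_approx[OF g, of h "-h" i j y] fdiff_fdiff_approx[OF g, of "-h" "-h" i j y]
    ultimately show ?thesis by (simp add: power2_eq_square abs_le_iff)
  qed
  have "\<bar>(rw h ^^ 2) (\<lambda>y. cdiff h i (cdiff h j g) y - 4 * h\<^sup>2 * ?d y) x\<bar> \<le> 8 * b * \<bar>h\<bar> ^ 3"
    by (rule rw_pow_bounded) (rule *)
  moreover have "(rw h ^^ 2) (\<lambda>y. cdiff h i (cdiff h j g) y - 4 * h\<^sup>2 * ?d y) x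
      = (rw h ^^ 2) (cdiff h i (cdiff h j g)) x - 4 * h\<^sup>2 * (rw h ^^ 2) ?d x"
  proof -
    have "(rw h ^^ 2) (\<lambda>y. c * u y) x = c * (rw h ^^ 2) u x" for c u and x :: "real^'n"
      by (simp add: numeral_2_eq_2 rw_def sum_distrib_left distrib_left sum_divide_distrib add_divide_distrib)
    then show ?thesis by (simp add: rw_pow_diff)
  qed
  moreover have "\<bar>(rw h ^^ 2) ?d x - ?d x\<bar> \<le> real 2 * (b * \<bar>h\<bar>)"
    by (rule rw_pow_minus_id_bound) (use tg b in \<open>auto simp: test_partial\<close>)
  then have *: "4 * h\<^sup>2 * \<bar>(rw h ^^ 2) ?d x - ?d x\<bar> \<le> 4 * h\<^sup>2 * (real 2 * (b * \<bar>h\<bar>))"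
    by (intro mult_left_mono) auto
  have "\<bar>4 * h\<^sup>2 * (rw h ^^ 2) ?d x - 4 * h\<^sup>2 * ?d x\<bar> \<le> 8 * b * \<bar>h\<bar> ^ 3"
  proof -
    have "4 * h\<^sup>2 * (rw h ^^ 2) ?d x - 4 * h\<^sup>2 * ?d x = 4 * h\<^sup>2 * ((rw h ^^ 2) ?d x - ?d x)"
      by (rule right_diff_distrib[symmetric])
    then have "\<bar>4 * h\<^sup>2 * (rw h ^^ 2) ?d x - 4 * h\<^sup>2 * ?d x\<bar> = 4 * h\<^sup>2 * \<bar>(rw h ^^ 2) ?d x - ?d x\<bar>"
      by (simp add: abs_mult)
    also note *
    also have "4 * h\<^sup>2 * (real 2 * (b * \<bar>h\<bar>)) = 8 * b * \<bar>h\<bar> ^ 3"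
    proof -
      have "h\<^sup>2 = \<bar>h\<bar>\<^sup>2" by simp
      then show ?thesis by (simp add: power2_eq_square power3_eq_cube)
    qed
    finally show ?thesis .
  qed
  ultimately show ?thesis by linarith
qed

text \<open>Both terms are close to 2 h^3 times the mixed second derivative. The factor h / 2 gained
  over a pure second-order term is what pays for the order 1/h many differences that make up a
  translation of fixed length.\<close>

lemma partial_cdiff_approx:
  fixes g :: "real^'n \<Rightarrow> real"
  assumes g: "smooth_bounded b g" and h: "0 < h"
  shows "\<bar>h\<^sup>2 * partial i (cdiff h j g) x - h / 2 * (rw h ^^ 2) (cdiff h i (cdiff h j g)) x\<bar> \<le> 10 * b * h ^ 4"
proof -
  have tg: "test g" and b: "\<And>i j k x. \<bar>partial k (partial j (partial i g)) x\<bar> \<le> b"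
    using g by (auto simp: smooth_bounded_def)
  let ?d = "partial j (partial i g) x"
  have "\<bar>fdiff t j (partial i g) x - t * ?d\<bar> \<le> b * t\<^sup>2" for t
    by (rule fdiff_taylor) (use tg b in \<open>auto simp: test_partial\<close>)
  note this[of h] this[of "- h"]
  moreover have "partial i (cdiff h j g) x = fdiff h j (partial i g) x - fdiff (- h) j (partial i g) x"
    unfolding test_cdiff(2)[OF tg] unfolding cdiff_fdiff ..
  ultimately have "\<bar>partial i (cdiff h j g) x - 2 * h * ?d\<bar> \<le> 2 * (b * h\<^sup>2)"
    by (simp add: abs_le_iff)
  then have *: "h\<^sup>2 * \<bar>partial i (cdiff h j g) x - 2 * h * ?d\<bar> \<le> h\<^sup>2 * (2 * (b * h\<^sup>2))"
    by (intro mult_left_mono) auto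
  have 1: "\<bar>h\<^sup>2 * partial i (cdiff h j g) x - 2 * h ^ 3 * ?d\<bar> \<le> 2 * b * h ^ 4"
  proof -
    have "h\<^sup>2 * partial i (cdiff h j g) x - 2 * h ^ 3 * ?d = h\<^sup>2 * (partial i (cdiff h j g) x - 2 * h * ?d)"
      by (simp add: algebra_simps eval_nat_numeral)
    then have "\<bar>h\<^sup>2 * partial i (cdiff h j g) x - 2 * h ^ 3 * ?d\<bar> = h\<^sup>2 * \<bar>partial i (cdiff h j g) x - 2 * h * ?d\<bar>"
      by (simp add: abs_mult)
    also note *
    also have "h\<^sup>2 * (2 * (b * h\<^sup>2)) = 2 * b * h ^ 4" by (simp add: eval_nat_numeral)
    finally show ?thesis .
  qed
  have "h / 2 * \<bar>(rw h ^^ 2) (cdiff h i (cdiff h j g)) x - 4 * h\<^sup>2 * ?d\<bar> \<le> h / 2 * (16 * b * \<bar>h\<bar> ^ 3)"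
    using h by (intro mult_left_mono cdiff_cdiff_approx g) auto
  also have "h / 2 * \<bar>(rw h ^^ 2) (cdiff h i (cdiff h j g)) x - 4 * h\<^sup>2 * ?d\<bar>
      = \<bar>h / 2 * ((rw h ^^ 2) (cdiff h i (cdiff h j g)) x - 4 * h\<^sup>2 * ?d)\<bar>"
    using h by (simp add: abs_mult)
  also have "h / 2 * ((rw h ^^ 2) (cdiff h i (cdiff h j g)) x - 4 * h\<^sup>2 * ?d)
      = h / 2 * (rw h ^^ 2) (cdiff h i (cdiff h j g)) x - 2 * h ^ 3 * ?d"
    by (simp add: right_diff_distrib eval_nat_numeral)
  finally have 2: "\<bar>h / 2 * (rw h ^^ 2) (cdiff h i (cdiff h j g)) x - 2 * h ^ 3 * ?d\<bar> \<le> 8 * b * h ^ 4"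
    using h by (simp add: eval_nat_numeral mult_ac)
  from 1 2 show ?thesis by linarith
qed

definition laplacian :: "(real^'n \<Rightarrow> real) \<Rightarrow> real^'n \<Rightarrow> real" where
  "laplacian g x = (\<Sum>i\<in>UNIV. partial i (partial i g) x)"

lemma rw_laplacian_approx:
  fixes g :: "real^'n \<Rightarrow> real"
  assumes g: "smooth_bounded b g" and h: "0 \<le> h"
  shows "\<bar>rw h g x - g x - h\<^sup>2 / (2 * CARD('n)) * laplacian g x\<bar> \<le> b * h ^ 3"
proof -
  let ?n = "real CARD('n)"
  have "rw h g x - g x = (\<Sum>i\<in>UNIV. - fdiff h i (fdiff (- h) i g) x) / (2 * ?n)"
    by (simp add: rw_def fdiff_def sum.distrib sum_subtractf sum_negf field_simps)
  then have "rw h g x - g x - h\<^sup>2 / (2 * ?n) * laplacian g x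
     = (\<Sum>i\<in>UNIV. - (fdiff h i (fdiff (- h) i g) x - h * (- h) * partial i (partial i g) x)) / (2 * ?n)"
    by (simp add: laplacian_def sum_distrib_left[symmetric] sum_subtractf sum_negf sum.distrib power2_eq_square
        diff_divide_distrib add_divide_distrib)
  also have "\<bar>\<dots>\<bar> \<le> (\<Sum>i\<in>(UNIV :: 'n set). 2 * b * h ^ 3) / (2 * ?n)"
    unfolding abs_divide
  proof (intro divide_mono order_trans[OF sum_abs] sum_mono)
    fix i
    show "\<bar>- (fdiff h i (fdiff (- h) i g) x - h * - h * partial i (partial i g) x)\<bar> \<le> 2 * b * h ^ 3"
      using fdiff_fdiff_approx[OF g, of "- h" h i i x] h unfolding abs_minus_cancel by simp
  qed auto
  finally show ?thesis by simp
qed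

lemma rw_pow4_laplacian_approx:
  fixes g :: "real^'n \<Rightarrow> real"
  assumes g: "smooth_bounded b g" and h: "0 \<le> h"
  shows "\<bar>g x - (rw h ^^ 4) g x + 2 * h\<^sup>2 / CARD('n) * laplacian g x\<bar> \<le> 7 * b * h ^ 3"
proof -
  let ?n = "real CARD('n)"
  have tg: "test g" and b: "\<And>i j k x. \<bar>partial k (partial j (partial i g)) x\<bar> \<le> b"
    using g by (auto simp: smooth_bounded_def)
  define c where "c = h\<^sup>2 / (2 * ?n)"
  have c: "0 \<le> c" by (simp add: c_def)
  \<comment> \<open>Step l of the walk sees the Laplacian of \<open>(rw h ^^ l) g\<close>; returning
    to that of g costs \<open>c\<close> n l b h, that is l b h^3 / 2. Over l = 0, ..., 3 the total
    is 4 + 6 / 2 = 7 times b h^3.\<close>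
  have *: "\<bar>(rw h ^^ Suc l) g x - (rw h ^^ l) g x - c * laplacian g x\<bar> \<le> b * h ^ 3 + l * (b * h ^ 3 / 2)" for l
  proof -
    have "\<bar>rw h ((rw h ^^ l) g) x - (rw h ^^ l) g x - c * laplacian ((rw h ^^ l) g) x\<bar> \<le> b * h ^ 3"
      using rw_laplacian_approx[OF smooth_bounded_rw_pow[OF g, where h = h and k = l] h, of x] by (simp add: c_def)
    moreover have "\<bar>laplacian ((rw h ^^ l) g) x - laplacian g x\<bar> \<le> ?n * (l * (b * h))"
    proof -
      have "\<bar>laplacian ((rw h ^^ l) g) x - laplacian g x\<bar>
        \<le> (\<Sum>i\<in>(UNIV :: 'n set). l * (b * h))"
        unfolding laplacian_def sum_subtractf[symmetric]
      proof (intro order_trans[OF sum_abs] sum_mono)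
        fix i
        show "\<bar>partial i (partial i ((rw h ^^ l) g)) x - partial i (partial i g) x\<bar> \<le> l * (b * h)"
          using rw_pow_minus_id_bound[where f = "partial i (partial i g)" and b = b and h = h and k = l and x = x] tg b h
          by (simp add: test_rw_pow test_partial)
      qed
      then show ?thesis by simp
    qed
    then have "c * \<bar>laplacian ((rw h ^^ l) g) x - laplacian g x\<bar> \<le> c * (?n * (l * (b * h)))"
      using c by (intro mult_left_mono) auto
    then have "\<bar>c * laplacian ((rw h ^^ l) g) x - c * laplacian g x\<bar> \<le> l * (b * h ^ 3 / 2)"
      using c by (simp add: abs_mult right_diff_distrib[symmetric])
        (simp add: c_def power2_eq_square power3_eq_cube mult_ac)
    ultimately show ?thesis unfolding funpow.simps o_apply by linarith
  qed
  have "4 * c = 2 * h\<^sup>2 / ?n" by (simp add: c_def)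
  moreover have "\<bar>g x - (rw h ^^ 4) g x + 4 * c * laplacian g x\<bar> \<le> 7 * b * h ^ 3"
  proof -
    have sum4: "\<bar>x0 - x4 + 4 * y\<bar> \<le> 7 * B"
      if "\<bar>x1 - x0 - y\<bar> \<le> B" "\<bar>x2 - x1 - y\<bar> \<le> B + B / 2" "\<bar>x3 - x2 - y\<bar> \<le> B + 2 * (B / 2)"
        "\<bar>x4 - x3 - y\<bar> \<le> B + 3 * (B / 2)" for x0 x1 x2 x3 x4 y B :: real
      using that unfolding abs_le_iff by (intro conjI; linarith)
    show ?thesis
      using sum4[of "(rw h ^^ 1) g x" "(rw h ^^ 0) g x" "c * laplacian g x" "b * h ^ 3" "(rw h ^^ 2) g x"
          "(rw h ^^ 3) g x" "(rw h ^^ 4) g x"] *[of 0] *[of 1] *[of 2] *[of 3]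
      by (simp add: eval_nat_numeral mult.assoc)
  qed
  ultimately show ?thesis by simp
qed

section \<open>Passage to the continuum limit\<close>

lemma integral_test_approx:
  fixes f u v :: "real^'n \<Rightarrow> real"
  assumes f: "integrable lborel f" and u: "test u" and v: "test v"
    and le: "\<And>x. \<bar>u x - v x\<bar> \<le> c"
  shows "\<bar>(LBINT x. f x * u x) - (LBINT x. f x * v x)\<bar> \<le> c * (LBINT x. \<bar>f x\<bar>)"
proof -
  have "integrable lborel (\<lambda>x. f x * w x)" if "test w" for w
    using test_bounded[OF that] integrable_mult_bounded[OF f test_measurable[OF that]] by metis
  then have "(LBINT x. f x * u x) - (LBINT x. f x * v x) = (LBINT x. f x * (u x - v x))"
    using u v by (simp add: right_diff_distrib)
  then show ?thesis
    using integral_mult_bounded_le[OF f test_measurable[OF test_diff[OF u v]] le] by simp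
qed

lemma integrable_mult_test:
  fixes f u :: "real^'n \<Rightarrow> real"
  assumes f: "integrable lborel f" and u: "test u"
  shows "integrable lborel (\<lambda>x. f x * u x)"
  using test_bounded[OF u] integrable_mult_bounded[OF f test_measurable[OF u]] by metis

lemma second_order_sum_bound:
  fixes f g :: "real^'n \<Rightarrow> real"
  assumes riesz: "\<bar>\<Sum>k<K. LBINT x. f x * (rw h ^^ (4 * k + 2)) (cdiff h i (cdiff h j g)) x\<bar> \<le> X"
    and f: "integrable lborel f" and g: "smooth_bounded b g" and h: "0 < h"
  shows "\<bar>\<Sum>k<K. h\<^sup>2 * (LBINT x. f x * partial j (partial i ((rw h ^^ (4 * k)) g)) x)\<bar>
     \<le> X / 4 + K * (4 * b * h ^ 3 * (LBINT x. \<bar>f x\<bar>))"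
proof -
  have tg: "test g" using g by (simp add: smooth_bounded_def)
  let ?a = "\<lambda>k. LBINT x. f x * (rw h ^^ (4 * k + 2)) (cdiff h i (cdiff h j g)) x"
  let ?b = "\<lambda>k. h\<^sup>2 * (LBINT x. f x * partial j (partial i ((rw h ^^ (4 * k)) g)) x)"
  have *: "\<bar>?b k - ?a k / 4\<bar> \<le> 4 * b * h ^ 3 * (LBINT x. \<bar>f x\<bar>)" for k
  proof -
    let ?g = "(rw h ^^ (4 * k)) g"
    have g': "smooth_bounded b ?g" by (rule smooth_bounded_rw_pow[OF g])
    have t: "test ?g" using g' by (simp add: smooth_bounded_def)
    have e: "(rw h ^^ (4 * k + 2)) (cdiff h i (cdiff h j g)) = (rw h ^^ 2) (cdiff h i (cdiff h j ?g))"
      by (simp only: add.commute[of "4 * k" 2] funpow_add o_apply rw_pow_cdiff)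
    have "\<bar>?a k - (LBINT x. f x * (4 * h\<^sup>2 * partial j (partial i ?g) x))\<bar>
        \<le> (16 * b * \<bar>h\<bar> ^ 3) * (LBINT x. \<bar>f x\<bar>)"
      unfolding e
      by (rule integral_test_approx[OF f _ _ cdiff_cdiff_approx[OF g']])
        (intro test_cmult test_rw_pow test_partial test_cdiff t)+
    moreover have "(LBINT x. f x * (4 * h\<^sup>2 * partial j (partial i ?g) x))
        = 4 * ?b k" by (simp add: mult.left_commute[of "f _"])
    ultimately show ?thesis using h by simp
  qed
  have "(\<Sum>k<K. ?b k) = (\<Sum>k<K. ?b k - ?a k / 4) + (\<Sum>k<K. ?a k) / 4"
    by (simp add: sum_subtractf sum_divide_distrib)
  moreover have "\<bar>\<Sum>k<K. ?b k - ?a k / 4\<bar> \<le> (\<Sum>k<K. 4 * b * h ^ 3 * (LBINT x. \<bar>f x\<bar>))"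
    by (rule order_trans[OF sum_abs sum_mono[OF *]])
  ultimately show ?thesis using riesz by simp
qed

lemma cdiff_shift:
  fixes f :: "real^'n \<Rightarrow> real"
  shows "cdiff h j f (x + ((2 * real r + 1) * h) *\<^sub>R axis j 1)
    = f (x + (2 * h * real (Suc r)) *\<^sub>R axis j 1) - f (x + (2 * h * real r) *\<^sub>R axis j 1)"
proof -
  have "((2 * real r + 1) * h) *\<^sub>R v + h *\<^sub>R v = (2 * h * real (Suc r)) *\<^sub>R v"
    "((2 * real r + 1) * h) *\<^sub>R v - h *\<^sub>R v = (2 * h * real r) *\<^sub>R v" for v :: "real^'n"
    unfolding scaleR_left_distrib[symmetric] scaleR_left_diff_distrib[symmetric] by (simp_all add: algebra_simps)
  then show ?thesis by (simp only: cdiff_def add.assoc add_diff_eq[symmetric])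
qed

text \<open>The translation difference telescopes into N central differences of translates of g.
  With them every first derivative becomes a mixed second difference, to which the Riesz bound
  applies. That bound is assumed for all translates with one \<open>X\<close>. When N h stays fixed,
  the main term N h X / 2 stays bounded.\<close>

lemma first_order_sum_bound:
  fixes f g :: "real^'n \<Rightarrow> real"
  assumes riesz: "\<And>y. \<bar>\<Sum>k<K. LBINT x. f x * (rw h ^^ (4 * k + 2)) (cdiff h i (cdiff h j (\<lambda>x. g (x + y)))) x\<bar> \<le> X"
    and f: "integrable lborel f" and g: "smooth_bounded b g" and h: "0 < h"
  shows "\<bar>\<Sum>k<K. h\<^sup>2 * (\<integral>x. f x * partial i ((rw h ^^ (4 * k))
         (\<lambda>x. g (x + (2 * h * real N) *\<^sub>R axis j 1) - g x)) x \<partial>lborel)\<bar>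
     \<le> N * (h / 2 * X + K * (10 * b * h ^ 4 * (LBINT x. \<bar>f x\<bar>)))"
proof -
  define G where "G = (\<lambda>r x. g (x + ((2 * real r + 1) * h) *\<^sub>R axis j 1))"
  have Gb: "smooth_bounded b (G r)" for r unfolding G_def by (rule smooth_bounded_translate[OF g])
  have Gt: "test (G r)" for r using Gb[of r] by (simp add: smooth_bounded_def)
  have tele: "(\<lambda>x. g (x + (2 * h * real N) *\<^sub>R axis j 1) - g x) = (\<lambda>x. \<Sum>r<N. cdiff h j (G r) x)"
  proof
    fix x
    have "(\<Sum>r<N. cdiff h j (G r) x) = (\<Sum>r<N. g (x + (2 * h * real (Suc r)) *\<^sub>R axis j 1) - g (x + (2 * h * real r) *\<^sub>R axis j 1))"
      by (simp only: G_def cdiff_translate cdiff_shift)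
    also have "\<dots> = g (x + (2 * h * real N) *\<^sub>R axis j 1) - g x"
      by (subst sum_lessThan_telescope) simp
    finally show "g (x + (2 * h * real N) *\<^sub>R axis j 1) - g x = (\<Sum>r<N. cdiff h j (G r) x)" by simp
  qed
  let ?d = "\<lambda>k r. partial i (cdiff h j ((rw h ^^ (4 * k)) (G r)))"
  have dt: "test (?d k r)" for k r by (intro test_partial test_cdiff test_rw_pow Gt)
  have rw_sum: "(rw h ^^ m) (\<lambda>x. \<Sum>r<N. u r x) = (\<lambda>x. \<Sum>r<N. (rw h ^^ m) (u r) x)" for m and u :: "nat \<Rightarrow> real^'n \<Rightarrow> real"
  proof (induction m)
    case (Suc m)
    have "rw h (\<lambda>x. \<Sum>r<N. v r x) = (\<lambda>x. \<Sum>r<N. rw h (v r) x)" for v :: "nat \<Rightarrow> real^'n \<Rightarrow> real"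
    proof
      fix x
      have "rw h (\<lambda>x. \<Sum>r<N. v r x) x = (\<Sum>i\<in>UNIV. \<Sum>r<N. v r (x + h *\<^sub>R axis i 1) + v r (x - h *\<^sub>R axis i 1)) / (2 * CARD('n))"
        by (simp add: rw_def sum.distrib)
      also have "\<dots> = (\<Sum>r<N. \<Sum>i\<in>UNIV. v r (x + h *\<^sub>R axis i 1) + v r (x - h *\<^sub>R axis i 1)) / (2 * CARD('n))"
        by (subst sum.swap) (rule refl)
      also have "\<dots> = (\<Sum>r<N. rw h (v r) x)"
        by (simp only: rw_def sum_divide_distrib)
      finally show "rw h (\<lambda>x. \<Sum>r<N. v r x) x = (\<Sum>r<N. rw h (v r) x)" .
    qed
    then show ?case by (simp add: Suc)
  qed simp
  have p: "partial i ((rw h ^^ (4 * k)) (\<lambda>x. g (x + (2 * h * real N) *\<^sub>R axis j 1) - g x)) = (\<lambda>x. \<Sum>r<N. ?d k r x)" for k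
    unfolding tele rw_sum
    by (subst partial_test_sum) (auto simp: rw_pow_cdiff intro!: test_cdiff test_rw_pow Gt)
  have *: "\<bar>\<Sum>k<K. h\<^sup>2 * (LBINT x. f x * ?d k r x)\<bar> \<le> h / 2 * X + K * (10 * b * h ^ 4 * (LBINT x. \<bar>f x\<bar>))" for r
  proof -
    let ?a = "\<lambda>k. LBINT x. f x * (rw h ^^ (4 * k + 2)) (cdiff h i (cdiff h j (G r))) x"
    have e: "\<bar>h\<^sup>2 * (LBINT x. f x * ?d k r x) - h / 2 * ?a k\<bar> \<le> 10 * b * h ^ 4 * (LBINT x. \<bar>f x\<bar>)" for k
    proof -
      let ?g = "(rw h ^^ (4 * k)) (G r)"
      have g': "smooth_bounded b ?g" by (rule smooth_bounded_rw_pow[OF Gb])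
      have t: "test ?g" using g' by (simp add: smooth_bounded_def)
      have e: "(rw h ^^ (4 * k + 2)) (cdiff h i (cdiff h j (G r))) = (rw h ^^ 2) (cdiff h i (cdiff h j ?g))"
        by (simp only: add.commute[of "4 * k" 2] funpow_add o_apply rw_pow_cdiff)
      have "\<bar>(LBINT x. f x * (h\<^sup>2 * ?d k r x)) - (LBINT x. f x * (h / 2 * (rw h ^^ 2) (cdiff h i (cdiff h j ?g)) x))\<bar>
        \<le> (10 * b * h ^ 4) * (LBINT x. \<bar>f x\<bar>)"
        by (rule integral_test_approx[OF f _ _ partial_cdiff_approx[OF g' h]])
          (intro test_cmult test_rw_pow test_partial test_cdiff t)+
      then show ?thesis unfolding e by (simp add: mult.left_commute[of "f _"])
    qed
    have "(\<Sum>k<K. h\<^sup>2 * (LBINT x. f x * ?d k r x))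
      = (\<Sum>k<K. h\<^sup>2 * (LBINT x. f x * ?d k r x) - h / 2 * ?a k) + h / 2 * (\<Sum>k<K. ?a k)"
      by (simp add: sum_subtractf sum_distrib_left)
    moreover have "\<bar>\<Sum>k<K. h\<^sup>2 * (LBINT x. f x * ?d k r x) - h / 2 * ?a k\<bar>
       \<le> (\<Sum>k<K. 10 * b * h ^ 4 * (LBINT x. \<bar>f x\<bar>))"
      by (rule order_trans[OF sum_abs sum_mono[OF e]])
    moreover have "\<bar>h / 2 * (\<Sum>k<K. ?a k)\<bar> \<le> h / 2 * X"
    proof -
      have Gr: "G r = (\<lambda>x. g (x + ((2 * real r + 1) * h) *\<^sub>R axis j 1))" by (simp add: G_def)
      show ?thesis
        using mult_left_mono[OF riesz[of "((2 * real r + 1) * h) *\<^sub>R axis j 1", folded Gr], of "h / 2"] h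
        by (simp only: abs_mult) simp
    qed
    ultimately show ?thesis by simp
  qed
  have "(\<Sum>k<K. h\<^sup>2 * (\<integral>x. f x * partial i ((rw h ^^ (4 * k))
         (\<lambda>x. g (x + (2 * h * real N) *\<^sub>R axis j 1) - g x)) x \<partial>lborel))
    = (\<Sum>k<K. \<Sum>r<N. h\<^sup>2 * (LBINT x. f x * ?d k r x))"
    unfolding p using integrable_mult_test[OF f dt] by (simp add: sum_distrib_left)
  also have "\<dots> = (\<Sum>r<N. \<Sum>k<K. h\<^sup>2 * (LBINT x. f x * ?d k r x))" by (rule sum.swap)
  also have "\<bar>\<dots>\<bar> \<le> (\<Sum>r<N. h / 2 * X + K * (10 * b * h ^ 4 * (LBINT x. \<bar>f x\<bar>)))"
    by (rule order_trans[OF sum_abs sum_mono[OF *]])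
  finally show ?thesis by simp
qed

text \<open>The same telescoping, with each central difference bounded by
  \<open>rw_gradient_bound\<close>. For N of order 1/h the bound is of order 1 over the square root
  of k h^2, so it decays as the elapsed time grows.\<close>

lemma rw_translate_decay:
  fixes g :: "real^'n \<Rightarrow> real"
  assumes b: "\<And>x. \<bar>g x\<bar> \<le> b" and k: "0 < k"
  shows "\<bar>(rw h ^^ k) (\<lambda>x. g (x + (2 * h * real N) *\<^sub>R axis j 1) - g x) x\<bar> \<le> N * (2 * b * sqrt (CARD('n) / k))"
proof -
  let ?u = "(rw h ^^ k) g"
  have b0: "0 \<le> b" using b[of 0] by linarith
  have d: "\<bar>cdiff h j ?u y\<bar> \<le> 2 * b * sqrt (CARD('n) / k)" for y
  proof (rule power2_le_imp_le)
    have "k * (cdiff h j ?u y)\<^sup>2 \<le> 4 * CARD('n) * b\<^sup>2" using rw_gradient_bound[where g = g and b = b] b by simp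
    then show "\<bar>cdiff h j ?u y\<bar>\<^sup>2 \<le> (2 * b * sqrt (CARD('n) / k))\<^sup>2"
      using k by (simp add: power_mult_distrib field_simps)
  qed (use b0 in simp)
  have "(rw h ^^ k) (\<lambda>x. g (x + (2 * h * real N) *\<^sub>R axis j 1) - g x) x
     = ?u (x + (2 * h * real N) *\<^sub>R axis j 1) - ?u x"
    unfolding rw_pow_diff rw_pow_translate ..
  also have "\<dots> = (\<Sum>r<N. ?u (x + (2 * h * real (Suc r)) *\<^sub>R axis j 1) - ?u (x + (2 * h * real r) *\<^sub>R axis j 1))"
    by (subst sum_lessThan_telescope) simp
  also have "\<dots> = (\<Sum>r<N. cdiff h j ?u (x + ((2 * real r + 1) * h) *\<^sub>R axis j 1))"
    by (simp only: cdiff_shift)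
  also have "\<bar>\<dots>\<bar> \<le> (\<Sum>r<N. 2 * b * sqrt (CARD('n) / k))"
    by (rule order_trans[OF sum_abs sum_mono[OF d]])
  finally show ?thesis by simp
qed

text \<open>Bounding |a - b| by twice the maximum gives a constant valid for every exponent q \<ge>
  0. It serves for exponents above 1 and, at the very end, for 1 / p.\<close>

lemma powr_diff_le:
  fixes a b q :: real
  assumes "0 \<le> q"
  shows "\<bar>a - b\<bar> powr q \<le> 2 powr q * (\<bar>a\<bar> powr q + \<bar>b\<bar> powr q)"
proof -
  have "\<bar>a - b\<bar> powr q \<le> (2 * max \<bar>a\<bar> \<bar>b\<bar>) powr q" using assms by (intro powr_mono2) auto
  also have "\<dots> = 2 powr q * max \<bar>a\<bar> \<bar>b\<bar> powr q" by (simp add: powr_mult)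
  also have "\<dots> \<le> 2 powr q * (\<bar>a\<bar> powr q + \<bar>b\<bar> powr q)"
    by (intro mult_left_mono) (auto simp: max_def)
  finally show ?thesis .
qed

text \<open>The weak hypothesis says D_i A = E_i - (sum over l of D_l S_il). What matters in the
  conclusion is that \<open>C\<close> does not depend on \<open>G\<close>: the bounds on derivatives
  of \<open>G\<close> enter only error terms that vanish in the limit, so \<open>G\<close> may
  afterwards approximate a merely bounded function.\<close>

lemma weak_gradient_bound:
  assumes p: "1 < p"
  defines "q \<equiv> conjugate_exponent p"
  obtains C :: real where "0 \<le> C"
    "\<And>(A :: real^'n \<Rightarrow> real) E S (G :: real^'n \<Rightarrow> real). integrable lborel A \<Longrightarrow> (\<And>x. real R \<le> norm x \<Longrightarrow> A x = 0) \<Longrightarrow>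
      (\<And>i. integrable lborel (E i)) \<Longrightarrow> (\<And>i. integrable lborel (\<lambda>x. \<bar>E i x\<bar> powr p)) \<Longrightarrow>
      (\<And>i l. integrable lborel (S i l)) \<Longrightarrow> (\<And>i l. integrable lborel (\<lambda>x. \<bar>S i l x\<bar> powr p)) \<Longrightarrow>
      (\<And>i \<phi>. test \<phi> \<Longrightarrow> (LBINT x. A x * partial i \<phi> x) =
         (\<Sum>l\<in>UNIV. LBINT x. S i l x * partial l \<phi> x) - (LBINT x. E i x * \<phi> x)) \<Longrightarrow>
      test G \<Longrightarrow> (\<And>x. real R \<le> norm x \<Longrightarrow> G x = 0) \<Longrightarrow>
      \<bar>LBINT x. A x * G x\<bar> \<le> C * ((\<Sum>i\<in>UNIV. LBINT x. \<bar>E i x\<bar> powr p)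
        + (\<Sum>i\<in>UNIV. \<Sum>l\<in>UNIV. LBINT x. \<bar>S i l x\<bar> powr p) + (LBINT x. \<bar>G x\<bar> powr q))"
proof -
  have q: "1 < q" using p by (simp add: q_def conjugate_exponent_def)
  show thesis
  proof (rule discrete_riesz_bound[OF p, where 'n = 'n, folded q_def], goal_cases)
  case (1 C0)
  note C0 = 1(1) and riesz = 1(2)
  let ?n = "real CARD('n)"
  have n: "1 \<le> ?n" by (simp add: Suc_leI)
  define C where "C = C0 * (real R + 1 + ?n * (2 * 2 powr q))"
  have C: "0 \<le> C" using C0 by (simp add: C_def)
  show thesis
  proof (rule that[OF C])
    fix A G :: "real^'n \<Rightarrow> real" and E S
    assume A: "integrable lborel A" "\<And>x. real R \<le> norm x \<Longrightarrow> A x = 0"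
      and E: "\<And>i. integrable lborel (E i)" "\<And>i. integrable lborel (\<lambda>x. \<bar>E i x\<bar> powr p)"
      and S: "\<And>i l. integrable lborel (S i l)" "\<And>i l. integrable lborel (\<lambda>x. \<bar>S i l x\<bar> powr p)"
      and weak: "\<And>i \<phi>. test \<phi> \<Longrightarrow> (LBINT x. A x * partial i \<phi> x) =
         (\<Sum>l\<in>UNIV. LBINT x. S i l x * partial l \<phi> x) - (LBINT x. E i x * \<phi> x)"
      and G: "test G" "\<And>x. real R \<le> norm x \<Longrightarrow> G x = 0"
    define e where "e = (SOME i :: 'n. True)"
    obtain b where Gb: "smooth_bounded b G" using test_smooth_bounded[OF G(1)] .
    have b: "\<And>x. \<bar>G x\<bar> \<le> b" using Gb by (simp add: smooth_bounded_def)
    have b0: "0 \<le> b" using b[of 0] by linarith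
    define g where "g = (\<lambda>x. G (x + (2 * real R) *\<^sub>R axis e 1) - G x)"
    have gb: "smooth_bounded (2 * b) g"
      unfolding g_def using smooth_bounded_diff[OF smooth_bounded_translate[OF Gb] Gb] by simp
    have gt: "test g" using gb by (simp add: smooth_bounded_def)
    note [measurable] = test_measurable[OF G(1)] test_measurable[OF gt]
    define Ge where "Ge = (LBINT x. \<bar>G x\<bar> powr q)"
    define Ee where "Ee = (\<lambda>i. LBINT x. \<bar>E i x\<bar> powr p)"
    define Se where "Se = (\<lambda>i l. LBINT x. \<bar>S i l x\<bar> powr p)"
    have nn: "0 \<le> Ge" "0 \<le> Ee i" "0 \<le> Se i l" for i l
      by (auto simp: Ge_def Ee_def Se_def)
    have Gq: "integrable lborel (\<lambda>x. \<bar>G x\<bar> powr q)"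
      and gq: "integrable lborel (\<lambda>x. \<bar>g x\<bar> powr q)"
      using test_powr_integrable[OF G(1)] test_powr_integrable[OF gt] q by auto
    have Gq': "integrable lborel (\<lambda>x. \<bar>G (x + a)\<bar> powr q)"
      "(LBINT x. \<bar>G (x + a)\<bar> powr q) = Ge" for a
      using integrable_lborel_translate[OF Gq, of a] integral_lborel_translate[of "\<lambda>x. \<bar>G x\<bar> powr q" a]
      by (simp_all add: Ge_def)
    have ge: "(LBINT x. \<bar>g x\<bar> powr q) \<le> 2 * 2 powr q * Ge"
    proof -
      have "(LBINT x. \<bar>g x\<bar> powr q) \<le> (LBINT x. 2 powr q * (\<bar>G (x + (2 * real R) *\<^sub>R axis e 1)\<bar> powr q + \<bar>G x\<bar> powr q))"
        using gq Gq Gq' q by (intro integral_mono) (auto simp: g_def intro!: powr_diff_le)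
      also have "\<dots> = 2 * 2 powr q * Ge" using Gq Gq' by (simp add: Ge_def)
      finally show ?thesis .
    qed
    \<comment> \<open>Where norm x < R, the point shifted by 2 R has norm at least R and only the
      term - G remains in \<open>g\<close>; elsewhere \<open>A\<close> vanishes.\<close>
    have Ag: "(LBINT x. A x * g x) = - (LBINT x. A x * G x)"
    proof -
      have "A x * g x = - (A x * G x)" for x
      proof (cases "norm x < R")
        case True
        have "norm ((2 * real R) *\<^sub>R axis e (1::real)) \<le> norm (x + (2 * real R) *\<^sub>R axis e 1) + norm x"
          using norm_triangle_ineq4[of "x + (2 * real R) *\<^sub>R axis e 1" x] by simp
        then have "real R \<le> norm (x + (2 * real R) *\<^sub>R axis e 1)" using True by (simp add: norm_axis_1)
        then show ?thesis by (simp add: g_def G(2))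
      qed (use A(2) in simp)
      then show ?thesis by simp
    qed
    define L where "L = (LBINT x. \<bar>A x\<bar>)"
    define LE where "LE = (\<lambda>i. LBINT x. \<bar>E i x\<bar>)"
    define LS where "LS = (\<lambda>i l. LBINT x. \<bar>S i l x\<bar>)"
    \<comment> \<open>\<open>Y\<close> is what survives in the limit and involves only the p-th and
      q-th power integrals. \<open>Z\<close> gathers the discretisation errors and the final value
      of the flow, all of which carry a factor 1/m and the smoothness bound
      \<open>b\<close>.\<close>
    define Y where "Y = 2 / ?n * (\<Sum>i\<in>UNIV. R * (C0 * (Ee i + Ge)) / 2 + (\<Sum>l\<in>UNIV. C0 * (Se i l + 2 * 2 powr q * Ge) / 4))"
    define Z where "Z = 2 / ?n * (\<Sum>i\<in>UNIV. R * (10 * b * LE i) + (\<Sum>l\<in>UNIV. 8 * b * LS i l)) + 14 * b * L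
       + R * (2 * b * sqrt ?n) * L"
    have main: "\<bar>LBINT x. A x * G x\<bar> \<le> Y + Z * (1 / m)" if m: "0 < m" for m :: nat
    proof -
      \<comment> \<open>With \<open>R * m ^ 4\<close> central differences of length 2 h the shift 2
        R is met exactly. The elapsed time K h^2 is m^2, the accumulated Taylor error K h^3 is
        1/m^2, and the decay estimate has size R m^4 over the square root of \<open>K\<close>, that
        is R / m; the last requirement fixes the exponent 10.\<close>
      define h where "h = 1 / real m ^ 4"
      define K where "K = m ^ 10"
      have h: "0 < h" using m by (simp add: h_def)
      have hR: "2 * h * real (R * m ^ 4) = 2 * real R" using m by (simp add: h_def)
      have Kh: "K * h ^ 3 \<le> 1 / m"
      proof -
        have "real m ^ 11 \<le> real m ^ 12" using m by (intro power_increasing) auto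
        then show ?thesis using m by (simp add: K_def h_def field_simps eval_nat_numeral)
      qed
      have RKh: "real (R * m ^ 4) * h = R" using m by (simp add: h_def)
      define \<phi> where "\<phi> = (\<lambda>k. (rw h ^^ (4 * k)) g)"
      have \<phi>b: "smooth_bounded (2 * b) (\<phi> k)" for k unfolding \<phi>_def by (rule smooth_bounded_rw_pow[OF gb])
      have \<phi>t: "test (\<phi> k)" for k using \<phi>b[of k] by (simp add: smooth_bounded_def)
      have \<phi>S: "\<phi> (Suc k) = (rw h ^^ 4) (\<phi> k)" for k
        by (simp add: \<phi>_def funpow_add add.commute)
      let ?I = "\<lambda>u. LBINT x. A x * u x"
      have tele: "?I g = ?I (\<phi> K) + (\<Sum>k<K. ?I (\<phi> k) - ?I (\<phi> (Suc k)))"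
        by (subst sum_lessThan_telescope') (simp add: \<phi>_def)
      have lap_t: "test (laplacian (\<phi> k))" for k
        unfolding laplacian_def[abs_def] by (intro test_sum test_partial \<phi>t)
      have step: "\<bar>(?I (\<phi> k) - ?I (\<phi> (Suc k))) - - 2 / ?n * (h\<^sup>2 * ?I (laplacian (\<phi> k)))\<bar> \<le> 14 * b * h ^ 3 * L" for k
      proof -
        have "\<bar>?I (\<lambda>x. \<phi> k x - \<phi> (Suc k) x) - ?I (\<lambda>x. (- 2 / ?n * h\<^sup>2) * laplacian (\<phi> k) x)\<bar> \<le> 14 * b * h ^ 3 * L"
          unfolding L_def
        proof (rule integral_test_approx[OF A(1)])
          show "\<bar>\<phi> k x - \<phi> (Suc k) x - (- 2 / ?n * h\<^sup>2) * laplacian (\<phi> k) x\<bar> \<le> 14 * b * h ^ 3" for x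
            using rw_pow4_laplacian_approx[OF \<phi>b[of k], of h x] h by (simp add: \<phi>S)
        qed (intro test_diff test_cmult \<phi>t lap_t)+
        moreover have "?I (\<lambda>x. \<phi> k x - \<phi> (Suc k) x) = ?I (\<phi> k) - ?I (\<phi> (Suc k))"
          using integrable_mult_test[OF A(1) \<phi>t] by (simp add: right_diff_distrib)
        moreover have "?I (\<lambda>x. (- 2 / ?n * h\<^sup>2) * laplacian (\<phi> k) x) = - 2 / ?n * (h\<^sup>2 * ?I (laplacian (\<phi> k)))"
          by (simp add: mult.left_commute[of "A _"])
        ultimately show ?thesis by simp
      qed
      \<comment> \<open>The weak equation is tested with \<open>partial i (\<phi> k)\<close>, which
        trades one derivative on \<open>A\<close> for second derivatives against \<open>S\<close>
        and a first derivative against \<open>E\<close>.\<close>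
      have lap: "?I (laplacian (\<phi> k)) = (\<Sum>i\<in>UNIV. (\<Sum>l\<in>UNIV. LBINT x. S i l x * partial l (partial i (\<phi> k)) x)
           - (LBINT x. E i x * partial i (\<phi> k) x))" for k
      proof -
        have "?I (laplacian (\<phi> k)) = (\<Sum>i\<in>UNIV. ?I (partial i (partial i (\<phi> k))))"
          using integrable_mult_test[OF A(1) test_partial[OF test_partial[OF \<phi>t]]]
          by (simp add: laplacian_def sum_distrib_left)
        then show ?thesis by (simp add: weak test_partial \<phi>t)
      qed
      have sum_lap: "\<bar>\<Sum>k<K. h\<^sup>2 * ?I (laplacian (\<phi> k))\<bar> \<le> (\<Sum>i\<in>UNIV.
         (R * (C0 * (Ee i + Ge)) / 2 + (\<Sum>l\<in>UNIV. C0 * (Se i l + 2 * 2 powr q * Ge) / 4))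
         + (R * (10 * b * LE i) + (\<Sum>l\<in>UNIV. 8 * b * LS i l)) * (1 / m))"
      proof -
        have s: "\<bar>\<Sum>k<K. h\<^sup>2 * (LBINT x. S i l x * partial l (partial i (\<phi> k)) x)\<bar>
            \<le> C0 * (Se i l + 2 * 2 powr q * Ge) / 4 + (8 * b * LS i l) * (1 / m)" for i l
        proof -
          have gbd: "\<bar>g x\<bar> \<le> 2 * b" for x using gb by (simp add: smooth_bounded_def)
          have "\<bar>\<Sum>k<K. LBINT x. S i l x * (rw h ^^ (4 * k + 2)) (cdiff h i (cdiff h l g)) x\<bar>
             \<le> C0 * (Se i l + 2 * 2 powr q * Ge)"
          proof -
            have "C0 * (Se i l + (LBINT x. \<bar>g x\<bar> powr q)) \<le> C0 * (Se i l + 2 * 2 powr q * Ge)"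
              using ge C0 by (intro mult_left_mono add_left_mono) auto
            then show ?thesis
              using riesz[OF S(1)[of i l] S(2)[of i l] test_measurable[OF gt] gbd gq, where K = K and h = h and i = i and j = l]
              unfolding Se_def by linarith
          qed
          from second_order_sum_bound[OF this S(1) gb h]
          have "\<bar>\<Sum>k<K. h\<^sup>2 * (LBINT x. S i l x * partial l (partial i (\<phi> k)) x)\<bar>
            \<le> C0 * (Se i l + 2 * 2 powr q * Ge) / 4 + (8 * b * LS i l) * (K * h ^ 3)"
            by (simp add: \<phi>_def LS_def mult_ac)
          also have "(8 * b * LS i l) * (K * h ^ 3) \<le> (8 * b * LS i l) * (1 / m)"
            using b0 by (intro mult_left_mono Kh) (auto simp: LS_def)
          finally show ?thesis by simp
        qed
        \<comment> \<open>The number of central differences times h is R (fact \<open>RKh\<close>),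
          so the factor h / 2 in the first-order bound cancels their number.\<close>
        have ee: "\<bar>\<Sum>k<K. h\<^sup>2 * (LBINT x. E i x * partial i (\<phi> k) x)\<bar>
            \<le> R * (C0 * (Ee i + Ge)) / 2 + (R * (10 * b * LE i)) * (1 / m)" for i
        proof -
          have "\<bar>\<Sum>k<K. LBINT x. E i x * (rw h ^^ (4 * k + 2)) (cdiff h i (cdiff h e (\<lambda>x. G (x + y)))) x\<bar>
             \<le> C0 * (Ee i + Ge)" for y
            using riesz[OF E(1)[of i] E(2)[of i], of "\<lambda>x. G (x + y)" b, where K = K and h = h and i = i and j = e] Gq'[of y] b by (simp add: Ee_def)
          from first_order_sum_bound[OF this E(1) Gb h, of "R * m ^ 4"]
          have "\<bar>\<Sum>k<K. h\<^sup>2 * (LBINT x. E i x * partial i (\<phi> k) x)\<bar>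
            \<le> real (R * m ^ 4) * (h / 2 * (C0 * (Ee i + Ge)) + real K * (10 * b * h ^ 4 * LE i))"
            unfolding hR \<phi>_def g_def LE_def .
          also have "\<dots> = (real (R * m ^ 4) * h) * (C0 * (Ee i + Ge)) / 2
             + (real (R * m ^ 4) * h) * (10 * b * LE i) * (K * h ^ 3)"
            by (simp add: algebra_simps eval_nat_numeral)
          also have "\<dots> \<le> R * (C0 * (Ee i + Ge)) / 2 + (R * (10 * b * LE i)) * (1 / m)"
            unfolding RKh using b0 h by (intro add_mono order_refl mult_mono Kh) (auto simp: LE_def)
          finally show ?thesis .
        qed
        have eq: "(\<Sum>k<K. h\<^sup>2 * ?I (laplacian (\<phi> k))) = (\<Sum>i\<in>UNIV.
           (\<Sum>l\<in>UNIV. \<Sum>k<K. h\<^sup>2 * (LBINT x. S i l x * partial l (partial i (\<phi> k)) x))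
            - (\<Sum>k<K. h\<^sup>2 * (LBINT x. E i x * partial i (\<phi> k) x)))"
          unfolding lap
          by (simp add: sum_distrib_left right_diff_distrib sum_subtractf sum.swap[of _ "{..<K}"])
        show ?thesis
          unfolding eq
        proof (rule order_trans[OF sum_abs sum_mono])
          fix i
          have "\<bar>\<Sum>l\<in>UNIV. \<Sum>k<K. h\<^sup>2 * (LBINT x. S i l x * partial l (partial i (\<phi> k)) x)\<bar>
            \<le> (\<Sum>l\<in>UNIV. C0 * (Se i l + 2 * 2 powr q * Ge) / 4 + (8 * b * LS i l) * (1 / m))"
            by (rule order_trans[OF sum_abs sum_mono[OF s]])
          also have "\<dots> = (\<Sum>l\<in>UNIV. C0 * (Se i l + 2 * 2 powr q * Ge) / 4) + (\<Sum>l\<in>UNIV. 8 * b * LS i l) * (1 / m)"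
            by (simp only: sum.distrib sum_distrib_right)
          finally show "\<bar>(\<Sum>l\<in>UNIV. \<Sum>k<K. h\<^sup>2 * (LBINT x. S i l x * partial l (partial i (\<phi> k)) x))
            - (\<Sum>k<K. h\<^sup>2 * (LBINT x. E i x * partial i (\<phi> k) x))\<bar>
            \<le> (R * (C0 * (Ee i + Ge)) / 2 + (\<Sum>l\<in>UNIV. C0 * (Se i l + 2 * 2 powr q * Ge) / 4))
             + (R * (10 * b * LE i) + (\<Sum>l\<in>UNIV. 8 * b * LS i l)) * (1 / m)"
            using ee[of i] unfolding distrib_right by linarith
        qed
      qed
      have last: "\<bar>?I (\<phi> K)\<bar> \<le> R * (2 * b * sqrt ?n) * L * (1 / m)"
      proof -
        have "\<bar>\<phi> K x\<bar> \<le> R * (2 * b * sqrt ?n) * (1 / m)" for x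
        proof -
          have K: "0 < 4 * K" using m by (simp add: K_def)
          have "\<bar>\<phi> K x\<bar> \<le> real (R * m ^ 4) * (2 * b * sqrt (?n / real (4 * K)))"
            using rw_translate_decay[OF b K, where h = h and N = "R * m ^ 4" and j = e and x = x] unfolding hR \<phi>_def g_def .
          also have "sqrt (?n / real (4 * K)) \<le> sqrt ?n / m ^ 5"
          proof -
            have "sqrt (real (4 * K)) \<ge> m ^ 5"
              by (rule real_le_rsqrt) (simp add: K_def flip: power_mult)
            then show ?thesis using m K by (simp only: real_sqrt_divide) (intro divide_left_mono, auto)
          qed
          finally have "\<bar>\<phi> K x\<bar> \<le> real (R * m ^ 4) * (2 * b * (sqrt ?n / m ^ 5))"
            using b0 by (simp add: mult_left_mono)
          also have "\<dots> = R * (2 * b * sqrt ?n) * (1 / m)"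
            using m by (simp add: divide_simps eval_nat_numeral)
          finally show ?thesis .
        qed
        from integral_mult_bounded_le[OF A(1) test_measurable[OF \<phi>t] this]
        show ?thesis by (simp add: L_def mult_ac)
      qed
      have "\<bar>\<Sum>k<K. ?I (\<phi> k) - ?I (\<phi> (Suc k))\<bar> \<le> 2 / ?n * \<bar>\<Sum>k<K. h\<^sup>2 * ?I (laplacian (\<phi> k))\<bar> + 14 * b * L * (1 / m)"
      proof -
        have "(\<Sum>k<K. ?I (\<phi> k) - ?I (\<phi> (Suc k))) = (\<Sum>k<K. (?I (\<phi> k) - ?I (\<phi> (Suc k))) - - 2 / ?n * (h\<^sup>2 * ?I (laplacian (\<phi> k))))
           - 2 / ?n * (\<Sum>k<K. h\<^sup>2 * ?I (laplacian (\<phi> k)))"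
          by (simp add: sum.distrib sum_distrib_left sum_negf sum_subtractf)
        moreover have "\<bar>\<Sum>k<K. (?I (\<phi> k) - ?I (\<phi> (Suc k))) - - 2 / ?n * (h\<^sup>2 * ?I (laplacian (\<phi> k)))\<bar> \<le> (\<Sum>k<K. 14 * b * h ^ 3 * L)"
          by (rule order_trans[OF sum_abs sum_mono[OF step]])
        moreover have "(\<Sum>k<K. 14 * b * h ^ 3 * L) = 14 * b * L * (K * h ^ 3)" by simp
        moreover have "14 * b * L * (K * h ^ 3) \<le> 14 * b * L * (1 / m)"
          using b0 by (intro mult_left_mono Kh) (auto simp: L_def)
        moreover have "\<bar>2 / ?n * (\<Sum>k<K. h\<^sup>2 * ?I (laplacian (\<phi> k)))\<bar> = 2 / ?n * \<bar>\<Sum>k<K. h\<^sup>2 * ?I (laplacian (\<phi> k))\<bar>"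
          by (simp add: abs_mult)
        ultimately show ?thesis by linarith
      qed
      moreover have "2 / ?n * \<bar>\<Sum>k<K. h\<^sup>2 * ?I (laplacian (\<phi> k))\<bar> \<le> Y +
          2 / ?n * (\<Sum>i\<in>UNIV. R * (10 * b * LE i) + (\<Sum>l\<in>UNIV. 8 * b * LS i l)) * (1 / m)"
        using mult_left_mono[OF sum_lap, of "2 / ?n"]
        unfolding Y_def sum.distrib[of _ "\<lambda>i. _ i * (1 / real m)"] sum_distrib_right[symmetric] distrib_left mult.assoc by simp
      ultimately show ?thesis
        using tele last Ag unfolding Z_def distrib_right by linarith
    qed
    have "((\<lambda>m. Y + Z * (1 / real m)) \<longlongrightarrow> Y + Z * 0) sequentially"
      by (intro tendsto_intros lim_1_over_n)
    then have "\<bar>LBINT x. A x * G x\<bar> \<le> Y"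
    proof (intro tendsto_lowerbound[of _ Y])
      show "\<forall>\<^sub>F m in sequentially. \<bar>LBINT x. A x * G x\<bar> \<le> Y + Z * (1 / real m)"
        using eventually_gt_at_top[of 0] by (rule eventually_mono) (rule main)
    qed auto
    also have "Y = (real R * C0 / ?n) * (\<Sum>i\<in>UNIV. Ee i) + (C0 / (2 * ?n)) * (\<Sum>i\<in>UNIV. \<Sum>l\<in>UNIV. Se i l)
        + (real R * C0 + C0 / 2 * ?n * (2 * 2 powr q)) * Ge"
    proof -
      have "(\<Sum>i\<in>UNIV. R * (C0 * (Ee i + Ge)) / 2) = R * C0 / 2 * ((\<Sum>i\<in>UNIV. Ee i) + ?n * Ge)"
        by (simp add: sum.distrib sum_distrib_left distrib_left sum_divide_distrib add_divide_distrib mult_ac)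
      moreover have "(\<Sum>i\<in>UNIV. \<Sum>l\<in>UNIV. C0 * (Se i l + 2 * 2 powr q * Ge) / 4)
          = C0 / 4 * ((\<Sum>i\<in>UNIV. \<Sum>l\<in>UNIV. Se i l) + ?n * ?n * (2 * 2 powr q) * Ge)"
        by (simp add: sum.distrib sum_distrib_left distrib_left sum_divide_distrib add_divide_distrib mult_ac)
      ultimately show ?thesis
        using n unfolding Y_def sum.distrib by (simp add: field_simps)
    qed
    also have "\<dots> \<le> C * (\<Sum>i\<in>UNIV. Ee i) + C * (\<Sum>i\<in>UNIV. \<Sum>l\<in>UNIV. Se i l) + C * Ge"
    proof -
      have P: "0 \<le> C0 * (?n * (2 * 2 powr q))" "0 \<le> C0 * real R" using C0 by auto
      have "real R * C0 / ?n \<le> real R * C0 / 1" using n C0 by (intro divide_left_mono) auto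
      moreover have "C0 * real R \<le> C" using P C0 unfolding C_def distrib_left by linarith
      ultimately have 1: "real R * C0 / ?n \<le> C" by (simp add: mult.commute)
      have "1 \<le> 2 * ?n" using n by linarith
      then have "C0 / (2 * ?n) \<le> C0 / 1" using C0 by (intro divide_left_mono) linarith+
      moreover have "C0 \<le> C" using P C0 unfolding C_def distrib_left by linarith
      ultimately have 2: "C0 / (2 * ?n) \<le> C" by simp
      have "C0 / 2 * ?n * (2 * 2 powr q) \<le> C0 * (?n * (2 * 2 powr q))" using C0 by simp
      then have 3: "real R * C0 + C0 / 2 * ?n * (2 * 2 powr q) \<le> C"
        using C0 unfolding C_def distrib_left by (simp add: mult.commute[of "real R"])
      show ?thesis by (intro add_mono mult_right_mono 1 2 3 sum_nonneg nn)
    qed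
    finally show "\<bar>LBINT x. A x * G x\<bar> \<le> C * ((\<Sum>i\<in>UNIV. LBINT x. \<bar>E i x\<bar> powr p)
        + (\<Sum>i\<in>UNIV. \<Sum>l\<in>UNIV. LBINT x. \<bar>S i l x\<bar> powr p) + (LBINT x. \<bar>G x\<bar> powr q))"
      by (simp add: Ee_def Se_def Ge_def distrib_left)
  qed
  qed
qed

section \<open>Density of test functions and duality\<close>

text \<open>Powers of 1/t are what differentiating exp(-1/t) produces. Indexing the whole family by
  m makes it closed under differentiation up to linear combinations, so that smoothness follows by
  induction.\<close>

definition flat_exp :: "nat \<Rightarrow> real \<Rightarrow> real" where
  "flat_exp m t = (if 0 < t then (1 / t) ^ m * exp (- (1 / t)) else 0)"

lemma flat_exp_at_right: "(flat_exp m \<longlongrightarrow> 0) (at_right 0)"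
proof -
  have "((\<lambda>t::real. (inverse t) ^ m / exp (inverse t)) \<longlongrightarrow> 0) (at_right 0)"
    using filterlim_compose[OF tendsto_power_div_exp_0 filterlim_inverse_at_top_right] .
  moreover have "eventually (\<lambda>t. inverse t ^ m / exp (inverse t) = flat_exp m t) (at_right 0)"
    using eventually_at_right_less[of "0::real"]
    by (rule eventually_mono) (simp add: flat_exp_def exp_minus inverse_eq_divide power_one_over)
  ultimately show ?thesis by (rule Lim_transform_eventually)
qed

lemma flat_exp_has_derivative:
  "(flat_exp m has_real_derivative (flat_exp (m + 2) t - m * flat_exp (m + 1) t)) (at t)"
proof -
  consider "0 < t" | "t < 0" | "t = 0" by linarith
  then show ?thesis
  proof cases
    case 1
    define g where "g = (\<lambda>t :: real. 1 / t)"
    have dg: "(g has_real_derivative - (g t)\<^sup>2) (at t)"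
      unfolding g_def using 1 by (auto intro!: derivative_eq_intros simp: power2_eq_square)
    have "((\<lambda>t. g t ^ m * exp (- g t)) has_real_derivative (flat_exp (m + 2) t - m * flat_exp (m + 1) t)) (at t)"
    proof (rule DERIV_cong)
      show "((\<lambda>t. g t ^ m * exp (- g t)) has_real_derivative
         (real m * (- (g t)\<^sup>2 * g t ^ (m - Suc 0)) * exp (- g t) + exp (- g t) * (- (- (g t)\<^sup>2)) * g t ^ m)) (at t)"
        by (intro DERIV_mult DERIV_power DERIV_fun_exp DERIV_minus dg)
      show "real m * (- (g t)\<^sup>2 * g t ^ (m - Suc 0)) * exp (- g t) + exp (- g t) * (- (- (g t)\<^sup>2)) * g t ^ m
         = flat_exp (m + 2) t - m * flat_exp (m + 1) t"
        using 1 unfolding flat_exp_def g_def[symmetric]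
        by (cases m) (simp_all add: g_def[symmetric] algebra_simps power2_eq_square)
    qed
    then have "((\<lambda>t. (1 / t) ^ m * exp (- (1 / t))) has_real_derivative (flat_exp (m + 2) t - m * flat_exp (m + 1) t)) (at t)"
      by (simp only: g_def)
    then show ?thesis
      by (rule has_field_derivative_transform_within_open[of _ _ _ "{0<..}"]) (use 1 in \<open>auto simp: flat_exp_def\<close>)
  next
    case 2
    have "((\<lambda>t. 0) has_real_derivative 0) (at t)" by simp
    then have "(flat_exp m has_real_derivative 0) (at t)"
      by (rule has_field_derivative_transform_within_open[of _ _ _ "{..<0}"]) (use 2 in \<open>auto simp: flat_exp_def\<close>)
    then show ?thesis using 2 by (simp add: flat_exp_def)
  next
    case 3
    \<comment> \<open>For h > 0 the difference quotient at 0 is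
      \<open>flat_exp (m + 1) h\<close>.\<close>
    have "((\<lambda>h. (flat_exp m h - flat_exp m 0) / h) \<longlongrightarrow> 0) (at_right 0)"
      using flat_exp_at_right[of "m + 1"]
      by (rule Lim_transform_eventually)
        (auto simp: eventually_at_right_less flat_exp_def intro!: eventually_mono[OF eventually_at_right_less[of "0::real"]])
    moreover have "((\<lambda>h. (flat_exp m h - flat_exp m 0) / h) \<longlongrightarrow> 0) (at_left 0)"
    proof (rule Lim_transform_eventually[OF tendsto_const])
      show "eventually (\<lambda>h. 0 = (flat_exp m h - flat_exp m 0) / h) (at_left 0)"
        by (auto simp: flat_exp_def eventually_at_left_real intro!: eventually_at_leftI[of "-1"])
    qed
    ultimately have "((\<lambda>h. (flat_exp m h - flat_exp m 0) / h) \<longlongrightarrow> 0) (at 0)"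
      by (simp add: filterlim_at_split)
    then show ?thesis unfolding 3 DERIV_def by (simp add: flat_exp_def)
  qed
qed

lemma Ck_bounded_linear:
  fixes f :: "real^'n \<Rightarrow> real"
  assumes "bounded_linear f"
  shows "Ck k f"
proof (cases k)
  case 0
  then show ?thesis using assms by (simp add: linear_continuous_on)
next
  case (Suc k)
  have d: "(f has_derivative f) (at x)" for x by (rule bounded_linear_imp_has_derivative[OF assms])
  then have "partial i f = (\<lambda>x. f (axis i 1))" for i by (auto intro: partial_eq)
  then show ?thesis unfolding Suc using d by (auto simp: differentiable_def intro: Ck_const)
qed

lemma Ck_real_polynomial_function:
  fixes f :: "real^'n \<Rightarrow> real"
  shows "real_polynomial_function f \<Longrightarrow> Ck k f"
  by (induction rule: real_polynomial_function.induct) (auto intro: Ck_bounded_linear Ck_const Ck_add Ck_mult)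

definition bump :: "real \<Rightarrow> nat \<Rightarrow> real^'n \<Rightarrow> real" where
  "bump R m x = flat_exp m (R\<^sup>2 - x \<bullet> x)"

text \<open>A partial derivative of a bump is a coordinate times bumps of index m + 1 and m + 2, so
  the induction on k runs over all m at once.\<close>

lemma bump_Ck: "Ck k (bump R m :: real^'n \<Rightarrow> real)"
proof (induction k arbitrary: m)
  have d: "(bump R m has_derivative (\<lambda>h. (- 2 * (x \<bullet> h)) * (bump R (m + 2) x - m * bump R (m + 1) x))) (at x)"
    for m and x :: "real^'n"
  proof -
    have "((\<lambda>x. R\<^sup>2 - x \<bullet> x) has_derivative (\<lambda>h. - 2 * (x \<bullet> h))) (at x)"
      by (auto intro!: derivative_eq_intros simp: inner_commute)
    from has_derivative_compose[OF this flat_exp_has_derivative[of m "R\<^sup>2 - x \<bullet> x", unfolded has_field_derivative_def]]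
    show ?thesis by (simp add: bump_def[abs_def] mult.commute)
  qed
  case 0
  show ?case
    using d by (auto simp: continuous_on_eq_continuous_at intro!: has_derivative_continuous)
  case (Suc k)
  have "partial i (bump R m) = (\<lambda>x. (- 2 * (x $ i)) * (bump R (m + 2) x - m * bump R (m + 1) x))" for i :: 'n
    using partial_eq[OF d] by (auto simp: inner_axis)
  moreover have "Ck k (\<lambda>x. (- 2 * (x $ i)) * (bump R (m + 2) x - m * bump R (m + 1) x))" for i :: 'n
    by (intro Ck_mult Ck_diff Suc.IH Ck_const Ck_bounded_linear bounded_linear_vec_nth)
  moreover have "bump R m differentiable (at x)" for x :: "real^'n"
    using d unfolding differentiable_def by blast
  ultimately show ?case by auto
qed

lemma flat_exp_0_bounds: "0 \<le> flat_exp 0 t" "flat_exp 0 t \<le> 1"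
  by (auto simp: flat_exp_def)

lemma flat_exp_0_mono: "s \<le> t \<Longrightarrow> flat_exp 0 s \<le> flat_exp 0 t"
  by (auto simp: flat_exp_def frac_le)

text \<open>Instead of mollifying, f is divided by a smooth cutoff \<psi>, the quotient is
  approximated by a polynomial on the ball, and \<psi> is multiplied back. The support is then right
  and, as \<psi> \<le> 1, the error does not grow. Taking the maximum with \<open>d\<close> keeps
  the quotient continuous, and changes it only where f = 0.\<close>

lemma continuous_approx_test:
  fixes f :: "real^'n \<Rightarrow> real"
  assumes f: "continuous_on UNIV f" and \<rho>: "0 < \<rho>" "\<rho> < R" and supp: "\<And>x. \<rho> < norm x \<Longrightarrow> f x = 0" and e: "0 < e"
  obtains G where "test G" "\<And>x. R \<le> norm x \<Longrightarrow> G x = 0" "\<And>x. \<bar>G x - f x\<bar> \<le> e"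
proof -
  define \<psi> :: "real^'n \<Rightarrow> real" where "\<psi> = bump R 0"
  have \<psi>C: "Ck k \<psi>" for k unfolding \<psi>_def by (rule bump_Ck)
  have \<psi>: "0 \<le> \<psi> x" "\<psi> x \<le> 1" for x by (auto simp: \<psi>_def bump_def flat_exp_0_bounds)
  have \<psi>0: "\<psi> x = 0" if "R \<le> norm x" for x
    using power_mono[OF that, of 2] \<rho> by (simp add: \<psi>_def bump_def flat_exp_def power2_norm_eq_inner)
  define d where "d = flat_exp 0 (R\<^sup>2 - \<rho>\<^sup>2)"
  have d: "0 < d" using \<rho> by (simp add: d_def flat_exp_def power_strict_mono)
  have \<psi>d: "d \<le> \<psi> x" if "norm x \<le> \<rho>" for x
    using power_mono[OF that, of 2] by (simp add: d_def \<psi>_def bump_def power2_norm_eq_inner flat_exp_0_mono)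
  define H where "H = (\<lambda>x. f x / max (\<psi> x) d)"
  have "continuous_on (cball 0 R) H"
    unfolding H_def using f \<psi>C[of 0] d
    by (intro continuous_intros continuous_on_max) (auto intro: continuous_on_subset)
  then obtain g where g: "real_polynomial_function g" "\<And>x. x \<in> cball 0 R \<Longrightarrow> \<bar>H x - g x\<bar> < e"
    using Stone_Weierstrass_real_polynomial_function[of "cball 0 R" H e] e by auto
  have H: "\<psi> x * H x = f x" for x
  proof (cases "norm x \<le> \<rho>")
    case True
    then show ?thesis using \<psi>d[OF True] d by (simp add: H_def)
  qed (use supp in \<open>simp add: H_def\<close>)
  show thesis
  proof (rule that[of "\<lambda>x. \<psi> x * g x"])
    show "test (\<lambda>x. \<psi> x * g x)"
    proof (rule testI)
      show "Ck k (\<lambda>x. \<psi> x * g x)" for k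
        by (intro Ck_mult \<psi>C Ck_real_polynomial_function g)
      show "bounded (cball (0 :: real^'n) R)" by simp
    qed (use \<psi>0 in auto)
    show "\<bar>\<psi> x * g x - f x\<bar> \<le> e" for x
    proof (cases "R \<le> norm x")
      case True
      then show ?thesis using e \<rho> by (simp add: \<psi>0 supp)
    next
      case False
      then have *: "\<bar>g x - H x\<bar> \<le> e" using g(2)[of x] by (simp add: abs_minus_commute less_imp_le)
      have "\<psi> x * g x - f x = \<psi> x * (g x - H x)" by (simp add: right_diff_distrib H)
      also have "\<bar>\<dots>\<bar> \<le> 1 * e" unfolding abs_mult using \<psi>[of x] * by (intro mult_mono) auto
      finally show ?thesis by simp
    qed
  qed (simp add: \<psi>0)
qed

text \<open>Measurability provides continuous functions converging off a null set. Truncation at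
  height \<open>M\<close> and the cutoff \<theta> give them the bound and the support of g without
  spoiling the limit; the smooth approximation then adds at most 1, hence
  \<open>M + 1\<close>.\<close>

lemma bounded_approx_test:
  fixes g :: "real^'n \<Rightarrow> real"
  assumes gm: "g \<in> borel_measurable borel" and b: "\<And>x. \<bar>g x\<bar> \<le> M"
    and r: "0 < r" "r < R" and supp: "\<And>x. r < norm x \<Longrightarrow> g x = 0"
  obtains G where "\<And>m::nat. test (G m)" "\<And>m x. R \<le> norm x \<Longrightarrow> G m x = 0"
    "\<And>m x. \<bar>G m x\<bar> \<le> M + 1" "AE x in lborel. (\<lambda>m. G m x) \<longlonglongrightarrow> g x"
proof -
  have M: "0 \<le> M" using b[of 0] by linarith
  have "g \<in> borel_measurable lebesgue" using gm by (simp add: measurable_completion)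
  then have "g measurable_on UNIV"
    by (intro lebesgue_measurable_imp_measurable_on_real) auto
  then obtain N c where N: "negligible N" and c: "\<And>m. continuous_on UNIV (c m)"
    and lim: "\<And>x. x \<notin> N \<Longrightarrow> (\<lambda>m::nat. c m x) \<longlonglongrightarrow> g x"
    unfolding measurable_on_def by auto
  define \<rho> where "\<rho> = (r + R) / 2"
  have \<rho>: "r < \<rho>" "\<rho> < R" "0 < \<rho>" using r by (auto simp: \<rho>_def)
  define \<theta> where "\<theta> = (\<lambda>x :: real^'n. max 0 (min 1 ((\<rho> - norm x) / (\<rho> - r))))"
  have \<theta>: "0 \<le> \<theta> x" "\<theta> x \<le> 1" "norm x \<le> r \<Longrightarrow> \<theta> x = 1" "\<rho> < norm x \<Longrightarrow> \<theta> x = 0" for x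
    using \<rho> by (auto simp: \<theta>_def min_def max_def field_simps)
  define f where "f = (\<lambda>m x. \<theta> x * max (- M) (min M (c m x)))"
  have fb: "\<bar>f m x\<bar> \<le> M" for m x
  proof -
    have "\<bar>f m x\<bar> \<le> 1 * M"
      unfolding f_def abs_mult using \<theta>[of x] M by (intro mult_mono) (auto simp: min_def max_def)
    then show ?thesis by simp
  qed
  have fc: "continuous_on UNIV (f m)" for m
    unfolding f_def \<theta>_def using c \<rho> by (intro continuous_intros) auto
  have "\<exists>G. test G \<and> (\<forall>x. R \<le> norm x \<longrightarrow> G x = 0) \<and> (\<forall>x. \<bar>G x - f m x\<bar> \<le> 1 / Suc m)" for m
    using continuous_approx_test[OF fc[of m] \<rho>(3,2), of "1 / Suc m"] \<theta>(4) by (auto simp: f_def) metis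
  then obtain G where G: "\<And>m. test (G m)" "\<And>m x. R \<le> norm x \<Longrightarrow> G m x = 0"
    "\<And>m x. \<bar>G m x - f m x\<bar> \<le> 1 / Suc m" by metis
  have "(\<lambda>m. G m x) \<longlonglongrightarrow> g x" if x: "x \<notin> N" for x
  proof -
    have "(\<lambda>m. f m x) \<longlonglongrightarrow> \<theta> x * max (- M) (min M (g x))"
      unfolding f_def by (intro tendsto_intros lim x)
    also have "max (- M) (min M (g x)) = g x" using b[of x] by (auto simp: min_def max_def)
    also have "\<theta> x * g x = g x" using \<theta>(3)[of x] supp[of x] by (cases "norm x \<le> r") auto
    finally have f: "(\<lambda>m. f m x) \<longlonglongrightarrow> g x" .
    have "(\<lambda>m. G m x - f m x) \<longlonglongrightarrow> 0"
      by (rule Lim_null_comparison[OF _ LIMSEQ_inverse_real_of_nat])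
        (use G(3) in \<open>auto simp: inverse_eq_divide\<close>)
    from tendsto_add[OF this f] show ?thesis by simp
  qed
  moreover have "AE x in lebesgue. x \<notin> N"
    using N by (intro AE_not_in) (simp add: negligible_iff_null_sets)
  ultimately have "AE x in lebesgue. (\<lambda>m. G m x) \<longlonglongrightarrow> g x" by (auto elim: eventually_mono)
  then have ae: "AE x in lborel. (\<lambda>m. G m x) \<longlonglongrightarrow> g x" by (simp add: AE_completion_iff)
  have Gb: "\<bar>G m x\<bar> \<le> M + 1" for m x
  proof -
    have "1 / real (Suc m) \<le> 1" by simp
    then show ?thesis using G(3)[of m x] fb[of m x] by linarith
  qed
  show thesis by (rule that[OF G(1,2) Gb ae])
qed

text \<open>Testing with g = \<epsilon> sgn(A) |A|^(p-1) gives \<epsilon> I on the left and C (X +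
  \<epsilon>^q I) on the right, where I is the integral of |A|^p. As q > 1, a small \<epsilon> lets
  half of the left side absorb the last term. Truncating where |A| exceeds N makes g bounded, so
  that it can be approximated by test functions.\<close>

lemma Lp_bound_by_duality:
  fixes A :: "real^'n \<Rightarrow> real"
  assumes p: "1 < p" and A: "integrable lborel A" "integrable lborel (\<lambda>x. \<bar>A x\<bar> powr p)"
    and r: "0 < r" "r < R" and supp: "\<And>x. r < norm x \<Longrightarrow> A x = 0"
    and C: "0 \<le> C"
    and dual: "\<And>G. test G \<Longrightarrow> (\<And>x. R \<le> norm x \<Longrightarrow> G x = 0) \<Longrightarrow>
      \<bar>LBINT x. A x * G x\<bar> \<le> C * (X + (LBINT x. \<bar>G x\<bar> powr conjugate_exponent p))"
  shows "(LBINT x. \<bar>A x\<bar> powr p) \<le> 2 * C * (2 * C + 2) powr (p - 1) * X"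
proof -
  define q where "q = conjugate_exponent p"
  have q: "1 < q" "(p - 1) * q = p" "(p - 1) * (q - 1) = 1"
    using p by (auto simp: q_def conjugate_exponent_def field_simps)
  have [measurable]: "A \<in> borel_measurable borel" using A by auto
  \<comment> \<open>Chosen so that \<open>\<epsilon> powr (q - 1)\<close> is 1 / (2 C + 2), which is
    the absorption condition \<open>\<epsilon>q\<close>; its reciprocal is the factor in the
    conclusion.\<close>
  define \<epsilon> where "\<epsilon> = (1 / (2 * C + 2)) powr (p - 1)"
  have \<epsilon>: "0 < \<epsilon>" using C by (simp add: \<epsilon>_def)
  have \<epsilon>q: "C * \<epsilon> powr q \<le> \<epsilon> / 2"
  proof -
    have "\<epsilon> powr q = \<epsilon> * \<epsilon> powr (q - 1)" using \<epsilon> by (simp add: powr_diff)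
    also have "\<epsilon> powr (q - 1) = 1 / (2 * C + 2)" using C q by (simp add: \<epsilon>_def powr_powr)
    finally have "C * \<epsilon> powr q = \<epsilon> * (C / (2 * C + 2))" by simp
    also have "\<dots> \<le> \<epsilon> * (1 / 2)" using \<epsilon> C by (intro mult_left_mono) (auto simp: field_simps)
    finally show ?thesis by simp
  qed
  define B where "B = cball (0 :: real^'n) R"
  have Bm[measurable]: "B \<in> sets borel" and Bf: "emeasure lborel B < \<infinity>"
    unfolding B_def using emeasure_bounded_finite[of "cball (0 :: real^'n) R"] by auto
  have main: "(LBINT x. (if \<bar>A x\<bar> \<le> real N then \<bar>A x\<bar> powr p else 0)) \<le> 2 * C / \<epsilon> * X" for N :: nat
  proof -
    define I where "I = (LBINT x. (if \<bar>A x\<bar> \<le> real N then \<bar>A x\<bar> powr p else 0))"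
    define g where "g = (\<lambda>x. if \<bar>A x\<bar> \<le> real N then \<epsilon> * (sgn (A x) * \<bar>A x\<bar> powr (p - 1)) else 0)"
    have gm[measurable]: "g \<in> borel_measurable borel" unfolding g_def sgn_if by measurable
    define M where "M = \<epsilon> * real N powr (p - 1)"
    have gb: "\<bar>g x\<bar> \<le> M" for x
    proof -
      have "\<bar>A x\<bar> \<le> real N \<Longrightarrow> \<bar>sgn (A x) * \<bar>A x\<bar> powr (p - 1)\<bar> \<le> 1 * real N powr (p - 1)"
        unfolding abs_mult using p by (intro mult_mono) (auto simp: sgn_if intro!: powr_mono2)
      then show ?thesis using \<epsilon> by (auto simp: g_def M_def abs_mult)
    qed
    have M0: "0 \<le> M" using gb[of 0] by linarith
    have gs: "g x = 0" if "r < norm x" for x using supp[OF that] by (simp add: g_def)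
    obtain G where G: "\<And>m::nat. test (G m)" "\<And>m x. R \<le> norm x \<Longrightarrow> G m x = 0"
      "\<And>m x. \<bar>G m x\<bar> \<le> M + 1" "AE x in lborel. (\<lambda>m. G m x) \<longlonglongrightarrow> g x"
      using bounded_approx_test[OF gm gb r gs] by blast
    have [measurable]: "G m \<in> borel_measurable borel" for m by (rule test_measurable[OF G(1)])
    have 1: "(\<lambda>m. LBINT x. A x * G m x) \<longlonglongrightarrow> (LBINT x. A x * g x)"
    proof (rule integral_dominated_convergence)
      show "integrable lborel (\<lambda>x. (M + 1) * \<bar>A x\<bar>)" using A by auto
      show "AE x in lborel. (\<lambda>m. A x * G m x) \<longlonglongrightarrow> A x * g x"
        using G(4) by (auto intro: tendsto_mult_left elim: eventually_mono)
      show "AE x in lborel. norm (A x * G m x) \<le> (M + 1) * \<bar>A x\<bar>" for m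
        using G(3) by (intro AE_I2) (simp add: abs_mult mult.commute[of "\<bar>A _\<bar>"] mult_right_mono)
    qed measurable
    have 2: "(\<lambda>m. LBINT x. \<bar>G m x\<bar> powr q) \<longlonglongrightarrow> (LBINT x. \<bar>g x\<bar> powr q)"
    proof (rule integral_dominated_convergence)
      show "integrable lborel (\<lambda>x. indicator B x * (M + 1) powr q)"
        using Bf by (intro integrable_mult_left integrable_real_indicator) auto
      show "AE x in lborel. (\<lambda>m. \<bar>G m x\<bar> powr q) \<longlonglongrightarrow> \<bar>g x\<bar> powr q"
        using G(4) q by (auto intro!: tendsto_powr2 tendsto_rabs elim!: eventually_mono)
      show "AE x in lborel. norm (\<bar>G m x\<bar> powr q) \<le> indicator B x * (M + 1) powr q" for m
        using G(2,3) q by (intro AE_I2) (auto simp: indicator_def B_def intro!: powr_mono2)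
    qed measurable
    have Ag: "(LBINT x. A x * g x) = \<epsilon> * I"
    proof -
      have "A x * g x = \<epsilon> * (if \<bar>A x\<bar> \<le> real N then \<bar>A x\<bar> powr p else 0)" for x
      proof -
        have "A x * (sgn (A x) * \<bar>A x\<bar> powr (p - 1)) = \<bar>A x\<bar> powr p"
          using powr_mult_base[of "\<bar>A x\<bar>" "p - 1"] by (simp add: mult.assoc[symmetric] abs_sgn[symmetric])
        then show ?thesis by (simp add: g_def)
      qed
      then show ?thesis by (simp add: I_def)
    qed
    have gq: "(LBINT x. \<bar>g x\<bar> powr q) = \<epsilon> powr q * I"
    proof -
      have "\<bar>g x\<bar> powr q = \<epsilon> powr q * (if \<bar>A x\<bar> \<le> real N then \<bar>A x\<bar> powr p else 0)" for x
        using \<epsilon> q by (cases "A x = 0") (auto simp: g_def abs_mult abs_sgn_eq powr_mult powr_powr)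
      then show ?thesis by (simp add: I_def)
    qed
    have "\<bar>\<epsilon> * I\<bar> \<le> C * (X + \<epsilon> powr q * I)"
    proof (rule LIMSEQ_le)
      show "(\<lambda>m. \<bar>LBINT x. A x * G m x\<bar>) \<longlonglongrightarrow> \<bar>\<epsilon> * I\<bar>" using tendsto_rabs[OF 1] by (simp add: Ag)
      show "(\<lambda>m. C * (X + (LBINT x. \<bar>G m x\<bar> powr q))) \<longlonglongrightarrow> C * (X + \<epsilon> powr q * I)"
        using 2 unfolding gq by (intro tendsto_intros)
      show "\<exists>N. \<forall>m\<ge>N. \<bar>LBINT x. A x * G m x\<bar> \<le> C * (X + (LBINT x. \<bar>G m x\<bar> powr q))"
        using dual[OF G(1) G(2)] by (auto simp: q_def)
    qed
    moreover have "0 \<le> I" unfolding I_def by (auto intro!: Bochner_Integration.integral_nonneg)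
    then have "C * \<epsilon> powr q * I \<le> \<epsilon> / 2 * I" by (rule mult_right_mono[OF \<epsilon>q])
    ultimately have "\<epsilon> / 2 * I \<le> C * X" by (simp add: distrib_left mult.assoc abs_le_iff)
    then show ?thesis using \<epsilon> unfolding I_def[symmetric] by (simp add: field_simps)
  qed
  \<comment> \<open>The bound is uniform in N, so the truncation is removed by dominated
    convergence.\<close>
  have "(\<lambda>N. LBINT x. (if \<bar>A x\<bar> \<le> real N then \<bar>A x\<bar> powr p else 0)) \<longlonglongrightarrow> (LBINT x. \<bar>A x\<bar> powr p)"
  proof (rule integral_dominated_convergence[where w = "\<lambda>x. \<bar>A x\<bar> powr p"])
    show "AE x in lborel. (\<lambda>N. if \<bar>A x\<bar> \<le> real N then \<bar>A x\<bar> powr p else 0) \<longlonglongrightarrow> \<bar>A x\<bar> powr p"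
    proof (rule AE_I2)
      fix x
      have "eventually (\<lambda>N. \<bar>A x\<bar> \<le> real N) sequentially"
        using filterlim_real_sequentially by (auto simp: filterlim_at_top)
      then have "eventually (\<lambda>N. \<bar>A x\<bar> powr p = (if \<bar>A x\<bar> \<le> real N then \<bar>A x\<bar> powr p else 0)) sequentially"
        by (rule eventually_mono) simp
      then show "(\<lambda>N. if \<bar>A x\<bar> \<le> real N then \<bar>A x\<bar> powr p else 0) \<longlonglongrightarrow> \<bar>A x\<bar> powr p"
        by (rule Lim_transform_eventually[OF tendsto_const])
    qed
  qed (use A in auto)
  then have "(LBINT x. \<bar>A x\<bar> powr p) \<le> 2 * C / \<epsilon> * X"
    by (rule LIMSEQ_le_const2) (use main in auto)
  also have "2 * C / \<epsilon> = 2 * C * (2 * C + 2) powr (p - 1)"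
    using C by (simp add: \<epsilon>_def powr_divide)
  finally show ?thesis .
qed

section \<open>The inequality on the whole space\<close>

lemma vec_nth_measurable [measurable]:
  fixes f :: "'m \<Rightarrow> 'b::euclidean_space^'n::finite"
  assumes [measurable]: "f \<in> borel_measurable M"
  shows "(\<lambda>x. f x $ i) \<in> borel_measurable M"
proof -
  have "(\<lambda>v::'b^'n. v $ i) \<in> borel_measurable borel"
    by (intro borel_measurable_continuous_onI continuous_intros)
  from measurable_compose[OF assms this] show ?thesis .
qed

lemma linear_sym_part: "linear (sym_part :: real^'n^'n::finite \<Rightarrow> real^'n^'n)"
  by (rule linearI) (auto simp: sym_part_def vec_eq_iff transpose_def algebra_simps)

lemma sym_part_measurable [measurable]:
  fixes f :: "'m \<Rightarrow> real^'n^'n::finite"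
  assumes [measurable]: "f \<in> borel_measurable M"
  shows "(\<lambda>x. sym_part (f x)) \<in> borel_measurable M"
proof -
  have "(sym_part :: real^'n^'n \<Rightarrow> real^'n^'n) \<in> borel_measurable borel"
    using linear_sym_part by (intro borel_measurable_continuous_onI linear_continuous_on) (simp add: linear_conv_bounded_linear)
  from measurable_compose[OF assms this] show ?thesis .
qed

lemma abs_matrix_entry_le: "\<bar>A $ i $ j\<bar> \<le> norm (A :: real^'n^'m::finite)"
  using Finite_Cartesian_Product.norm_nth_le[of A i] Finite_Cartesian_Product.norm_nth_le[of "A $ i" j] by auto

lemma abs_tensor_entry_le: "\<bar>T $ k $ i $ j\<bar> \<le> norm (T :: real^'n^'m::finite^'l::finite)"
  using Finite_Cartesian_Product.norm_nth_le[of T k] abs_matrix_entry_le[of "T $ k" i j] by linarith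

lemma norm_matrix_le_sum: "norm (A :: real^'n^'m::finite) \<le> (\<Sum>(i, j)\<in>UNIV. \<bar>A $ i $ j\<bar>)"
proof -
  have "norm A \<le> (\<Sum>i\<in>UNIV. norm (A $ i))" unfolding norm_vec_def by (rule L2_set_le_sum) auto
  also have "\<dots> \<le> (\<Sum>i\<in>UNIV. \<Sum>j\<in>UNIV. \<bar>A $ i $ j\<bar>)" by (intro sum_mono norm_le_l1_cart)
  also have "\<dots> = (\<Sum>(i, j)\<in>UNIV. \<bar>A $ i $ j\<bar>)" by (simp add: sum.cartesian_product UNIV_Times_UNIV)
  finally show ?thesis .
qed

lemma sum_powr_le:
  fixes a :: "'i \<Rightarrow> real"
  assumes "finite I" "I \<noteq> {}" "\<And>i. i \<in> I \<Longrightarrow> 0 \<le> a i" "0 \<le> p"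
  shows "(\<Sum>i\<in>I. a i) powr p \<le> real (card I) powr p * (\<Sum>i\<in>I. a i powr p)"
proof -
  define m where "m = Max (a ` I)"
  have "m \<in> a ` I" unfolding m_def using assms by (intro Max_in) auto
  then obtain j where j: "j \<in> I" "m = a j" by auto
  have "(\<Sum>i\<in>I. a i) \<le> real (card I) * m"
    using assms by (intro sum_bounded_above) (auto simp: m_def)
  then have "(\<Sum>i\<in>I. a i) powr p \<le> (real (card I) * m) powr p"
    using assms by (intro powr_mono2) (auto intro: sum_nonneg)
  also have "\<dots> = real (card I) powr p * a j powr p" using j assms by (simp add: powr_mult)
  also have "\<dots> \<le> real (card I) powr p * (\<Sum>i\<in>I. a i powr p)"
    using j assms by (intro mult_left_mono member_le_sum) auto
  finally show ?thesis .
qed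

text \<open>Integrability of u itself comes from the bounded support: inside the ball |u| is at most
  1 + |u|^p, and outside it u vanishes.\<close>

lemma Lp_component:
  fixes F :: "real^'n \<Rightarrow> 'b::euclidean_space" and u :: "real^'n \<Rightarrow> real"
  assumes p: "1 < p" and um[measurable]: "u \<in> borel_measurable borel" and Fm[measurable]: "F \<in> borel_measurable borel"
    and F: "integrable lborel (\<lambda>x. norm (F x) powr p)" and supp: "\<And>x. r < norm x \<Longrightarrow> F x = 0"
    and c: "0 \<le> c" and le: "\<And>x. \<bar>u x\<bar> \<le> c * norm (F x)"
  shows "integrable lborel u" "integrable lborel (\<lambda>x. \<bar>u x\<bar> powr p)"
    "(LBINT x. \<bar>u x\<bar> powr p) \<le> c powr p * (LBINT x. norm (F x) powr p)"
proof -
  have *: "\<bar>u x\<bar> powr p \<le> c powr p * norm (F x) powr p" for x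
    using powr_mono2[OF _ _ le[of x], of p] p c by (simp add: powr_mult)
  show i: "integrable lborel (\<lambda>x. \<bar>u x\<bar> powr p)"
  proof (rule Bochner_Integration.integrable_bound)
    show "integrable lborel (\<lambda>x. c powr p * norm (F x) powr p)" using F by auto
  qed (use * in auto)
  show "(LBINT x. \<bar>u x\<bar> powr p) \<le> c powr p * (LBINT x. norm (F x) powr p)"
    using integral_mono[OF i _ *] F by simp
  show "integrable lborel u"
  proof (rule Bochner_Integration.integrable_bound)
    have "emeasure lborel (cball (0 :: real^'n) r) < \<infinity>" by (rule emeasure_bounded_finite) simp
    then show "integrable lborel (\<lambda>x. indicator (cball (0 :: real^'n) r) x + \<bar>u x\<bar> powr p)"
      using i by (intro Bochner_Integration.integrable_add integrable_real_indicator) auto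
    have "\<bar>u x\<bar> \<le> indicator (cball 0 r) x + \<bar>u x\<bar> powr p" for x
    proof (cases "r < norm x")
      case True
      then show ?thesis using le[of x] supp[of x] by simp
    next
      case False
      have "\<bar>u x\<bar> \<le> 1 + \<bar>u x\<bar> powr p"
      proof (cases "\<bar>u x\<bar> \<le> 1")
        case True
        then show ?thesis by (simp add: add_increasing2)
      next
        case False
        then have "\<bar>u x\<bar> powr 1 \<le> \<bar>u x\<bar> powr p" using p by (intro powr_mono) auto
        then show ?thesis using False by simp
      qed
      with False show ?thesis by simp
    qed
    then show "AE x in lborel. norm (u x) \<le> norm (indicator (cball 0 r) x + \<bar>u x\<bar> powr p)"
      by (intro AE_I2) (smt (verit) real_norm_def)
  qed auto
qed

text \<open>Incompatible version of the classical argument for Korn's inequality: for a gradient F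
  the tensor C vanishes and the derivatives of the skew part are combinations of derivatives of the
  symmetric part; in general C enters as a term of order zero. Each entry of the skew part is then
  bounded by duality.\<close>

lemma whole_space_korn:
  assumes p: "1 < p" and r: "0 < r"
  obtains K :: real where "0 \<le> K"
    "\<And>(F :: real^'n \<Rightarrow> real^'n^'n) (C :: real^'n \<Rightarrow> real^'n^'n^'n).
      F \<in> borel_measurable borel \<Longrightarrow> C \<in> borel_measurable borel \<Longrightarrow>
      (\<And>x. r < norm x \<Longrightarrow> F x = 0) \<Longrightarrow> (\<And>x. r < norm x \<Longrightarrow> C x = 0) \<Longrightarrow>
      integrable lborel (\<lambda>x. norm (F x) powr p) \<Longrightarrow> integrable lborel (\<lambda>x. norm (C x) powr p) \<Longrightarrow>
      (\<And>k i j \<phi>. test \<phi> \<Longrightarrow> (LBINT x. C x $ k $ i $ j * \<phi> x)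
         = (LBINT x. F x $ k $ i * partial j \<phi> x) - (LBINT x. F x $ k $ j * partial i \<phi> x)) \<Longrightarrow>
      (LBINT x. norm (F x) powr p) \<le> K * ((LBINT x. norm (sym_part (F x)) powr p)
         + (LBINT x. norm (C x) powr p))"
proof -
  \<comment> \<open>An integer, so that the shift 2 R is a whole number of lattice differences, and
    strictly above r, which leaves room for the smooth cutoffs.\<close>
  define R where "R = Suc (nat \<lceil>r\<rceil>)"
  have R: "r < real R" unfolding R_def by linarith
  define q where "q = conjugate_exponent p"
  show thesis
  proof (rule weak_gradient_bound[OF p, where R = R and 'n = 'n, folded q_def], goal_cases)
  case (1 C1)
  note C1 = 1(1) and wg = 1(2)
  define N where "N = real CARD('n)"
  have N: "1 \<le> N" by (simp add: N_def Suc_leI)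
  define K1 where "K1 = 2 * C1 * (2 * C1 + 2) powr (p - 1)"
  define K2 where "K2 = K1 * (N * N * 2 powr p)"
  \<comment> \<open>\<open>K2\<close> bounds one entry of the skew part. The power of
    \<open>N * N\<close> comes from estimating the Frobenius norm by the sum of the n^2 entries, and
    \<open>2 powr p\<close> from splitting each entry into symmetric and skew part.\<close>
  define K where "K = (N * N) powr p * (2 powr p * (N * N * (1 + K2)))"
  have K1: "0 \<le> K1" and K2: "0 \<le> K2" and K: "0 \<le> K" using C1 N by (auto simp: K1_def K2_def K_def)
  show thesis
  proof (rule that[OF K])
    fix F :: "real^'n \<Rightarrow> real^'n^'n" and C :: "real^'n \<Rightarrow> real^'n^'n^'n"
    assume [measurable]: "F \<in> borel_measurable borel" "C \<in> borel_measurable borel"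
      and F0: "\<And>x. r < norm x \<Longrightarrow> F x = 0" and C0: "\<And>x. r < norm x \<Longrightarrow> C x = 0"
      and Fp: "integrable lborel (\<lambda>x. norm (F x) powr p)" and Cp: "integrable lborel (\<lambda>x. norm (C x) powr p)"
      and weak: "\<And>k i j \<phi>. test \<phi> \<Longrightarrow> (LBINT x. C x $ k $ i $ j * \<phi> x)
         = (LBINT x. F x $ k $ i * partial j \<phi> x) - (LBINT x. F x $ k $ j * partial i \<phi> x)"
    define Sf where "Sf = (\<lambda>x. sym_part (F x))"
    have [measurable]: "Sf \<in> borel_measurable borel" unfolding Sf_def by measurable
    have Sf0: "Sf x = 0" if "r < norm x" for x
      using F0[OF that] linear_0[OF linear_sym_part] by (simp add: Sf_def)
    define A where "A = (\<lambda>a b x. (F x $ a $ b - F x $ b $ a) / 2)"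
    have Sf: "Sf x $ a $ b = (F x $ a $ b + F x $ b $ a) / 2" for a b x
      by (simp add: Sf_def sym_part_def transpose_def)
    \<comment> \<open>In this combination of curls the terms with D_i add up to 2 D_i A_ab, and all
      the others pair up to derivatives of F_ai + F_ia and F_bi + F_ib, that is, of symmetric
      entries.\<close>
    define E where "E = (\<lambda>a b i x. (C x $ a $ i $ b - C x $ b $ i $ a + C x $ i $ a $ b) / 2)"
    \<comment> \<open>Divergence form: the sum over l of D_l S_l is D_b Sf_ai - D_a Sf_bi.\<close>
    define S where "S = (\<lambda>a b i l x. (if l = b then Sf x $ a $ i else 0) - (if l = a then Sf x $ b $ i else 0))"
    have Am[measurable]: "A a b \<in> borel_measurable borel" for a b unfolding A_def by measurable
    have Em[measurable]: "E a b i \<in> borel_measurable borel" for a b i unfolding E_def by measurable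
    have Sm[measurable]: "S a b i l \<in> borel_measurable borel" for a b i l unfolding S_def by measurable
    have Sfp: "integrable lborel (\<lambda>x. norm (Sf x) powr p)"
    proof -
      have "norm (Sf x) \<le> real (CARD('n \<times> 'n)) * norm (F x)" for x
      proof -
        have "norm (Sf x) \<le> (\<Sum>(i, j)\<in>UNIV. \<bar>Sf x $ i $ j\<bar>)" by (rule norm_matrix_le_sum)
        also have "\<dots> \<le> (\<Sum>z\<in>(UNIV :: ('n \<times> 'n) set). norm (F x))"
        proof (intro sum_mono, clarify)
          fix i j
          show "\<bar>Sf x $ i $ j\<bar> \<le> norm (F x)"
            using abs_matrix_entry_le[of "F x" i j] abs_matrix_entry_le[of "F x" j i] by (simp add: Sf)
        qed
        finally show ?thesis by simp
      qed
      then show ?thesis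
        using Lp_component(2)[where u = "\<lambda>x. norm (Sf x)" and c = "real (CARD('n \<times> 'n))", OF p _ _ Fp F0] by simp
    qed
    have A: "integrable lborel (A a b)" "integrable lborel (\<lambda>x. \<bar>A a b x\<bar> powr p)" for a b
    proof -
      have le: "\<bar>A a b x\<bar> \<le> 1 * norm (F x)" for x
        using abs_matrix_entry_le[of "F x" a b] abs_matrix_entry_le[of "F x" b a] by (simp add: A_def)
      show "integrable lborel (A a b)" "integrable lborel (\<lambda>x. \<bar>A a b x\<bar> powr p)"
        by (rule Lp_component[OF p _ _ Fp F0 _ le]; simp)+
    qed
    have E: "integrable lborel (E a b i)" "integrable lborel (\<lambda>x. \<bar>E a b i x\<bar> powr p)"
      "(LBINT x. \<bar>E a b i x\<bar> powr p) \<le> 2 powr p * (LBINT x. norm (C x) powr p)" for a b i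
    proof -
      have le: "\<bar>E a b i x\<bar> \<le> 2 * norm (C x)" for x
        using abs_tensor_entry_le[of "C x" a i b] abs_tensor_entry_le[of "C x" b i a] abs_tensor_entry_le[of "C x" i a b]
        by (simp add: E_def)
      show "integrable lborel (E a b i)" "integrable lborel (\<lambda>x. \<bar>E a b i x\<bar> powr p)"
        "(LBINT x. \<bar>E a b i x\<bar> powr p) \<le> 2 powr p * (LBINT x. norm (C x) powr p)"
        by (rule Lp_component[OF p _ _ Cp C0 _ le]; simp)+
    qed
    have S: "integrable lborel (S a b i l)" "integrable lborel (\<lambda>x. \<bar>S a b i l x\<bar> powr p)"
      "(LBINT x. \<bar>S a b i l x\<bar> powr p) \<le> 2 powr p * (LBINT x. norm (Sf x) powr p)" for a b i l
    proof -
      have le: "\<bar>S a b i l x\<bar> \<le> 2 * norm (Sf x)" for x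
        using abs_matrix_entry_le[of "Sf x" a i] abs_matrix_entry_le[of "Sf x" b i] norm_ge_zero[of "Sf x"]
        by (auto simp: S_def simp del: norm_ge_zero)
      show "integrable lborel (S a b i l)" "integrable lborel (\<lambda>x. \<bar>S a b i l x\<bar> powr p)"
        "(LBINT x. \<bar>S a b i l x\<bar> powr p) \<le> 2 powr p * (LBINT x. norm (Sf x) powr p)"
        by (rule Lp_component[OF p _ _ Sfp Sf0 _ le]; simp)+
    qed
    have Fi: "integrable lborel (\<lambda>x. F x $ a $ b)" for a b
    proof -
      have le: "\<bar>F x $ a $ b\<bar> \<le> 1 * norm (F x)" for x using abs_matrix_entry_le by simp
      show ?thesis by (rule Lp_component[OF p _ _ Fp F0 _ le]; simp)
    qed
    have Ci: "integrable lborel (\<lambda>x. C x $ k $ a $ b)" for k a b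
    proof -
      have le: "\<bar>C x $ k $ a $ b\<bar> \<le> 1 * norm (C x)" for x using abs_tensor_entry_le by simp
      show ?thesis by (rule Lp_component[OF p _ _ Cp C0 _ le]; simp)
    qed
    have A_weak: "(LBINT x. A a b x * partial i \<phi> x) =
         (\<Sum>l\<in>UNIV. LBINT x. S a b i l x * partial l \<phi> x) - (LBINT x. E a b i x * \<phi> x)"
      if \<phi>: "test \<phi>" for a b i \<phi>
    proof -
      define f where "f = (\<lambda>a b i. LBINT x. F x $ a $ b * partial i \<phi> x)"
      define c where "c = (\<lambda>k a b. LBINT x. C x $ k $ a $ b * \<phi> x)"
      note Fint = integrable_mult_test[OF Fi test_partial[OF \<phi>]]
      note Cint = integrable_mult_test[OF Ci \<phi>]
      have cw: "c k i j = f k i j - f k j i" for k i j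
        using weak[OF \<phi>] by (simp add: c_def f_def)
      have "(LBINT x. A a b x * partial i \<phi> x) = (f a b i - f b a i) / 2"
        using Fint by (simp add: A_def f_def left_diff_distrib)
      moreover have "(LBINT x. E a b i x * \<phi> x) = (c a i b - c b i a + c i a b) / 2"
        using Cint by (simp add: E_def c_def left_diff_distrib distrib_right)
      moreover have "(\<Sum>l\<in>UNIV. LBINT x. S a b i l x * partial l \<phi> x)
        = (f a i b + f i a b) / 2 - (f b i a + f i b a) / 2"
      proof -
        have "(LBINT x. S a b i l x * partial l \<phi> x) =
           (if l = b then (f a i b + f i a b) / 2 else 0) - (if l = a then (f b i a + f i b a) / 2 else 0)" for l
        proof -
          have sf: "(LBINT x. Sf x $ a $ i * partial l \<phi> x) = (f a i l + f i a l) / 2" for a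
            using Fint by (simp add: Sf f_def distrib_right)
          have sfi: "integrable lborel (\<lambda>x. Sf x $ a $ i * partial l \<phi> x)" for a
            using Fint by (simp add: Sf distrib_right add_divide_distrib)
          have "(LBINT x. S a b i l x * partial l \<phi> x) =
             (LBINT x. (if l = b then 1 else 0) * (Sf x $ a $ i * partial l \<phi> x) - (if l = a then 1 else 0) * (Sf x $ b $ i * partial l \<phi> x))"
            by (rule arg_cong[where f = "integral\<^sup>L lborel"]) (auto simp: S_def algebra_simps)
          also have "\<dots> = (if l = b then 1 else 0) * ((f a i l + f i a l) / 2) - (if l = a then 1 else 0) * ((f b i l + f i b l) / 2)"
            using sfi by (simp add: sf)
          finally show ?thesis by simp
        qed
        then show ?thesis by (simp add: sum_subtractf)
      qed
      ultimately show ?thesis by (simp add: cw field_simps)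
    qed
    define Y where "Y = (LBINT x. norm (Sf x) powr p) + (LBINT x. norm (C x) powr p)"
    have Y: "0 \<le> (LBINT x. norm (Sf x) powr p)" "0 \<le> (LBINT x. norm (C x) powr p)"
      by (auto intro!: Bochner_Integration.integral_nonneg)
    have Ab: "(LBINT x. \<bar>A a b x\<bar> powr p) \<le> K2 * Y" for a b
    proof -
      define X where "X = (\<Sum>i\<in>UNIV. LBINT x. \<bar>E a b i x\<bar> powr p)
        + (\<Sum>i\<in>UNIV. \<Sum>l\<in>UNIV. LBINT x. \<bar>S a b i l x\<bar> powr p)"
      have A0: "A a b x = 0" if "r < norm x" for x using F0[OF that] by (simp add: A_def)
      have "(LBINT x. \<bar>A a b x\<bar> powr p) \<le> K1 * X"
        unfolding K1_def
      proof (rule Lp_bound_by_duality[OF p A r R A0 C1])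
        fix G :: "real^'n \<Rightarrow> real"
        assume G: "test G" "\<And>x. real R \<le> norm x \<Longrightarrow> G x = 0"
        show "\<bar>LBINT x. A a b x * G x\<bar> \<le> C1 * (X + (LBINT x. \<bar>G x\<bar> powr conjugate_exponent p))"
          unfolding X_def q_def[symmetric]
          by (rule wg[OF A(1) _ E(1,2) S(1,2) A_weak G]) (use A0 R in auto)
      qed
      also have "\<dots> \<le> K1 * (N * N * 2 powr p * Y)"
      proof (rule mult_left_mono[OF _ K1])
        have "X \<le> (\<Sum>i\<in>(UNIV::'n set). 2 powr p * (LBINT x. norm (C x) powr p))
          + (\<Sum>i\<in>(UNIV::'n set). \<Sum>l\<in>(UNIV::'n set). 2 powr p * (LBINT x. norm (Sf x) powr p))"
          unfolding X_def by (intro add_mono sum_mono E(3) S(3))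
        also have "\<dots> = N * (2 powr p * (LBINT x. norm (C x) powr p)) + N * N * (2 powr p * (LBINT x. norm (Sf x) powr p))"
          by (simp add: N_def)
        also have "\<dots> \<le> N * N * (2 powr p * (LBINT x. norm (C x) powr p)) + N * N * (2 powr p * (LBINT x. norm (Sf x) powr p))"
          using N Y mult_left_mono[OF N, of N] by (intro add_mono mult_right_mono) auto
        finally show "X \<le> N * N * 2 powr p * Y" by (simp add: Y_def algebra_simps)
      qed
      finally show ?thesis by (simp add: K2_def mult_ac)
    qed
    have pt: "norm (F x) powr p \<le> (N * N) powr p * (\<Sum>z\<in>UNIV. 2 powr p * (norm (Sf x) powr p + \<bar>A (fst z) (snd z) x\<bar> powr p))" for x
    proof -
      have "norm (F x) \<le> (\<Sum>(i, j)\<in>UNIV. \<bar>F x $ i $ j\<bar>)" by (rule norm_matrix_le_sum)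
      also have "\<dots> \<le> (\<Sum>z\<in>UNIV. norm (Sf x) + \<bar>A (fst z) (snd z) x\<bar>)"
      proof (intro sum_mono, clarify)
        fix i j
        have "F x $ i $ j = Sf x $ i $ j + A i j x" by (simp add: Sf A_def field_simps)
        then show "\<bar>F x $ i $ j\<bar> \<le> norm (Sf x) + \<bar>A (fst (i, j)) (snd (i, j)) x\<bar>"
          using abs_matrix_entry_le[of "Sf x" i j] by simp
      qed
      finally have "norm (F x) powr p \<le> (\<Sum>z\<in>UNIV. norm (Sf x) + \<bar>A (fst z) (snd z) x\<bar>) powr p"
        using p by (intro powr_mono2) auto
      also have "\<dots> \<le> real (card (UNIV :: ('n \<times> 'n) set)) powr p * (\<Sum>z\<in>UNIV. (norm (Sf x) + \<bar>A (fst z) (snd z) x\<bar>) powr p)"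
        using p by (intro sum_powr_le) auto
      also have "\<dots> \<le> (N * N) powr p * (\<Sum>z\<in>UNIV. 2 powr p * (norm (Sf x) powr p + \<bar>A (fst z) (snd z) x\<bar> powr p))"
      proof (intro mult_mono sum_mono)
        fix z
        show "(norm (Sf x) + \<bar>A (fst z) (snd z) x\<bar>) powr p \<le> 2 powr p * (norm (Sf x) powr p + \<bar>A (fst z) (snd z) x\<bar> powr p)"
          using powr_diff_le[of p "norm (Sf x)" "- \<bar>A (fst z) (snd z) x\<bar>"] p by simp
      qed (auto simp: N_def card_cartesian_product intro!: sum_nonneg)
      finally show ?thesis .
    qed
    have "(LBINT x. norm (F x) powr p) \<le>
      (LBINT x. (N * N) powr p * (\<Sum>z\<in>UNIV. 2 powr p * (norm (Sf x) powr p + \<bar>A (fst z) (snd z) x\<bar> powr p)))"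
      using Fp Sfp A pt by (intro integral_mono) auto
    also have "\<dots> = (N * N) powr p * (\<Sum>z\<in>UNIV. 2 powr p * ((LBINT x. norm (Sf x) powr p) + (LBINT x. \<bar>A (fst z) (snd z) x\<bar> powr p)))"
      using Sfp A by simp
    also have "\<dots> \<le> (N * N) powr p * (\<Sum>z\<in>(UNIV :: ('n \<times> 'n) set). 2 powr p * (Y + K2 * Y))"
      using Y by (intro mult_left_mono sum_mono add_mono Ab) (auto simp: Y_def)
    also have "\<dots> = K * Y"
      by (simp add: K_def N_def card_cartesian_product algebra_simps)
    finally show "(LBINT x. norm (F x) powr p) \<le> K * ((LBINT x. norm (sym_part (F x)) powr p)
         + (LBINT x. norm (C x) powr p))" by (simp add: Y_def Sf_def)
  qed
  qed
qed

text \<open>Fields on the domain are only Lebesgue measurable, while the translations and averages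
  above are treated for Borel functions. Working coordinate by coordinate reduces the choice of a
  representative to real functions; multiplication by the indicator makes the extension vanish
  everywhere outside, not just almost everywhere.\<close>

lemma borel_representative:
  fixes f :: "'a::euclidean_space \<Rightarrow> 'b::euclidean_space"
  assumes \<Omega>: "open \<Omega>" and f: "f \<in> borel_measurable (lebesgue_on \<Omega>)"
  obtains F where "F \<in> borel_measurable borel" "\<And>x. x \<notin> \<Omega> \<Longrightarrow> F x = 0"
    "AE x in lebesgue. (if x \<in> \<Omega> then f x else 0) = F x"
proof -
  have \<Omega>s: "\<Omega> \<in> sets lebesgue" "\<Omega> \<in> sets borel" using \<Omega> by auto
  define u where "u = (\<lambda>x. if x \<in> \<Omega> then f x else 0)"
  have u[measurable]: "u \<in> borel_measurable lebesgue"
    unfolding u_def using borel_measurable_if[OF \<Omega>s(1)] f by auto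
  have "\<exists>g\<in>borel_measurable lborel. AE x in lborel. u x \<bullet> b = g x" for b
    by (rule completion_ex_borel_measurable_real) measurable
  then obtain g where g: "\<And>b. g b \<in> borel_measurable lborel" "\<And>b. AE x in lborel. u x \<bullet> b = g b x"
    by metis
  define F where "F = (\<lambda>x. indicator \<Omega> x *\<^sub>R (\<Sum>b\<in>Basis. g b x *\<^sub>R b))"
  have Fm[measurable]: "F \<in> borel_measurable borel"
    using g(1) \<Omega>s(2) unfolding F_def by (simp cong: measurable_cong_sets) 
  have "AE x in lborel. \<forall>b\<in>Basis. u x \<bullet> b = g b x"
    using g(2) by (intro AE_finite_allI) auto
  then have ae: "AE x in lborel. u x = F x"
  proof (rule eventually_mono)
    fix x assume "\<forall>b\<in>Basis. u x \<bullet> b = g b x"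
    then have "(\<Sum>b\<in>Basis. g b x *\<^sub>R b) = u x" using euclidean_representation[of "u x"] by simp
    then show "u x = F x" by (simp add: F_def u_def indicator_def)
  qed
  have ae': "AE x in lebesgue. (if x \<in> \<Omega> then f x else 0) = F x"
    using AE_completion[OF ae] by (simp only: u_def)
  show thesis by (rule that[OF Fm _ ae']) (auto simp: F_def)
qed

text \<open>The general integrand \<open>H\<close> covers norms, norms of symmetric parts and
  entries times test functions at once. The condition \<open>H 0 x = 0\<close> is what makes
  extension by zero harmless.\<close>

lemma lebesgue_on_transfer:
  fixes f F :: "'a::euclidean_space \<Rightarrow> 'b::euclidean_space" and H :: "'b \<Rightarrow> 'a \<Rightarrow> real"
  assumes \<Omega>: "open \<Omega>" and f: "f \<in> borel_measurable (lebesgue_on \<Omega>)"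
    and Fm: "F \<in> borel_measurable borel" and ae: "AE x in lebesgue. (if x \<in> \<Omega> then f x else 0) = F x"
    and Hm: "(\<lambda>z. H (fst z) (snd z)) \<in> borel_measurable (borel \<Otimes>\<^sub>M borel)" and H0: "\<And>x. H 0 x = 0"
  shows "integrable (lebesgue_on \<Omega>) (\<lambda>x. H (f x) x) = integrable lborel (\<lambda>x. H (F x) x)"
    "(\<integral>x. H (f x) x \<partial>lebesgue_on \<Omega>) = (LBINT x. H (F x) x)"
proof -
  have \<Omega>s: "\<Omega> \<in> sets lebesgue" using \<Omega> by auto
  define u where "u = (\<lambda>x. if x \<in> \<Omega> then f x else 0)"
  have u: "u \<in> borel_measurable lebesgue"
    unfolding u_def using borel_measurable_if[OF \<Omega>s] f by auto
  have eq: "indicator \<Omega> x *\<^sub>R H (f x) x = H (u x) x" for x by (simp add: u_def H0 indicator_def)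
  have HF: "(\<lambda>x. H (F x) x) \<in> borel_measurable borel"
    using measurable_compose[OF measurable_Pair[OF Fm measurable_ident_sets[OF refl]] Hm] by simp
  have id: "(\<lambda>x. x) \<in> lebesgue \<rightarrow>\<^sub>M borel" by (rule measurable_completion) simp
  have Hu: "(\<lambda>x. H (u x) x) \<in> borel_measurable lebesgue"
    using measurable_compose[OF measurable_Pair[OF u id] Hm] by simp
  have HF': "(\<lambda>x. H (F x) x) \<in> borel_measurable lebesgue" using HF by (simp add: measurable_completion)
  have aeH: "AE x in lebesgue. H (u x) x = H (F x) x" using ae unfolding u_def by (auto elim: eventually_mono)
  have "integrable (lebesgue_on \<Omega>) (\<lambda>x. H (f x) x) = integrable lebesgue (\<lambda>x. H (u x) x)"
    using \<Omega>s by (subst integrable_restrict_space) (simp_all add: eq[unfolded real_scaleR_def])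
  also have "\<dots> = integrable lebesgue (\<lambda>x. H (F x) x)"
    by (rule integrable_cong_AE[OF Hu HF' aeH])
  also have "\<dots> = integrable lborel (\<lambda>x. H (F x) x)"
    using HF by (intro integrable_completion) simp
  finally show "integrable (lebesgue_on \<Omega>) (\<lambda>x. H (f x) x) = integrable lborel (\<lambda>x. H (F x) x)" .
  have "(\<integral>x. H (f x) x \<partial>lebesgue_on \<Omega>) = (\<integral>x. H (u x) x \<partial>lebesgue)"
    using \<Omega>s by (subst integral_restrict_space) (simp_all add: eq[unfolded real_scaleR_def])
  also have "\<dots> = (\<integral>x. H (F x) x \<partial>lebesgue)"
    by (rule integral_cong_AE[OF Hu HF' aeH])
  also have "\<dots> = (LBINT x. H (F x) x)"
    using HF by (intro integral_completion) simp
  finally show "(\<integral>x. H (f x) x \<partial>lebesgue_on \<Omega>) = (LBINT x. H (F x) x)" .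
qed

text \<open>By translation invariance \<open>fdiff t i \<phi>\<close> has integral 0, and it differs
  from t times the derivative by O(t^2) on a bounded set. Dividing by t and letting t tend to 0
  gives the claim without iterated integrals.\<close>

lemma integral_partial_test:
  fixes \<phi> :: "real^'n \<Rightarrow> real"
  assumes \<phi>: "test \<phi>"
  shows "(LBINT x. partial i \<phi> x) = 0"
proof -
  obtain r where r: "0 < r" "\<And>x. r < norm x \<Longrightarrow> \<phi> x = 0" using test_support[OF \<phi>] by metis
  obtain s where s: "\<And>x. s < norm x \<Longrightarrow> partial i \<phi> x = 0" using test_support[OF test_partial[OF \<phi>]] by metis
  obtain b where b: "0 \<le> b" "\<And>x. \<bar>partial i (partial i \<phi>) x\<bar> \<le> b" using test_bounded[OF test_partial[OF test_partial[OF \<phi>]]] by metis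
  define B where "B = cball (0 :: real^'n) (max (r + 1) s)"
  have Bf: "emeasure lborel B < \<infinity>" unfolding B_def by (rule emeasure_bounded_finite) simp
  have Bi: "integrable lborel (\<lambda>x. indicator B x :: real)"
    using Bf by (intro integrable_real_indicator) (auto simp: B_def)
  let ?I = "\<bar>LBINT x. partial i \<phi> x\<bar>"
  have *: "?I \<le> t * (b * measure lborel B)" if t: "0 < t" "t < 1" for t
  proof -
    have "(LBINT x. \<phi> (x + t *\<^sub>R axis i 1)) = (LBINT x. \<phi> x)"
      by (rule integral_lborel_translate) (rule test_measurable[OF \<phi>])
    then have "(LBINT x. t * partial i \<phi> x - fdiff t i \<phi> x) = t * (LBINT x. partial i \<phi> x)"
      using test_integrable[OF \<phi>] test_integrable[OF test_translate[OF \<phi>]] test_integrable[OF test_partial[OF \<phi>]]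
      by (simp add: fdiff_def)
    moreover have "\<bar>LBINT x. t * partial i \<phi> x - fdiff t i \<phi> x\<bar> \<le> (LBINT x. (b * t\<^sup>2) * indicator B x)"
    proof (rule order_trans[OF integral_abs_bound integral_mono])
      show "integrable lborel (\<lambda>x. \<bar>t * partial i \<phi> x - fdiff t i \<phi> x\<bar>)"
        by (intro integrable_abs test_integrable test_diff test_cmult test_partial test_fdiff \<phi>)
      show "integrable lborel (\<lambda>x. (b * t\<^sup>2) * indicator B x)" using Bi by auto
      fix x
      show "\<bar>t * partial i \<phi> x - fdiff t i \<phi> x\<bar> \<le> (b * t\<^sup>2) * indicator B x"
      proof (cases "x \<in> B")
        case True
        then show ?thesis using fdiff_taylor[OF \<phi> b(2), of t x] by (simp add: abs_minus_commute)
      next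
        case False
        then have x: "r + 1 < norm x" "s < norm x" by (auto simp: B_def)
        have "norm x \<le> norm (x + t *\<^sub>R axis i 1) + norm (t *\<^sub>R axis i (1::real))"
          using norm_triangle_ineq4[of "x + t *\<^sub>R axis i 1" "t *\<^sub>R axis i 1"] by simp
        then have "r < norm (x + t *\<^sub>R axis i 1)" using x t by (simp add: norm_axis_1)
        then show ?thesis using x False by (simp add: fdiff_def r s)
      qed
    qed
    ultimately have "t * ?I \<le> b * t\<^sup>2 * measure lborel B"
      using t Bf by (simp add: abs_mult)
    then show ?thesis using t by (simp add: power2_eq_square mult_ac)
  qed
  have "((\<lambda>t. t * (b * measure lborel B)) \<longlongrightarrow> 0) (at_right 0)"
    by (auto intro!: tendsto_eq_intros)
  moreover have "eventually (\<lambda>t. ?I \<le> t * (b * measure lborel B)) (at_right 0)"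
    using eventually_at_right[of 0 1] * by (auto intro!: eventually_at_rightI[of 0 1])
  ultimately have "?I \<le> 0" by (intro tendsto_lowerbound) auto
  then show ?thesis by simp
qed

section \<open>Reduction to the whole space\<close>

lemma test_function_imp_test:
  "test_function \<Omega> \<phi> \<Longrightarrow> test \<phi>"
  by (simp add: test_function_def)

lemma test_function_zero_outside:
  fixes \<phi> :: "real^'n \<Rightarrow> real"
  assumes \<phi>: "test_function \<Omega> \<phi>" and x: "x \<notin> \<Omega>"
  shows "\<phi> x = 0" "partial i \<phi> x = 0"
proof -
  have x': "x \<in> - closure {x. \<phi> x \<noteq> 0}" using assms by (auto simp: test_function_def)
  have zero: "0 = \<phi> y" if "y \<in> - closure {x. \<phi> x \<noteq> 0}" for y
    using that closure_subset[of "{x. \<phi> x \<noteq> 0}"] by auto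
  show "\<phi> x = 0" using zero[OF x'] by simp
  have "(\<phi> has_derivative (\<lambda>_. 0)) (at x)"
    by (rule has_derivative_transform_within_open[OF has_derivative_const[of 0] _ x' zero]) auto
  then show "partial i \<phi> x = 0" by (rule partial_eq)
qed

lemma integrable_lebesgue_on_scaleR:
  fixes g :: "'a::euclidean_space \<Rightarrow> real" and M :: "'b::euclidean_space"
  assumes g: "integrable lborel g" and S: "S \<in> sets lebesgue"
  shows "integrable (lebesgue_on S) (\<lambda>x. g x *\<^sub>R M)"
proof -
  have gm: "g \<in> borel_measurable lborel" using g by auto
  have "integrable lebesgue g" using g integrable_completion[OF gm] by simp
  then have "integrable lebesgue (\<lambda>x. indicator S x *\<^sub>R (g x *\<^sub>R M))"
    by (intro integrable_mult_indicator S integrable_scaleR_left)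
  then show ?thesis using S by (subst integrable_restrict_space) simp_all
qed

lemma integral_lebesgue_on_scaleR:
  fixes g :: "'a::euclidean_space \<Rightarrow> real" and M :: "'b::euclidean_space"
  assumes g: "integrable lborel g" and S: "S \<in> sets lebesgue" and z: "\<And>x. x \<notin> S \<Longrightarrow> g x = 0"
  shows "(\<integral>x. g x *\<^sub>R M \<partial>lebesgue_on S) = (LBINT x. g x) *\<^sub>R M"
proof -
  have gm: "g \<in> borel_measurable lborel" using g by auto
  have "(\<integral>x. g x *\<^sub>R M \<partial>lebesgue_on S) = (\<integral>x. indicator S x *\<^sub>R (g x *\<^sub>R M) \<partial>lebesgue)"
    using S by (subst integral_restrict_space) simp_all
  also have "(\<lambda>x. indicator S x *\<^sub>R (g x *\<^sub>R M)) = (\<lambda>x. g x *\<^sub>R M)"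
    using z by (auto simp: fun_eq_iff indicator_def of_bool_def)
  also have "(\<integral>x. g x *\<^sub>R M \<partial>lebesgue) = (LBINT x. g x *\<^sub>R M)"
    using gm by (intro integral_completion) auto
  finally show ?thesis using g by simp
qed

lemma test_scaleR_Lp:
  fixes \<phi> :: "real^'n \<Rightarrow> real" and M :: "'b::euclidean_space"
  assumes \<phi>: "test \<phi>" and S: "S \<in> sets lebesgue" and q: "0 \<le> q"
  shows "(\<lambda>x. \<phi> x *\<^sub>R M) \<in> Lp q S"
proof -
  have "(\<lambda>x. \<phi> x *\<^sub>R M) \<in> borel_measurable (lebesgue_on S)"
    using integrable_lebesgue_on_scaleR[OF test_integrable[OF \<phi>] S, of M] by auto
  moreover have "integrable (lebesgue_on S) (\<lambda>x. norm (\<phi> x *\<^sub>R M) powr q)"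
    using integrable_lebesgue_on_scaleR[OF test_powr_integrable[OF \<phi> q] S, of "norm M powr q"]
    by (simp add: powr_mult)
  ultimately show ?thesis by (simp add: Lp_def)
qed

lemma test_scaleR_weak_gradient:
  fixes \<phi> :: "real^'n \<Rightarrow> real" and M :: "'b::euclidean_space"
  assumes \<phi>: "test \<phi>" and S: "open S"
  shows "has_weak_gradient S (\<lambda>x. \<phi> x *\<^sub>R M) (\<lambda>i x. partial i \<phi> x *\<^sub>R M)"
  unfolding has_weak_gradient_def
proof (intro conjI allI impI)
  have Sl: "S \<in> sets lebesgue" using S by auto
  show "locally_integrable S (\<lambda>x. \<phi> x *\<^sub>R M)" "locally_integrable S (\<lambda>x. partial i \<phi> x *\<^sub>R M)" for i
    unfolding locally_integrable_def
    by (auto intro!: integrable_lebesgue_on_scaleR test_integrable test_partial \<phi> fmeasurableD[OF lmeasurable_compact])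
  fix i \<eta> assume \<eta>': "test_function S \<eta>"
  then have \<eta>: "test \<eta>" by (rule test_function_imp_test)
  have t: "test (\<lambda>x. \<eta> x * partial i \<phi> x)" "test (\<lambda>x. partial i \<eta> x * \<phi> x)" "test (\<lambda>x. \<eta> x * \<phi> x)"
    by (intro test_mult test_partial \<eta> \<phi> test_Ck)+
  have "(LBINT x. \<eta> x * partial i \<phi> x) + (LBINT x. partial i \<eta> x * \<phi> x)
      = (LBINT x. partial i (\<lambda>x. \<eta> x * \<phi> x) x)"
    using t \<eta> \<phi> by (simp add: partial_mult test_differentiable test_integrable)
  also have "\<dots> = 0" by (rule integral_partial_test[OF t(3)])
  finally have e: "(LBINT x. \<eta> x * partial i \<phi> x) = - (LBINT x. partial i \<eta> x * \<phi> x)" by simp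
  have "(\<integral>x. \<eta> x *\<^sub>R (partial i \<phi> x *\<^sub>R M) \<partial>lebesgue_on S) = (LBINT x. \<eta> x * partial i \<phi> x) *\<^sub>R M"
    using integral_lebesgue_on_scaleR[OF test_integrable[OF t(1)] Sl, of M] test_function_zero_outside[OF \<eta>'] by simp
  moreover have "(\<integral>x. partial i \<eta> x *\<^sub>R (\<phi> x *\<^sub>R M) \<partial>lebesgue_on S) = (LBINT x. partial i \<eta> x * \<phi> x) *\<^sub>R M"
    using integral_lebesgue_on_scaleR[OF test_integrable[OF t(2)] Sl, of M] test_function_zero_outside[OF \<eta>'] by simp
  ultimately show "(\<integral>x. \<eta> x *\<^sub>R (partial i \<phi> x *\<^sub>R M) \<partial>lebesgue_on S) = - (\<integral>x. partial i \<eta> x *\<^sub>R (\<phi> x *\<^sub>R M) \<partial>lebesgue_on S)"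
    using e by simp
qed

text \<open>The test field is \<phi> times the matrix unit at (i, j), which is not skew. Its skew
  part carries a factor 1/2, which the 2 in the trace pairing cancels. Since \<phi> need not vanish
  at the boundary, the result holds for the fields extended by zero.\<close>

lemma zero_tangential_trace_test:
  fixes v :: "real^'n \<Rightarrow> real^'n" and w :: "real^'n \<Rightarrow> real^'n^'n"
  assumes trace: "zero_tangential_trace p \<Omega> v w" and \<Omega>: "open \<Omega>" and p: "1 < p" and \<phi>: "test \<phi>"
  shows "(\<integral>x. - (w x $ i $ j * \<phi> x) + (v x $ i * partial j \<phi> x - v x $ j * partial i \<phi> x) \<partial>lebesgue_on \<Omega>) = 0"
proof -
  define q where "q = conjugate_exponent p"
  have q: "0 \<le> q" using p by (simp add: q_def conjugate_exponent_def)
  have \<Omega>l: "\<Omega> \<in> sets lebesgue" using \<Omega> by auto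
  define M :: "real^'n^'n" where "M = axis i (axis j 1)"
  define E where "E = (\<lambda>l x. partial l \<phi> x *\<^sub>R skew_part M)"
  have Q: "(\<lambda>x. \<phi> x *\<^sub>R M) \<in> W1p q \<Omega>"
    unfolding W1p_def
    by (intro CollectI conjI exI[of _ "\<lambda>i x. partial i \<phi> x *\<^sub>R M"] allI test_scaleR_Lp test_scaleR_weak_gradient
        test_partial \<phi> \<Omega> \<Omega>l q)
  have "(\<lambda>x. skew_part (\<phi> x *\<^sub>R M)) = (\<lambda>x. \<phi> x *\<^sub>R skew_part M)"
    by (auto simp: skew_part_def vec_eq_iff transpose_def algebra_simps)
  then have QE: "has_weak_gradient \<Omega> (\<lambda>x. skew_part (\<phi> x *\<^sub>R M)) E"
    unfolding E_def using test_scaleR_weak_gradient[OF \<phi> \<Omega>] by simp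
  have E: "E l \<in> Lp q \<Omega>" for l
    unfolding E_def by (rule test_scaleR_Lp[OF test_partial[OF \<phi>] \<Omega>l q])
  have "(\<integral>x. - (w x \<bullet> (\<phi> x *\<^sub>R M)) + 2 * (v x \<bullet> Div E x) \<partial>lebesgue_on \<Omega>) = 0"
    by (rule trace[unfolded zero_tangential_trace_def, folded q_def, rule_format, OF Q]) (use E QE in simp)
  moreover have "w x \<bullet> (\<phi> x *\<^sub>R M) = w x $ i $ j * \<phi> x" for x
    by (simp add: M_def inner_axis)
  moreover have "2 * (v x \<bullet> Div E x) = v x $ i * partial j \<phi> x - v x $ j * partial i \<phi> x" for x
  proof -
    have Mac: "M $ a $ c = (if a = i then 1 else 0) * (if c = j then 1 else 0)" for a c
      by (simp add: M_def axis_def)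
    have delta: "(\<Sum>c\<in>UNIV. f c * (if c = l then 1 else 0)) = f l" for f :: "'n \<Rightarrow> real" and l
    proof -
      have "f c * (if c = l then 1 else 0) = (if c = l then f c else 0)" for c by simp
      then show ?thesis by simp
    qed
    have "2 * (v x \<bullet> Div E x) = (\<Sum>a\<in>UNIV. v x $ a * (\<Sum>c\<in>UNIV. partial c \<phi> x * (M $ a $ c - M $ c $ a)))"
      by (simp add: inner_vec_def Div_def E_def skew_part_def transpose_def sum_distrib_left mult_ac)
    also have "(\<lambda>a. \<Sum>c\<in>UNIV. partial c \<phi> x * (M $ a $ c - M $ c $ a))
       = (\<lambda>a. partial j \<phi> x * (if a = i then 1 else 0) - partial i \<phi> x * (if a = j then 1 else 0))"
    proof
      fix a
      have "(\<Sum>c\<in>UNIV. partial c \<phi> x * (M $ a $ c - M $ c $ a))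
        = (if a = i then 1 else 0) * (\<Sum>c\<in>UNIV. partial c \<phi> x * (if c = j then 1 else 0))
         - (if a = j then 1 else 0) * (\<Sum>c\<in>UNIV. partial c \<phi> x * (if c = i then 1 else 0))"
        unfolding sum_distrib_left sum_subtractf[symmetric] Mac by (rule sum.cong) (simp_all only: right_diff_distrib mult_ac)
      then show "(\<Sum>c\<in>UNIV. partial c \<phi> x * (M $ a $ c - M $ c $ a))
        = partial j \<phi> x * (if a = i then 1 else 0) - partial i \<phi> x * (if a = j then 1 else 0)"
        unfolding delta by (simp only: mult.commute)
    qed
    also have "(\<Sum>a\<in>UNIV. v x $ a * (partial j \<phi> x * (if a = i then 1 else 0) - partial i \<phi> x * (if a = j then 1 else 0)))
       = v x $ i * partial j \<phi> x - v x $ j * partial i \<phi> x"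
      unfolding right_diff_distrib sum_subtractf mult.assoc[symmetric] delta ..
    finally show ?thesis .
  qed
  ultimately show ?thesis by (simp only:)
qed

theorem theorem4p3:
  fixes \<Omega> :: "(real^'n::finite) set" and p :: real
  assumes "CARD('n) \<ge> 2"
    and "bounded_lipschitz_domain \<Omega>"
    and "1 < p"
  shows "\<exists>c>0. \<forall>P \<in> W1p_Curl_0 p \<Omega>. \<forall>C \<in> Lp p \<Omega>. has_weak_Curl \<Omega> P C \<longrightarrow>
           Lp_norm p \<Omega> P \<le> c * (Lp_norm p \<Omega> (\<lambda>x. sym_part (P x)) + Lp_norm p \<Omega> C)"
proof -
  note p = \<open>1 < p\<close>
  have \<Omega>: "open \<Omega>" and \<Omega>b: "bounded \<Omega>" using assms(2) by (auto simp: bounded_lipschitz_domain_def)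
  obtain r where r: "0 < r" and \<Omega>r: "\<And>x. x \<in> \<Omega> \<Longrightarrow> norm x \<le> r" using \<Omega>b by (auto simp: bounded_pos)
  show ?thesis
  proof (rule whole_space_korn[OF p r, where 'n = 'n], goal_cases)
  case (1 K)
  note K = 1(1) and korn = 1(2)
  \<comment> \<open>The summand 1 makes the constant positive; the factor
    \<open>2 powr (1 / p)\<close> separates the p-th root of the sum of the two integrals.\<close>
  define c where "c = (K + 1) powr (1 / p) * 2 powr (1 / p)"
  have "0 < c" using K by (simp add: c_def)
  moreover have "Lp_norm p \<Omega> P \<le> c * (Lp_norm p \<Omega> (\<lambda>x. sym_part (P x)) + Lp_norm p \<Omega> C)"
    if P: "P \<in> W1p_Curl_0 p \<Omega>" and C: "C \<in> Lp p \<Omega>" and curl: "has_weak_Curl \<Omega> P C" for P C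
  proof -
    \<comment> \<open>The trace condition in \<open>W1p_Curl_0\<close> is imposed for every weak
      curl in L^p, so it applies to the given \<open>C\<close>.\<close>
    have trace: "zero_tangential_trace p \<Omega> (\<lambda>x. row k (P x)) (\<lambda>x. C x $ k)" for k
      using P C curl by (auto simp: W1p_Curl_0_def)
    have PL: "P \<in> borel_measurable (lebesgue_on \<Omega>)" "integrable (lebesgue_on \<Omega>) (\<lambda>x. norm (P x) powr p)"
      using P by (auto simp: W1p_Curl_0_def W1p_Curl_def Lp_def)
    have CL: "C \<in> borel_measurable (lebesgue_on \<Omega>)" "integrable (lebesgue_on \<Omega>) (\<lambda>x. norm (C x) powr p)"
      using C by (auto simp: Lp_def)
    obtain F where Fm[measurable]: "F \<in> borel_measurable borel" and F0: "\<And>x. x \<notin> \<Omega> \<Longrightarrow> F x = 0"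
      and Fae: "AE x in lebesgue. (if x \<in> \<Omega> then P x else 0) = F x"
      by (rule borel_representative[OF \<Omega> PL(1)]) blast
    obtain D where Dm[measurable]: "D \<in> borel_measurable borel" and D0: "\<And>x. x \<notin> \<Omega> \<Longrightarrow> D x = 0"
      and Dae: "AE x in lebesgue. (if x \<in> \<Omega> then C x else 0) = D x"
      by (rule borel_representative[OF \<Omega> CL(1)]) blast
    note Fi = lebesgue_on_transfer(1)[OF \<Omega> PL(1) Fm Fae] and FI = lebesgue_on_transfer(2)[OF \<Omega> PL(1) Fm Fae]
    note Di = lebesgue_on_transfer(1)[OF \<Omega> CL(1) Dm Dae] and DI = lebesgue_on_transfer(2)[OF \<Omega> CL(1) Dm Dae]
    have Fr: "F x = 0" and Dr: "D x = 0" if "r < norm x" for x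
      using \<Omega>r[of x] that F0[of x] D0[of x] by force+
    have Fp: "integrable lborel (\<lambda>x. norm (F x) powr p)"
      using PL(2) Fi[of "\<lambda>y x. norm y powr p"] p by simp
    have Dp: "integrable lborel (\<lambda>x. norm (D x) powr p)"
      using CL(2) Di[of "\<lambda>y x. norm y powr p"] p by simp
    have weak: "(LBINT x. D x $ k $ i $ j * \<phi> x)
         = (LBINT x. F x $ k $ i * partial j \<phi> x) - (LBINT x. F x $ k $ j * partial i \<phi> x)"
      if \<phi>: "test \<phi>" for k i j \<phi>
    proof -
      have [measurable]: "\<phi> \<in> borel_measurable borel" "partial l \<phi> \<in> borel_measurable borel" for l
        using test_measurable[OF \<phi>] test_measurable[OF test_partial[OF \<phi>]] by auto
      have a: "integrable (lebesgue_on \<Omega>) (\<lambda>x. P x $ k $ a * partial l \<phi> x)"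
        "(\<integral>x. P x $ k $ a * partial l \<phi> x \<partial>lebesgue_on \<Omega>) = (LBINT x. F x $ k $ a * partial l \<phi> x)" for a l
      proof -
        have le: "\<bar>F x $ k $ a\<bar> \<le> 1 * norm (F x)" for x using abs_matrix_entry_le by simp
        have "integrable lborel (\<lambda>x. F x $ k $ a)"
          by (rule Lp_component[OF p _ _ Fp Fr _ le]; simp)
        from integrable_mult_test[OF this test_partial[OF \<phi>]]
        show "integrable (lebesgue_on \<Omega>) (\<lambda>x. P x $ k $ a * partial l \<phi> x)"
          using Fi[of "\<lambda>y x. y $ k $ a * partial l \<phi> x"] by simp
        show "(\<integral>x. P x $ k $ a * partial l \<phi> x \<partial>lebesgue_on \<Omega>) = (LBINT x. F x $ k $ a * partial l \<phi> x)"
          using FI[of "\<lambda>y x. y $ k $ a * partial l \<phi> x"] by simp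
      qed
      have b: "integrable (lebesgue_on \<Omega>) (\<lambda>x. C x $ k $ i $ j * \<phi> x)"
        "(\<integral>x. C x $ k $ i $ j * \<phi> x \<partial>lebesgue_on \<Omega>) = (LBINT x. D x $ k $ i $ j * \<phi> x)"
      proof -
        have le: "\<bar>D x $ k $ i $ j\<bar> \<le> 1 * norm (D x)" for x using abs_tensor_entry_le by simp
        have "integrable lborel (\<lambda>x. D x $ k $ i $ j)"
          by (rule Lp_component[OF p _ _ Dp Dr _ le]; simp)
        from integrable_mult_test[OF this \<phi>]
        show "integrable (lebesgue_on \<Omega>) (\<lambda>x. C x $ k $ i $ j * \<phi> x)"
          using Di[of "\<lambda>y x. y $ k $ i $ j * \<phi> x"] by simp
        show "(\<integral>x. C x $ k $ i $ j * \<phi> x \<partial>lebesgue_on \<Omega>) = (LBINT x. D x $ k $ i $ j * \<phi> x)"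
          using DI[of "\<lambda>y x. y $ k $ i $ j * \<phi> x"] by simp
      qed
      show ?thesis
        using zero_tangential_trace_test[OF trace[of k] \<Omega> p \<phi>, of i j] a b by (simp add: row_def)
    qed
    define I where "I = (\<integral>x. norm (P x) powr p \<partial>lebesgue_on \<Omega>)"
    define J where "J = (\<integral>x. norm (sym_part (P x)) powr p \<partial>lebesgue_on \<Omega>)"
    define L where "L = (\<integral>x. norm (C x) powr p \<partial>lebesgue_on \<Omega>)"
    have nn: "0 \<le> I" "0 \<le> J" "0 \<le> L"
      by (auto simp: I_def J_def L_def intro!: Bochner_Integration.integral_nonneg)
    have "I = (LBINT x. norm (F x) powr p)"
      unfolding I_def using FI[of "\<lambda>y x. norm y powr p"] p by simp
    moreover have "J = (LBINT x. norm (sym_part (F x)) powr p)"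
      unfolding J_def using FI[of "\<lambda>y x. norm (sym_part y) powr p"] p linear_0[OF linear_sym_part] by simp
    moreover have "L = (LBINT x. norm (D x) powr p)"
      unfolding L_def using DI[of "\<lambda>y x. norm y powr p"] p by simp
    ultimately have "I \<le> K * (J + L)"
      using korn[OF Fm Dm Fr Dr Fp Dp weak] by simp
    also have "\<dots> \<le> (K + 1) * (J + L)" using nn by (intro mult_right_mono) auto
    finally have "I powr (1 / p) \<le> ((K + 1) * (J + L)) powr (1 / p)"
      using nn p by (intro powr_mono2) auto
    also have "\<dots> = (K + 1) powr (1 / p) * (J + L) powr (1 / p)"
      using K nn by (simp add: powr_mult)
    also have "\<dots> \<le> (K + 1) powr (1 / p) * (2 powr (1 / p) * (J powr (1 / p) + L powr (1 / p)))"
      \<comment> \<open>The sign of \<open>L\<close> turns the bound for differences into one for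
        the sum J + L.\<close>
      using powr_diff_le[of "1 / p" J "- L"] p nn by (intro mult_left_mono) auto
    finally show ?thesis
      by (simp add: Lp_norm_def I_def J_def L_def c_def mult.assoc)
  qed
  ultimately show ?thesis by blast
  qed
qed

end
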